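(* Let $\Gamma$ be a discrete cocompact subgroup of $\mathrm{PSU}(1,1)$ and $\mathfrak{g}$ the space of Killing vector fields on $\mathbb{D}$. Let $\varPhi:\mathrm{HQD}(\mathbb{D},\Gamma)\to H^1(\Gamma;\mathfrak{g})$ be the map $q\mapsto[\delta\chi]$, where $\chi$ is a harmonic vector field on $\mathbb{D}$ with $(\mathcal{L}_\chi\mathbf{g}_{\mathbb{D}})^{(2,0)}=q$ admitting an $L^2$-extension to $\overline{\mathbb{D}}$ whose restriction to $\mathbb{S}^1$ is tangential. Let $\varPsi:H^1(\Gamma;\mathfrak{g})\to\mathrm{HQD}(\mathbb{D},\Gamma)$ be the map $[c]\mapsto(\mathcal{L}_{\mathcal{F}(\psi^\sharp)}\mathbf{g}_{\mathbb{D}})^{(2,0)}$, where $\psi$ is a smooth vector field on $\mathbb{D}$ with $\delta\psi=c$ and $\psi^\sharp$ is the (tangential) restriction to $\mathbb{S}^1$ of its $L^2$-extension to $\overline{\mathbb{D}}$. Then $$\varPhi\circ\varPsi=\mathrm{Id}.$$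
   Context: $\mathbb{D}=\{|z|<1\}$ carries $\mathbf{g}_{\mathbb{D}}=4(dx^2+dy^2)/(1-|z|^2)^2$. $\mathrm{PSU}(1,1)$ acts on $\mathbb{D}$ by $\gamma(z)=\frac{az+b}{\bar bz+\bar a}$, $|a|^2-|b|^2=1$, as the group of orientation preserving isometries. Vector fields are identified with $\mathbb{C}$-valued functions. $\mathrm{HQD}(\mathbb{D},\Gamma)$ is the vector space of holomorphic quadratic differentials $f\,dz^2$ on $\mathbb{D}$ with $f(\gamma(z))\gamma'(z)^2=f(z)$ for all $\gamma\in\Gamma$. The maps $\varPhi$ and $\varPsi$ are well defined: $\chi$ exists and is unique up to Killing vector fields, and $\psi$ exists for every cocycle $c$, with any such $\psi$ admitting an $L^2$-extension with tangential restriction $\psi^\sharp$. Cohomology: $\Gamma$ acts on vector fields on $\mathbb{D}$ by $(\gamma^*F)(z)=F(\gamma(z))\gamma'(z)^{-1}$. A $1$-cocycle is a map $c:\Gamma\to\mathfrak{g}$ with $c_{\gamma_1\circ\gamma_2}=\gamma_2^*c_{\gamma_1}+c_{\gamma_2}$; the coboundary of a vector field $F$ is $\delta F:\gamma\mapsto\gamma^*F-F$; $H^1(\Gamma;\mathfrak{g})$ is the space of $\mathfrak{g}$-valued cocycles modulo coboundaries of elements of $\mathfrak{g}$. $L^2$-extension: a continuous vector field $X$ on $\mathbb{D}$ has an $L^2$-extension to $\overline{\mathbb{D}}$ if the vector fields $X_\epsilon(z)=X((1-\epsilon)z)$ on $\mathbb{S}^1$ converge as $\epsilon\to0$ in the Hilbert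 space of $L^2$-vector fields ($\mathbb{C}$-valued functions) on $\mathbb{S}^1$; the limit is the restriction of the extension to $\mathbb{S}^1$. An $L^2$-vector field on $\mathbb{S}^1$ is tangential if it is of the form $z\mapsto f(z)\,iz$ with $f$ real-valued. The map $\mathcal{F}$: for a tangential vector field $X(z)=f(z)\,iz$ on $\mathbb{S}^1$, $$\mathcal{F}(X)(z)=(f*\mathbf{K})(z)=\frac1{2\pi}\int_{\mathbb{S}^1}f(w)\,w\,\mathbf{K}(zw^{-1})\,dw,\qquad \mathbf{K}(z)=\frac{i(1-|z|^2)^3}{|1-\bar z|^2(1-\bar z)^2},$$ with $dw$ arc length on $\mathbb{S}^1$. Harmonic vector field: for a smooth map $\phi:U\to \mathbb{D}$ from an open set $U\subseteq \mathbb{D}$, the tension field is $\tau(\phi)=\mathrm{trace}(\nabla d\phi)$, with $\nabla$ induced by the Levi-Civita connections. A smooth vector field $\xi$ on $U$ is harmonic if there is a smooth family of smooth maps $\phi_t:U\to \mathbb{D}$, $t\in[0,\epsilon)$, such that $\phi_0$ is the inclusion, $\frac{d\phi_t}{dt}|_{t=0}=\xi$, and $\frac{d}{dt}|_{t=0}\tau(\phi_t)(x)=0$ for all $x\in U$ (in the standard coordinates of $\mathbb{C}$). $(2,0)$-part: the trace-free part of the Lie derivative $\mathcal{L}_\xi\mathbf{g}_{\mathbb{D}}$ can be written uniquely as the real part of $h\,dz^2$ with $h$ complex-valued, and $(\mathcal{L}_\xi\mathbf{g}_{\mathbb{D}})^{(2,0)}:=h\,dz^2$. *)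

theory Defs
  imports "HOL-Analysis.Analysis" "HOL-Algebra.Coset"
begin

primrec C_k_on :: "nat \<Rightarrow> 'a::euclidean_space set \<Rightarrow> ('a \<Rightarrow> 'b::real_normed_vector) \<Rightarrow> bool"
  where
    "C_k_on 0 U f \<longleftrightarrow> continuous_on U f"
  | "C_k_on (Suc k) U f \<longleftrightarrow>
       f differentiable_on U \<and> (\<forall>v. C_k_on k U (\<lambda>x. frechet_derivative f (at x) v))"

text \<open>\<open>C_k_on\<close> is only meant for open sets. On an arbitrary set, smooth means locally the
  restriction of a smooth function on an open set; this is needed for the parameter
  interval \<open>[0, \<epsilon>)\<close> in the definition of harmonic vector fields.\<close>

definition smooth_on :: "'a::euclidean_space set \<Rightarrow> ('a \<Rightarrow> 'b::real_normed_vector) \<Rightarrow> bool"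
  where "smooth_on A f \<longleftrightarrow>
    (\<forall>x\<in>A. \<exists>V F. open V \<and> x \<in> V \<and> (\<forall>k. C_k_on k V F) \<and> (\<forall>y\<in>V \<inter> A. F y = f y))"

abbreviation disc :: "complex set"
  where "disc \<equiv> ball 0 1"

definition SU11 :: "(complex \<times> complex) set"
  where "SU11 = {(a, b). (cmod a)\<^sup>2 - (cmod b)\<^sup>2 = 1}"

text \<open>The matrix with first row \<open>(a, b)\<close> and second row \<open>(cnj b, cnj a)\<close> acts on the disc. Working
  with extensional functions on the disc identifies \<open>(a, b)\<close> with \<open>(-a, -b)\<close> and nothing else.\<close>

definition mobius :: "complex \<times> complex \<Rightarrow> complex \<Rightarrow> complex"
  where "mobius = (\<lambda>(a, b). \<lambda>z\<in>disc. (a * z + b) / (cnj b * z + cnj a))"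

definition PSU11 :: "(complex \<Rightarrow> complex) monoid"
  where "PSU11 = \<lparr>carrier = mobius ` SU11, mult = compose disc, one = (\<lambda>z\<in>disc. z)\<rparr>"

lemma mobius_denom_nonzero:
  assumes "(a, b) \<in> SU11" "z \<in> disc"
  shows "cnj b * z + cnj a \<noteq> 0"
proof
  assume "cnj b * z + cnj a = 0"
  then have "cnj a = - (cnj b * z)"
    by (simp add: add_eq_0_iff)
  then have "cmod (cnj a) = cmod (- (cnj b * z))"
    by simp
  then have eq: "cmod a = cmod b * cmod z"
    by (simp add: norm_mult)
  have "cmod b * cmod z \<le> cmod b * 1"
    using assms(2) by (intro mult_left_mono) auto
  then have "(cmod a)\<^sup>2 \<le> (cmod b)\<^sup>2"
    unfolding eq by (intro power_mono) auto
  moreover have "(cmod a)\<^sup>2 - (cmod b)\<^sup>2 = 1"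
    using assms(1) by (simp add: SU11_def)
  ultimately show False
    by linarith
qed

lemma SU11_iff: "(a, b) \<in> SU11 \<longleftrightarrow> a * cnj a - b * cnj b = 1"
proof -
  have "a * cnj a - b * cnj b = of_real ((cmod a)\<^sup>2 - (cmod b)\<^sup>2)"
    by (simp add: complex_norm_square[symmetric])
  then show ?thesis
    by (simp add: SU11_def del: of_real_diff)
qed

lemma mobius_in_disc:
  assumes ab: "(a, b) \<in> SU11" and z: "z \<in> disc"
  shows "mobius (a, b) z \<in> disc"
proof -
  let ?n = "a * z + b" and ?d = "cnj b * z + cnj a"
  have "?d * cnj ?d - ?n * cnj ?n = (a * cnj a - b * cnj b) * (1 - z * cnj z)"
    by (simp add: algebra_simps)
  also have "\<dots> = 1 - z * cnj z"
    using ab by (simp add: SU11_iff)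
  finally have "of_real ((cmod ?d)\<^sup>2 - (cmod ?n)\<^sup>2) = (of_real (1 - (cmod z)\<^sup>2) :: complex)"
    by (simp only: of_real_diff complex_norm_square of_real_1)
  then have "(cmod ?d)\<^sup>2 - (cmod ?n)\<^sup>2 = 1 - (cmod z)\<^sup>2"
    by (simp only: of_real_eq_iff)
  moreover have "(cmod z)\<^sup>2 < 1"
    using z by (simp add: abs_square_less_1)
  ultimately have "cmod ?n < cmod ?d"
    by (intro power2_less_imp_less[of "cmod ?n"]) auto
  then show ?thesis
    using z mobius_denom_nonzero[OF ab z] by (simp add: mobius_def norm_divide)
qed

lemma mobius_compose:
  assumes ab: "(a, b) \<in> SU11" and cd: "(c, d) \<in> SU11"
  shows "compose disc (mobius (a, b)) (mobius (c, d)) =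
      mobius (a * c + b * cnj d, a * d + b * cnj c)"
    and "(a * c + b * cnj d, a * d + b * cnj c) \<in> SU11"
proof -
  have "(a * c + b * cnj d) * cnj (a * c + b * cnj d)
      - (a * d + b * cnj c) * cnj (a * d + b * cnj c)
      = (a * cnj a - b * cnj b) * (c * cnj c - d * cnj d)"
    by (simp add: algebra_simps)
  also have "\<dots> = 1"
    using ab cd by (simp add: SU11_iff)
  finally show mem: "(a * c + b * cnj d, a * d + b * cnj c) \<in> SU11"
    by (simp only: SU11_iff)
  show "compose disc (mobius (a, b)) (mobius (c, d)) =
      mobius (a * c + b * cnj d, a * d + b * cnj c)"
  proof
    fix z
    show "compose disc (mobius (a, b)) (mobius (c, d)) z =
        mobius (a * c + b * cnj d, a * d + b * cnj c) z"
    proof (cases "z \<in> disc")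
      case True
      let ?y = "(c * z + d) / (cnj d * z + cnj c)"
      have y: "mobius (c, d) z = ?y"
        using True by (simp add: mobius_def)
      have ydisc: "?y \<in> disc"
        using mobius_in_disc[OF cd True] y by simp
      have nz: "cnj d * z + cnj c \<noteq> 0"
        by (rule mobius_denom_nonzero[OF cd True])
      have "a * ?y + b = (a * (c * z + d) + b * (cnj d * z + cnj c)) / (cnj d * z + cnj c)"
        and "cnj b * ?y + cnj a =
          (cnj b * (c * z + d) + cnj a * (cnj d * z + cnj c)) / (cnj d * z + cnj c)"
        using nz by (simp_all add: field_simps)
      then have "(a * ?y + b) / (cnj b * ?y + cnj a) =
          (a * (c * z + d) + b * (cnj d * z + cnj c)) /
          (cnj b * (c * z + d) + cnj a * (cnj d * z + cnj c))"
        using nz by simp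
      also have "\<dots> = ((a * c + b * cnj d) * z + (a * d + b * cnj c)) /
          (cnj (a * d + b * cnj c) * z + cnj (a * c + b * cnj d))"
        by (rule arg_cong2[of _ _ _ _ "(/)"]) (simp_all add: algebra_simps)
      finally show ?thesis
        using True y ydisc by (simp add: compose_eq mobius_def)
    next
      case False
      then show ?thesis
        by (simp add: compose_def mobius_def)
    qed
  qed
qed

lemma group_PSU11: "group PSU11"
proof (rule groupI)
  have id: "(\<lambda>z\<in>disc. z) = mobius (1, 0)"
    by (simp add: mobius_def)
  have one_mem: "(1, 0) \<in> SU11"
    by (simp add: SU11_def)
  show "\<one>\<^bsub>PSU11\<^esub> \<in> carrier PSU11"
    using id one_mem by (auto simp: PSU11_def)
  fix x
  assume x: "x \<in> carrier PSU11"
  then obtain a b where ab: "(a, b) \<in> SU11" "x = mobius (a, b)"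
    by (auto simp: PSU11_def)
  have xdisc: "x \<in> disc \<rightarrow> disc" and xext: "x \<in> extensional disc"
    using mobius_in_disc ab by (auto simp: mobius_def)
  show "\<one>\<^bsub>PSU11\<^esub> \<otimes>\<^bsub>PSU11\<^esub> x = x"
    using xdisc xext by (simp add: PSU11_def Id_compose)
  have inv_mem: "(cnj a, - b) \<in> SU11"
    using ab by (simp add: SU11_def)
  have "cnj a * a + - b * cnj b = 1" "cnj a * b + - b * cnj a = 0"
    using ab(1) by (simp_all add: SU11_iff mult.commute)
  then have "compose disc (mobius (cnj a, - b)) x = mobius (1, 0)"
    using mobius_compose(1)[OF inv_mem ab(1)] ab(2) by simp
  then show "\<exists>y\<in>carrier PSU11. y \<otimes>\<^bsub>PSU11\<^esub> x = \<one>\<^bsub>PSU11\<^esub>"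
    using inv_mem id by (auto simp: PSU11_def)
  fix y
  assume y: "y \<in> carrier PSU11"
  then obtain c d where cd: "(c, d) \<in> SU11" "y = mobius (c, d)"
    by (auto simp: PSU11_def)
  show "x \<otimes>\<^bsub>PSU11\<^esub> y \<in> carrier PSU11"
    using mobius_compose[OF ab(1) cd(1)] ab cd by (simp add: PSU11_def)
  fix z
  assume "z \<in> carrier PSU11"
  then obtain e f where ef: "(e, f) \<in> SU11" "z = mobius (e, f)"
    by (auto simp: PSU11_def)
  have "z \<in> disc \<rightarrow> disc"
    using mobius_in_disc ef by auto
  then show "x \<otimes>\<^bsub>PSU11\<^esub> y \<otimes>\<^bsub>PSU11\<^esub> z = x \<otimes>\<^bsub>PSU11\<^esub> (y \<otimes>\<^bsub>PSU11\<^esub> z)"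
    using compose_assoc[of z disc disc x y] by (simp add: PSU11_def)
qed

definition quotient_topology :: "'a topology \<Rightarrow> ('a \<Rightarrow> 'b) \<Rightarrow> 'b topology"
  where "quotient_topology X p =
    topology (\<lambda>U. U \<subseteq> p ` topspace X \<and> openin X {x \<in> topspace X. p x \<in> U})"

lemma openin_quotient_topology:
  "openin (quotient_topology X p) U \<longleftrightarrow>
     U \<subseteq> p ` topspace X \<and> openin X {x \<in> topspace X. p x \<in> U}"
proof -
  have "istopology (\<lambda>U. U \<subseteq> p ` topspace X \<and> openin X {x \<in> topspace X. p x \<in> U})"
    unfolding istopology_def
  proof (intro conjI allI impI)
    fix S T
    assume S: "S \<subseteq> p ` topspace X \<and> openin X {x \<in> topspace X. p x \<in> S}"
      and T: "T \<subseteq> p ` topspace X \<and> openin X {x \<in> topspace X. p x \<in> T}"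
    then show "S \<inter> T \<subseteq> p ` topspace X"
      by blast
    have "{x \<in> topspace X. p x \<in> S \<inter> T} =
        {x \<in> topspace X. p x \<in> S} \<inter> {x \<in> topspace X. p x \<in> T}"
      by blast
    then show "openin X {x \<in> topspace X. p x \<in> S \<inter> T}"
      using S T by (simp add: openin_Int)
  next
    fix K
    assume K: "\<forall>S\<in>K. S \<subseteq> p ` topspace X \<and> openin X {x \<in> topspace X. p x \<in> S}"
    then show "\<Union>K \<subseteq> p ` topspace X"
      by blast
    have "{x \<in> topspace X. p x \<in> \<Union>K} = (\<Union>S\<in>K. {x \<in> topspace X. p x \<in> S})"
      by blast
    then show "openin X {x \<in> topspace X. p x \<in> \<Union>K}"
      using K by auto
  qed
  then show ?thesis
    by (simp add: quotient_topology_def topology_inverse')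
qed

definition PSU11_topology :: "(complex \<Rightarrow> complex) topology"
  where "PSU11_topology = quotient_topology (top_of_set SU11) mobius"

definition discrete_in_PSU11 :: "(complex \<Rightarrow> complex) set \<Rightarrow> bool"
  where "discrete_in_PSU11 \<Gamma> \<longleftrightarrow> subtopology PSU11_topology \<Gamma> = discrete_topology \<Gamma>"

definition cocompact_in_PSU11 :: "(complex \<Rightarrow> complex) set \<Rightarrow> bool"
  where "cocompact_in_PSU11 \<Gamma> \<longleftrightarrow>
    compact_space (quotient_topology PSU11_topology (\<lambda>g. \<Gamma> #>\<^bsub>PSU11\<^esub> g))"

text \<open>Vector fields on the disc and tensors at a point are written in the standard coordinate of
  the complex plane. Only values on the disc are relevant; tensors are evaluated on pairs of
  tangent vectors.\<close>

definition conf_factor :: "complex \<Rightarrow> real"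
  where "conf_factor z = 4 / (1 - (cmod z)\<^sup>2)\<^sup>2"

definition hyp_metric :: "complex \<Rightarrow> complex \<Rightarrow> complex \<Rightarrow> real"
  where "hyp_metric z u v = conf_factor z * (u \<bullet> v)"

text \<open>The vectors of \<open>Basis\<close> divided by the square root of \<open>conf_factor z\<close> are
  orthonormal for the metric at \<open>z\<close>.\<close>

definition metric_trace :: "complex \<Rightarrow> (complex \<Rightarrow> complex \<Rightarrow> 'b::real_vector) \<Rightarrow> 'b"
  where "metric_trace z T = (\<Sum>b\<in>Basis. (1 / conf_factor z) *\<^sub>R T b b)"

text \<open>For coordinate vectors \<open>u, v\<close> the Lie derivative is
  \<open>\<xi>(g(u,v)) - g([\<xi>,u],v) - g(u,[\<xi>,v])\<close>, where \<open>[\<xi>,u] = -d\<xi>(u)\<close>.\<close>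

definition lie_metric :: "(complex \<Rightarrow> complex) \<Rightarrow> complex \<Rightarrow> complex \<Rightarrow> complex \<Rightarrow> real"
  where "lie_metric \<xi> z u v =
    frechet_derivative (\<lambda>x. hyp_metric x u v) (at z) (\<xi> z)
    + hyp_metric z (frechet_derivative \<xi> (at z) u) v
    + hyp_metric z u (frechet_derivative \<xi> (at z) v)"

definition trace_free_part ::
    "complex \<Rightarrow> (complex \<Rightarrow> complex \<Rightarrow> real) \<Rightarrow> complex \<Rightarrow> complex \<Rightarrow> real"
  where "trace_free_part z T u v = T u v - metric_trace z T / 2 * hyp_metric z u v"

text \<open>The coefficient \<open>h\<close> of \<open>dz\<^sup>2\<close>, which is the bilinear form \<open>(u, v) \<mapsto> u * v\<close>.\<close>

definition part_2_0 :: "(complex \<Rightarrow> complex) \<Rightarrow> complex \<Rightarrow> complex"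
  where "part_2_0 \<xi> z = (THE h. \<forall>u v. trace_free_part z (lie_metric \<xi> z) u v = Re (h * (u * v)))"

definition killing_fields :: "(complex \<Rightarrow> complex) set"
  where "killing_fields = {\<xi>. smooth_on disc \<xi> \<and> (\<forall>z\<in>disc. \<forall>u v. lie_metric \<xi> z u v = 0)}"

text \<open>The Levi-Civita connection is \<open>\<nabla>\<^sub>u Y = dY(u) + christoffel z u Y\<close>, with
  \<open>christoffel\<close> given by the Koszul formula for coordinate vector fields.\<close>

definition christoffel :: "complex \<Rightarrow> complex \<Rightarrow> complex \<Rightarrow> complex"
  where "christoffel z u v =
    (\<Sum>b\<in>Basis.
      ((frechet_derivative (\<lambda>x. hyp_metric x v b) (at z) u
        + frechet_derivative (\<lambda>x. hyp_metric x u b) (at z) v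
        - frechet_derivative (\<lambda>x. hyp_metric x u v) (at z) b) / (2 * conf_factor z)) *\<^sub>R b)"

text \<open>\<open>\<nabla>d\<phi>\<close> is formed with the connection on \<open>T\<^sup>*U \<otimes> \<phi>\<^sup>*TD\<close>.\<close>

definition second_fundamental_form ::
    "(complex \<Rightarrow> complex) \<Rightarrow> complex \<Rightarrow> complex \<Rightarrow> complex \<Rightarrow> complex"
  where "second_fundamental_form \<phi> z u v =
    frechet_derivative (\<lambda>x. frechet_derivative \<phi> (at x) v) (at z) u
    + christoffel (\<phi> z) (frechet_derivative \<phi> (at z) u) (frechet_derivative \<phi> (at z) v)
    - frechet_derivative \<phi> (at z) (christoffel z u v)"

definition tension_field :: "(complex \<Rightarrow> complex) \<Rightarrow> complex \<Rightarrow> complex"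
  where "tension_field \<phi> z = metric_trace z (second_fundamental_form \<phi> z)"

definition harmonic_field_on :: "complex set \<Rightarrow> (complex \<Rightarrow> complex) \<Rightarrow> bool"
  where "harmonic_field_on U \<xi> \<longleftrightarrow> open U \<and> U \<subseteq> disc \<and> smooth_on U \<xi> \<and>
    (\<exists>(\<epsilon>::real) \<phi>. \<epsilon> > 0 \<and>
      smooth_on ({0..<\<epsilon>} \<times> U) (\<lambda>(t, x). \<phi> t x) \<and>
      (\<forall>t\<in>{0..<\<epsilon>}. \<phi> t ` U \<subseteq> disc) \<and>
      (\<forall>x\<in>U. \<phi> 0 x = x) \<and>
      (\<forall>x\<in>U. ((\<lambda>t. \<phi> t x) has_vector_derivative \<xi> x) (at 0 within {0..<\<epsilon>})) \<and>
      (\<forall>x\<in>U. ((\<lambda>t. tension_field (\<phi> t) x) has_vector_derivative 0) (at 0 within {0..<\<epsilon>})))"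

text \<open>Arc length on the unit circle, of total mass \<open>2\<pi>\<close>.\<close>

definition circle_measure :: "complex measure"
  where "circle_measure =
    distr (restrict_space lborel {0..2 * pi}) (restrict_space borel (sphere 0 1)) cis"

definition L2_circle :: "(complex \<Rightarrow> complex) \<Rightarrow> bool"
  where "L2_circle Y \<longleftrightarrow>
    Y \<in> borel_measurable circle_measure \<and> integrable circle_measure (\<lambda>w. (cmod (Y w))\<^sup>2)"

text \<open>\<open>Y\<close> represents the restriction to the circle of the \<open>L\<^sup>2\<close>-extension of \<open>X\<close>.\<close>

definition has_L2_boundary :: "(complex \<Rightarrow> complex) \<Rightarrow> (complex \<Rightarrow> complex) \<Rightarrow> bool"
  where "has_L2_boundary X Y \<longleftrightarrow> continuous_on disc X \<and> L2_circle Y \<and>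
    ((\<lambda>\<epsilon>::real. LINT w|circle_measure. (cmod (X (of_real (1 - \<epsilon>) * w) - Y w))\<^sup>2) \<longlongrightarrow> 0) (at_right 0)"

definition tangential :: "(complex \<Rightarrow> complex) \<Rightarrow> bool"
  where "tangential Y \<longleftrightarrow>
    (\<exists>f :: complex \<Rightarrow> real. AE w in circle_measure. Y w = of_real (f w) * (\<i> * w))"

definition K_kernel :: "complex \<Rightarrow> complex"
  where "K_kernel z =
    \<i> * of_real ((1 - (cmod z)\<^sup>2) ^ 3) / (of_real ((cmod (1 - cnj z))\<^sup>2) * (1 - cnj z)\<^sup>2)"

text \<open>The function \<open>f\<close> with \<open>Y w = f w * (\<i> * w)\<close> is \<open>Y w / (\<i> * w)\<close>.\<close>

definition F_op :: "(complex \<Rightarrow> complex) \<Rightarrow> complex \<Rightarrow> complex"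
  where "F_op Y z =
    of_real (1 / (2 * pi)) * (LINT w|circle_measure. (Y w / (\<i> * w)) * w * K_kernel (z / w))"

text \<open>A quadratic differential \<open>f dz\<^sup>2\<close> on the disc is represented by the function \<open>f\<close>, extended by
  zero outside the disc so that equality on the disc is equality.\<close>

definition HQD :: "(complex \<Rightarrow> complex) set \<Rightarrow> (complex \<Rightarrow> complex) set"
  where "HQD \<Gamma> = {f. f holomorphic_on disc \<and> (\<forall>z. z \<notin> disc \<longrightarrow> f z = 0) \<and>
    (\<forall>\<gamma>\<in>\<Gamma>. \<forall>z\<in>disc. f (\<gamma> z) * (deriv \<gamma> z)\<^sup>2 = f z)}"

definition vf_pullback :: "(complex \<Rightarrow> complex) \<Rightarrow> (complex \<Rightarrow> complex) \<Rightarrow> complex \<Rightarrow> complex"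
  where "vf_pullback \<gamma> X z = X (\<gamma> z) / deriv \<gamma> z"

definition coboundary :: "(complex \<Rightarrow> complex) \<Rightarrow> (complex \<Rightarrow> complex) \<Rightarrow> complex \<Rightarrow> complex"
  where "coboundary X \<gamma> z = vf_pullback \<gamma> X z - X z"

definition cocycles :: "(complex \<Rightarrow> complex) set \<Rightarrow> ((complex \<Rightarrow> complex) \<Rightarrow> complex \<Rightarrow> complex) set"
  where "cocycles \<Gamma> = {c. (\<forall>\<gamma>\<in>\<Gamma>. c \<gamma> \<in> killing_fields) \<and>
    (\<forall>\<gamma>\<^sub>1\<in>\<Gamma>. \<forall>\<gamma>\<^sub>2\<in>\<Gamma>. \<forall>z\<in>disc.
      c (\<gamma>\<^sub>1 \<otimes>\<^bsub>PSU11\<^esub> \<gamma>\<^sub>2) z = vf_pullback \<gamma>\<^sub>2 (c \<gamma>\<^sub>1) z + c \<gamma>\<^sub>2 z)}"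

text \<open>Cocycles that agree for all \<open>\<gamma> \<in> \<Gamma>\<close> on the disc are identified as well, so the
  irrelevant values of \<open>c\<close> disappear in the quotient.\<close>

definition cohomologous ::
    "(complex \<Rightarrow> complex) set \<Rightarrow> ((complex \<Rightarrow> complex) \<Rightarrow> complex \<Rightarrow> complex) rel"
  where "cohomologous \<Gamma> = {(c, c'). c \<in> cocycles \<Gamma> \<and> c' \<in> cocycles \<Gamma> \<and>
    (\<exists>X\<in>killing_fields. \<forall>\<gamma>\<in>\<Gamma>. \<forall>z\<in>disc. c' \<gamma> z - c \<gamma> z = coboundary X \<gamma> z)}"

definition H1 :: "(complex \<Rightarrow> complex) set \<Rightarrow> ((complex \<Rightarrow> complex) \<Rightarrow> complex \<Rightarrow> complex) set set"
  where "H1 \<Gamma> = cocycles \<Gamma> // cohomologous \<Gamma>"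

definition Phi ::
    "(complex \<Rightarrow> complex) set \<Rightarrow> (complex \<Rightarrow> complex) \<Rightarrow>
      ((complex \<Rightarrow> complex) \<Rightarrow> complex \<Rightarrow> complex) set"
  where "Phi \<Gamma> = (\<lambda>q\<in>HQD \<Gamma>. THE h. \<exists>\<xi> Y.
    harmonic_field_on disc \<xi> \<and> (\<forall>z\<in>disc. part_2_0 \<xi> z = q z) \<and>
    has_L2_boundary \<xi> Y \<and> tangential Y \<and> h = cohomologous \<Gamma> `` {coboundary \<xi>})"

definition Psi ::
    "(complex \<Rightarrow> complex) set \<Rightarrow> ((complex \<Rightarrow> complex) \<Rightarrow> complex \<Rightarrow> complex) set \<Rightarrow>
      (complex \<Rightarrow> complex)"
  where "Psi \<Gamma> = (\<lambda>h\<in>H1 \<Gamma>. THE q. \<exists>c\<in>h. \<exists>\<psi> Y.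
    smooth_on disc \<psi> \<and> (\<forall>\<gamma>\<in>\<Gamma>. \<forall>z\<in>disc. coboundary \<psi> \<gamma> z = c \<gamma> z) \<and>
    has_L2_boundary \<psi> Y \<and> tangential Y \<and>
    q = (\<lambda>z. if z \<in> disc then part_2_0 (F_op Y) z else 0))"

end

theory Submission
  imports Defs "HOL-Complex_Analysis.Complex_Analysis"
begin

text \<open>Write \<open>s = 1 - |z|\<^sup>2\<close>. For continuous \<open>Y\<close> on the circle, \<open>F_op Y\<close> is a Cauchy
  integral plus \<open>cnj z\<close> times a polynomial in \<open>s\<close> with antiholomorphic coefficients. This
  explicit form shows that it is harmonic with \<open>dbar\<close>-derivative \<open>3 s\<^sup>2\<close> times an
  antiholomorphic function, so that its \<open>(2,0)\<close>-part is holomorphic, and an approximate identity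
  argument shows that it extends continuously by \<open>Y\<close>.

  Given a cocycle \<open>c\<close>, let \<open>z\<close> tend radially to a boundary point \<open>w\<close> and choose
  \<open>\<eta> \<in> \<Gamma>\<close> moving \<open>z\<close> into a fixed compact set. The values \<open>- c \<eta> w\<close> converge
  geometrically fast to a continuous tangential field \<open>Y\<close> on the circle with
  \<open>\<gamma>\<^sup>* Y - Y = c \<gamma>\<close>. Then \<open>\<xi> = F_op Y\<close> satisfies \<open>\<delta>\<xi> = c\<close>: the difference
  \<open>\<gamma>\<^sup>* \<xi> - \<xi> - c \<gamma>\<close> vanishes on the circle and its \<open>dbar\<close>-derivative is \<open>s\<^sup>2\<close> times an
  antiholomorphic function, and the Fourier coefficients of such a field force it to be zero.

  So the same \<open>\<xi>\<close> serves as the primitive in the definition of \<open>Psi\<close> and as the harmonic field in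
  the definition of \<open>Phi\<close>. The choices in \<open>Psi\<close> do not matter since an invariant vector field
  vanishes on the circle, those in \<open>Phi\<close> since a holomorphic field with tangential boundary values
  is Killing.\<close>

section \<open>Smooth functions\<close>

text \<open>The boundary field is read off from a primitive that is not yet available. If
  \<delta>\<psi> = c, then \<psi>(z) = \<psi>(\<eta> z) / \<eta>'(z) - c \<eta> z. When \<eta> z
  stays in a compact set, 1 / |\<eta>'(z)| is comparable to 1 - |z|, so the first term disappears at
  the circle and the boundary value has to be the limit of - c \<eta>. Taking this limit as the
  definition avoids constructing a smooth primitive by averaging. \<open>Phi\<close> and
  \<open>Psi\<close> are descriptions by \<open>THE\<close>, so existence and uniqueness must be
  proved before either can be evaluated. One field \<open>F_op Y\<close> with continuous
  \<open>Y\<close> gives existence for both; only uniqueness has to face general square integrable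
  boundary values, and there Fourier coefficients on circles of radius less than 1 are passed to the
  limit. The power s^2 is forced: the (2,0)-part is 8 / s^2 times the conjugate of the
  dbar-derivative, so it is holomorphic exactly when that derivative is s^2 times an antiholomorphic
  function.\<close>

lemma has_derivative_cong_open:
  assumes "open U" "x \<in> U" "\<And>y. y \<in> U \<Longrightarrow> f y = g y"
  shows "(f has_derivative D) (at x) \<longleftrightarrow> (g has_derivative D) (at x)"
  using assms by (metis has_derivative_transform_within_open)

lemma frechet_derivative_cong_open:
  assumes "open U" "x \<in> U" "\<And>y. y \<in> U \<Longrightarrow> f y = g y"
  shows "frechet_derivative f (at x) = frechet_derivative g (at x)"
  unfolding frechet_derivative_def using has_derivative_cong_open[OF assms] by simp

lemma frechet_derivative_eq:
  "(f has_derivative D) (at x) \<Longrightarrow> frechet_derivative f (at x) = D"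
  using frechet_derivative_at by metis

lemma C_k_on_cong:
  assumes "open U" "C_k_on k U f" "\<And>x. x \<in> U \<Longrightarrow> f x = g x"
  shows "C_k_on k U g"
  using assms(2,3)
proof (induction k arbitrary: f g)
  case 0
  then show ?case by (simp add: continuous_on_eq)
next
  case (Suc k)
  have "f differentiable_on U"
    using Suc.prems(1) by simp
  then have "g differentiable_on U"
    unfolding differentiable_on_eq_differentiable_at[OF assms(1)] differentiable_def
    using has_derivative_cong_open[where f = f and g = g, OF assms(1) _ Suc.prems(2)] by blast
  moreover have "C_k_on k U (\<lambda>x. frechet_derivative g (at x) v)" for v
  proof (rule Suc.IH)
    show "C_k_on k U (\<lambda>x. frechet_derivative f (at x) v)"
      using Suc.prems(1) by simp
    show "frechet_derivative f (at x) v = frechet_derivative g (at x) v" if "x \<in> U" for x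
      using frechet_derivative_cong_open[OF assms(1) that Suc.prems(2)] by simp
  qed
  ultimately show ?case by simp
qed

text \<open>\<open>C_k_on\<close> is phrased with \<open>frechet_derivative\<close>. This rule lets
  the closure lemmas supply an explicit derivative \<open>D\<close>, so that their inductions only
  have to recognise \<open>D x v\<close> as built from functions already known to be
  \<open>C_k_on k\<close>.\<close>

lemma C_k_on_SucI:
  assumes "open U" "\<And>x. x \<in> U \<Longrightarrow> (f has_derivative D x) (at x)"
    and "\<And>v. C_k_on k U (\<lambda>x. D x v)"
  shows "C_k_on (Suc k) U f"
proof -
  have "f differentiable_on U"
    using assms(1,2) by (auto simp: differentiable_on_eq_differentiable_at differentiable_def)
  moreover have "C_k_on k U (\<lambda>x. frechet_derivative f (at x) v)" for v
    by (rule C_k_on_cong[OF assms(1) assms(3)[of v]]) (simp add: frechet_derivative_eq[OF assms(2)])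
  ultimately show ?thesis by simp
qed

lemma C_k_on_SucD:
  assumes "C_k_on (Suc k) U f" "open U" "x \<in> U"
  shows "(f has_derivative frechet_derivative f (at x)) (at x)"
  using assms by (simp add: differentiable_on_eq_differentiable_at frechet_derivative_works)

lemma C_k_on_Suc_imp:
  assumes "open U" "C_k_on (Suc k) U f"
  shows "C_k_on k U f"
  using assms(2)
proof (induction k arbitrary: f)
  case 0
  then show ?case by (simp add: differentiable_imp_continuous_on)
next
  case (Suc k)
  have "f differentiable_on U" "\<And>v. C_k_on (Suc k) U (\<lambda>x. frechet_derivative f (at x) v)"
    using Suc.prems unfolding C_k_on.simps(2)[of "Suc k"] by blast+
  with Suc.IH show ?case
    unfolding C_k_on.simps(2)[of k U f] by blast
qed

lemma C_k_on_continuous_on: "open U \<Longrightarrow> C_k_on k U f \<Longrightarrow> continuous_on U f"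
  by (induction k) (auto intro: C_k_on_Suc_imp differentiable_imp_continuous_on)

lemma C_k_on_const: "C_k_on k U (\<lambda>x. c)"
proof (induction k arbitrary: c)
  case (Suc k)
  show ?case by (simp add: Suc.IH)
qed simp

lemma C_k_on_bounded_linear:
  assumes "open U" "bounded_linear L" "C_k_on k U f"
  shows "C_k_on k U (\<lambda>x. L (f x))"
  using assms(3)
proof (induction k arbitrary: f)
  case 0
  then show ?case
    using assms(2) by (auto intro: linear_continuous_on_compose bounded_linear.continuous_on)
next
  case (Suc k)
  show ?case
  proof (rule C_k_on_SucI[OF assms(1)])
    show "((\<lambda>x. L (f x)) has_derivative (\<lambda>v. L (frechet_derivative f (at x) v))) (at x)"
      if "x \<in> U" for x
      using C_k_on_SucD[OF Suc.prems assms(1) that] by (rule bounded_linear.has_derivative[OF assms(2)])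
  qed (use Suc in auto)
qed

lemma C_k_on_add:
  assumes "open U" "C_k_on k U f" "C_k_on k U g"
  shows "C_k_on k U (\<lambda>x. f x + g x)"
  using assms(2,3)
proof (induction k arbitrary: f g)
  case 0
  then show ?case by (simp add: continuous_on_add)
next
  case (Suc k)
  show ?case
  proof (rule C_k_on_SucI[OF assms(1)])
    show "((\<lambda>x. f x + g x) has_derivative
        (\<lambda>v. frechet_derivative f (at x) v + frechet_derivative g (at x) v)) (at x)"
      if "x \<in> U" for x
      using C_k_on_SucD[OF Suc.prems(1) assms(1) that] C_k_on_SucD[OF Suc.prems(2) assms(1) that]
      by (rule has_derivative_add)
  qed (use Suc in auto)
qed

lemma C_k_on_mult:
  fixes f g :: "'a::euclidean_space \<Rightarrow> 'b::real_normed_algebra"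
  assumes "open U" "C_k_on k U f" "C_k_on k U g"
  shows "C_k_on k U (\<lambda>x. f x * g x)"
  using assms(2,3)
proof (induction k arbitrary: f g)
  case 0
  then show ?case by (simp add: continuous_on_mult)
next
  case (Suc k)
  have fg: "C_k_on k U f" "C_k_on k U g"
    using Suc.prems C_k_on_Suc_imp[OF assms(1)] by blast+
  show ?case
  proof (rule C_k_on_SucI[OF assms(1)])
    show "((\<lambda>x. f x * g x) has_derivative
        (\<lambda>v. f x * frechet_derivative g (at x) v + frechet_derivative f (at x) v * g x)) (at x)"
      if "x \<in> U" for x
      using C_k_on_SucD[OF Suc.prems(1) assms(1) that] C_k_on_SucD[OF Suc.prems(2) assms(1) that]
      by (rule has_derivative_mult)
  next
    fix v
    show "C_k_on k U (\<lambda>x. f x * frechet_derivative g (at x) v + frechet_derivative f (at x) v * g x)"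
      using Suc fg by (intro C_k_on_add assms(1) Suc.IH) auto
  qed
qed

lemma C_k_on_minus:
  assumes "open U" "C_k_on k U f"
  shows "C_k_on k U (\<lambda>x. - f x)"
  using C_k_on_bounded_linear[OF assms(1) bounded_linear_minus[OF bounded_linear_ident] assms(2)] .

lemma C_k_on_diff:
  assumes "open U" "C_k_on k U f" "C_k_on k U g"
  shows "C_k_on k U (\<lambda>x. f x - g x)"
  using C_k_on_add[OF assms(1,2) C_k_on_minus[OF assms(1,3)]] by simp

lemma C_k_on_power:
  fixes f :: "'a::euclidean_space \<Rightarrow> 'b::real_normed_algebra_1"
  assumes "open U" "C_k_on k U f"
  shows "C_k_on k U (\<lambda>x. f x ^ n)"
  by (induction n) (auto intro: C_k_on_const C_k_on_mult assms)

lemma C_k_on_inverse: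
  fixes f :: "'a::euclidean_space \<Rightarrow> 'b::real_normed_div_algebra"
  assumes "open U" "C_k_on k U f" "\<And>x. x \<in> U \<Longrightarrow> f x \<noteq> 0"
  shows "C_k_on k U (\<lambda>x. inverse (f x))"
  using assms(2)
proof (induction k)
  case 0
  then show ?case by (simp add: assms(3) continuous_on_inverse)
next
  case (Suc k)
  have f: "C_k_on k U f"
    using Suc.prems C_k_on_Suc_imp[OF assms(1)] by blast
  show ?case
  proof (rule C_k_on_SucI[OF assms(1)])
    show "((\<lambda>x. inverse (f x)) has_derivative
        (\<lambda>v. - (inverse (f x) * frechet_derivative f (at x) v * inverse (f x)))) (at x)"
      if "x \<in> U" for x
      using that assms(3) C_k_on_SucD[OF Suc.prems assms(1) that]
      by (intro Deriv.has_derivative_inverse) auto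
  next
    fix v
    show "C_k_on k U (\<lambda>x. - (inverse (f x) * frechet_derivative f (at x) v * inverse (f x)))"
      using Suc f by (intro C_k_on_minus C_k_on_mult assms(1)) auto
  qed
qed

lemma C_k_on_linear:
  assumes "bounded_linear L"
  shows "C_k_on k U L"
proof (cases k)
  case 0
  then show ?thesis using assms by (simp add: linear_continuous_on)
next
  case (Suc m)
  have L: "(L has_derivative L) (at x)" for x
    by (rule bounded_linear_imp_has_derivative[OF assms])
  have "L differentiable_on U"
    using bounded_linear_imp_differentiable_on[OF assms] .
  then show ?thesis
    using Suc by (simp add: frechet_derivative_eq[OF L] C_k_on_const)
qed

text \<open>For linear \<open>L\<close> the derivative in direction \<open>v\<close> is the
  derivative of \<open>f\<close> in the fixed direction \<open>L v\<close>, again composed with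
  \<open>L\<close>, so the induction closes. It serves to regard functions of \<open>x\<close> as
  functions of \<open>(t, x)\<close>.\<close>

lemma C_k_on_compose_linear:
  assumes "open U" "open V" "bounded_linear L" "\<And>x. x \<in> V \<Longrightarrow> L x \<in> U" "C_k_on k U f"
  shows "C_k_on k V (\<lambda>x. f (L x))"
  using assms(5)
proof (induction k arbitrary: f)
  case 0
  then show ?case
    using assms(4) continuous_on_compose2[of U f V L] linear_continuous_on[OF assms(3)] by auto
next
  case (Suc k)
  show ?case
  proof (rule C_k_on_SucI[OF assms(2)])
    show "((\<lambda>x. f (L x)) has_derivative (\<lambda>v. frechet_derivative f (at (L x)) (L v))) (at x)"
      if "x \<in> V" for x
      using has_derivative_compose[OF bounded_linear_imp_has_derivative[OF assms(3)]
          C_k_on_SucD[OF Suc.prems assms(1) assms(4)[OF that]]] .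
  qed (use Suc in auto)
qed

lemma holomorphic_on_imp_C_k_on:
  assumes "open U" "f holomorphic_on U"
  shows "C_k_on k U f"
  using assms(2)
proof (induction k arbitrary: f)
  case 0
  then show ?case by (simp add: holomorphic_on_imp_continuous_on)
next
  case (Suc k)
  show ?case
  proof (rule C_k_on_SucI[OF assms(1)])
    show "(f has_derivative (\<lambda>v. deriv f x * v)) (at x)" if "x \<in> U" for x
      using holomorphic_derivI[OF Suc.prems assms(1) that] by (simp add: has_field_derivative_def)
    show "C_k_on k U (\<lambda>x. deriv f x * v)" for v
      using Suc.prems assms(1) by (intro Suc.IH holomorphic_intros)
  qed
qed

lemma smooth_on_openI:
  assumes "open U" "\<And>k. C_k_on k U f"
  shows "smooth_on U f"
  unfolding smooth_on_def using assms by blast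

lemma smooth_on_differentiable:
  assumes "open U" "smooth_on U f" "x \<in> U"
  shows "f differentiable (at x)"
proof -
  obtain V F where V: "open V" "x \<in> V" "\<forall>k. C_k_on k V F" "\<forall>y\<in>V \<inter> U. F y = f y"
    using bspec[OF assms(2)[unfolded smooth_on_def] assms(3)] by (elim exE conjE)
  have "(F has_derivative frechet_derivative F (at x)) (at x)"
    by (rule C_k_on_SucD[OF spec[OF V(3)] V(1,2)])
  then have "(f has_derivative frechet_derivative F (at x)) (at x)"
    using has_derivative_cong_open[OF open_Int[OF V(1) assms(1)], of x F f] V(2,4) assms(3) by simp
  then show ?thesis by (auto simp: differentiable_def)
qed

lemma smooth_on_continuous_on:
  assumes "open U" "smooth_on U f"
  shows "continuous_on U f"
  using smooth_on_differentiable[OF assms]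
  by (meson continuous_at_imp_continuous_on differentiable_imp_continuous_within)

section \<open>The hyperbolic metric and harmonic vector fields\<close>

text \<open>The Wirtinger derivatives: \<open>a\<close> is the derivative in z and \<open>b\<close>
  the dbar-derivative, so \<open>b = 0\<close> is complex differentiability.\<close>

abbreviation has_wirtinger ::
    "(complex \<Rightarrow> complex) \<Rightarrow> complex \<Rightarrow> complex \<Rightarrow> complex filter \<Rightarrow> bool"
  where "has_wirtinger f a b F \<equiv> (f has_derivative (\<lambda>v. a * v + b * cnj v)) F"

abbreviation height :: "complex \<Rightarrow> real"
  where "height z \<equiv> 1 - (cmod z)\<^sup>2"

lemma height_pos: "z \<in> disc \<Longrightarrow> height z > 0"
  by (simp add: abs_square_less_1)

lemma of_real_height: "of_real (height z) = 1 - z * cnj z"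
  by (metis complex_norm_square of_real_1 of_real_diff)

lemma one_minus_mult_cnj_nonzero: "z \<in> disc \<Longrightarrow> 1 - z * cnj z \<noteq> 0"
  using height_pos[of z] by (metis of_real_height of_real_eq_0_iff less_irrefl)

lemma linear_complex_wirtinger:
  fixes D :: "complex \<Rightarrow> complex"
  assumes "linear D"
  shows "D v = (D 1 - \<i> * D \<i>) / 2 * v + (D 1 + \<i> * D \<i>) / 2 * cnj v"
proof -
  have "D v = D (Re v *\<^sub>R 1 + Im v *\<^sub>R \<i>)"
    by (rule arg_cong[of _ _ D]) (simp add: complex_eq_iff)
  also have "\<dots> = of_real (Re v) * D 1 + of_real (Im v) * D \<i>"
    by (simp only: linear_add[OF assms] linear_scale[OF assms]) (simp only: scaleR_conv_of_real)
  also have "\<dots> = (D 1 - \<i> * D \<i>) / 2 * v + (D 1 + \<i> * D \<i>) / 2 * cnj v"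
    by (simp add: complex_eq_iff field_simps)
  finally show ?thesis .
qed

lemma differentiable_has_wirtinger:
  fixes f :: "complex \<Rightarrow> complex"
  assumes "f differentiable (at z)"
  obtains a b where "has_wirtinger f a b (at z)"
proof -
  obtain D where D: "(f has_derivative D) (at z)"
    using assms by (auto simp: differentiable_def)
  have "D = (\<lambda>v. (D 1 - \<i> * D \<i>) / 2 * v + (D 1 + \<i> * D \<i>) / 2 * cnj v)"
    using linear_complex_wirtinger[OF has_derivative_linear[OF D]] by blast
  with D that show thesis by metis
qed

lemma has_wirtinger_unique:
  assumes "has_wirtinger f a b (at z)" "has_wirtinger f a' b' (at z)"
  shows "a = a'" "b = b'"
proof -
  have "(\<lambda>v. a * v + b * cnj v) = (\<lambda>v. a' * v + b' * cnj v)"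
    using has_derivative_unique[OF assms] .
  from fun_cong[OF this, of 1] fun_cong[OF this, of \<i>] show "a = a'" "b = b'"
    by (auto simp: complex_eq_iff)
qed

lemma has_wirtinger_field:
  "(f has_field_derivative a) F \<Longrightarrow> has_wirtinger f a 0 F"
  by (simp add: has_field_derivative_def)

lemma has_wirtinger_cnj:
  assumes "has_wirtinger f a b F"
  shows "has_wirtinger (\<lambda>z. cnj (f z)) (cnj b) (cnj a) F"
  using has_derivative_cnj[OF assms] by (simp add: add.commute)

lemma has_wirtinger_add:
  assumes "has_wirtinger f a b F" "has_wirtinger g c d F"
  shows "has_wirtinger (\<lambda>z. f z + g z) (a + c) (b + d) F"
  by (rule has_derivative_eq_rhs[OF has_derivative_add[OF assms]]) (simp add: fun_eq_iff algebra_simps)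

lemma has_wirtinger_diff:
  assumes "has_wirtinger f a b F" "has_wirtinger g c d F"
  shows "has_wirtinger (\<lambda>z. f z - g z) (a - c) (b - d) F"
  by (rule has_derivative_eq_rhs[OF has_derivative_diff[OF assms]]) (simp add: fun_eq_iff algebra_simps)

lemma has_wirtinger_mult:
  assumes "has_wirtinger f a b (at z)" "has_wirtinger g c d (at z)"
  shows "has_wirtinger (\<lambda>z. f z * g z) (a * g z + f z * c) (b * g z + f z * d) (at z)"
  by (rule has_derivative_eq_rhs[OF has_derivative_mult[OF assms]]) (simp add: fun_eq_iff algebra_simps)

lemma has_wirtinger_height: "has_wirtinger (\<lambda>z. 1 - z * cnj z) (- cnj z) (- z) (at z)"
  by (rule has_derivative_eq_rhs) (auto intro!: derivative_eq_intros simp: fun_eq_iff)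

section \<open>The Lie derivative of the metric and its (2,0)-part\<close>

lemma has_derivative_conf_factor:
  assumes "z \<in> disc"
  shows "(conf_factor has_derivative (\<lambda>w. 16 * (z \<bullet> w) / (height z) ^ 3)) (at z)"
proof -
  have "height z \<noteq> 0"
    using height_pos[OF assms] by simp
  then have "1 - z \<bullet> z \<noteq> 0"
    by (simp add: power2_norm_eq_inner)
  then have "((\<lambda>x. 4 / (1 - x \<bullet> x)\<^sup>2) has_derivative (\<lambda>w. 16 * (z \<bullet> w) / (1 - z \<bullet> z) ^ 3)) (at z)"
    by (auto intro!: derivative_eq_intros
        simp: fun_eq_iff inner_commute power2_eq_square power3_eq_cube divide_simps)
  then show ?thesis
    by (simp add: conf_factor_def[abs_def] power2_norm_eq_inner)
qed

lemma has_derivative_hyp_metric: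
  assumes "z \<in> disc"
  shows "((\<lambda>x. hyp_metric x u v) has_derivative
    (\<lambda>w. 16 * (z \<bullet> w) / (height z) ^ 3 * (u \<bullet> v))) (at z)"
  unfolding hyp_metric_def by (rule has_derivative_mult_left[OF has_derivative_conf_factor[OF assms]])

lemma inner_eq_Re: "(u::complex) \<bullet> v = Re (cnj u * v)"
  by (simp add: inner_complex_def)

text \<open>Multiplication by \<open>a\<close> is a similarity and only rescales the metric, through
  \<open>Re a\<close>. Everything that is not a multiple of the metric comes from the
  dbar-derivative \<open>b\<close>.\<close>

lemma lie_metric_eq:
  assumes "z \<in> disc" "has_wirtinger \<xi> a b (at z)"
  shows "lie_metric \<xi> z u v = (16 * (z \<bullet> \<xi> z) / (height z) ^ 3 + 2 * conf_factor z * Re a) * (u \<bullet> v)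
    + Re (2 * of_real (conf_factor z) * cnj b * (u * v))"
  unfolding lie_metric_def frechet_derivative_eq[OF has_derivative_hyp_metric[OF assms(1)]]
    frechet_derivative_eq[OF assms(2)]
  unfolding hyp_metric_def
  by (simp add: inner_complex_def algebra_simps)

lemma metric_trace_eq:
  "metric_trace z T = (1 / conf_factor z) *\<^sub>R (T 1 1 + T \<i> \<i>)"
  by (simp add: metric_trace_def Basis_complex_def scaleR_add_right)

lemma conf_factor_pos: "z \<in> disc \<Longrightarrow> conf_factor z > 0"
  using height_pos[of z] by (simp add: conf_factor_def)

text \<open>The form (u, v) to Re (h u v) has trace zero because 1^2 + i^2 = 0, so taking the
  trace-free part removes exactly the other summand. The pairs (1, 1) and (1, i) recover the real
  and imaginary part of h, which makes the description by \<open>THE\<close> definite.\<close>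

lemma part_2_0_eq:
  assumes "z \<in> disc" "has_wirtinger \<xi> a b (at z)"
  shows "part_2_0 \<xi> z = 2 * of_real (conf_factor z) * cnj b"
proof -
  let ?h = "2 * of_real (conf_factor z) * cnj b"
  define K where "K = 16 * (z \<bullet> \<xi> z) / (height z) ^ 3 + 2 * conf_factor z * Re a"
  have lie: "lie_metric \<xi> z u v = K * (u \<bullet> v) + Re (?h * (u * v))" for u v
    by (simp only: lie_metric_eq[OF assms] K_def)
  have "metric_trace z (lie_metric \<xi> z) = 2 * K / conf_factor z"
    by (simp add: metric_trace_eq lie inner_complex_def)
  then have tf: "trace_free_part z (lie_metric \<xi> z) u v = Re (?h * (u * v))" for u v
    using conf_factor_pos[OF assms(1)] by (simp add: trace_free_part_def lie hyp_metric_def)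
  show ?thesis
    unfolding part_2_0_def
  proof (rule the_equality)
    fix h assume "\<forall>u v. trace_free_part z (lie_metric \<xi> z) u v = Re (h * (u * v))"
    then have "Re (?h * (u * v)) = Re (h * (u * v))" for u v
      by (metis tf)
    from this[of 1 1] this[of 1 \<i>] show "h = ?h"
      by (simp add: complex_eq_iff)
  qed (use tf in blast)
qed

text \<open>For a conformal metric exp(2 f) |dz|^2 the connection is complex bilinear with
  coefficient twice the z-derivative of f; here f = log 2 - log (height z).\<close>

lemma christoffel_eq:
  assumes "z \<in> disc"
  shows "christoffel z u v = 2 * cnj z * u * v / of_real (height z)"
proof -
  have "16 * x / h ^ 3 / (2 * (4 / h\<^sup>2)) = 2 * x / h" if "h \<noteq> 0" for x h :: real
    using that by (simp add: power2_eq_square power3_eq_cube field_simps)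
  then have c: "16 * x / (height z) ^ 3 / (2 * conf_factor z) = 2 * x / height z" for x
    using height_pos[OF assms] by (simp add: conf_factor_def)
  have "christoffel z u v = (\<Sum>b\<in>Basis. (2 * ((z \<bullet> u) * (v \<bullet> b) + (z \<bullet> v) * (u \<bullet> b)
      - (z \<bullet> b) * (u \<bullet> v)) / height z) *\<^sub>R b)"
    unfolding christoffel_def frechet_derivative_eq[OF has_derivative_hyp_metric[OF assms]]
      c[symmetric]
    by (simp add: algebra_simps add_divide_distrib diff_divide_distrib)
  also have "\<dots> = (2 / height z) *\<^sub>R (cnj z * u * v)"
    by (simp add: Basis_complex_def complex_eq_iff inner_complex_def algebra_simps
        add_divide_distrib diff_divide_distrib)
  finally show ?thesis
    by (simp add: scaleR_conv_of_real)
qed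

section \<open>A variation through maps into the disc and its tension field\<close>

lemma has_vector_derivative_times_continuous:
  fixes g :: "real \<Rightarrow> complex"
  assumes "continuous (at 0 within S) g"
  shows "((\<lambda>t. of_real t * g t) has_vector_derivative g 0) (at 0 within S)"
proof -
  have "((\<lambda>t. g t - g 0) \<longlongrightarrow> 0) (at 0 within S)"
    using assms by (simp add: continuous_within LIM_zero)
  then have lim: "((\<lambda>t. norm (g t - g 0)) \<longlongrightarrow> 0) (at 0 within S)"
    by (rule tendsto_norm_zero)
  have "norm ((1 / norm (t - 0)) *\<^sub>R (of_real t * g t - (of_real 0 * g 0 + (t - 0) *\<^sub>R g 0)))
      \<le> norm (g t - g 0)" for t
  proof -
    have "of_real t * g t - (of_real 0 * g 0 + (t - 0) *\<^sub>R g 0) = of_real t * (g t - g 0)"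
      by (simp add: scaleR_conv_of_real right_diff_distrib)
    then show ?thesis
      by (simp add: norm_mult)
  qed
  then have "((\<lambda>t. (1 / norm (t - 0)) *\<^sub>R (of_real t * g t - (of_real 0 * g 0 + (t - 0) *\<^sub>R g 0))) \<longlongrightarrow> 0)
      (at 0 within S)"
    by (intro Lim_null_comparison[OF _ lim] always_eventually allI)
  then show ?thesis
    unfolding has_vector_derivative_def has_derivative_within
    by (simp add: bounded_linear_scaleR_left)
qed

lemma has_derivative_slice:
  fixes F :: "real \<times> complex \<Rightarrow> complex"
  assumes "C_k_on (Suc k) V F" "open V" "(t, x) \<in> V"
  shows "((\<lambda>x. F (t, x)) has_derivative (\<lambda>v. frechet_derivative F (at (t, x)) (0, v))) (at x)"
proof -
  have "((\<lambda>x. (t, x)) has_derivative (\<lambda>v. (0, v))) (at x)"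
    by (auto intro!: derivative_eq_intros)
  from has_derivative_compose[OF this C_k_on_SucD[OF assms]] show ?thesis .
qed

text \<open>The straight variation \<open>x + t * v\<close> can leave the disc, and in general no
  interval of \<open>t\<close> works for all \<open>x\<close> at once. With y = |t| |v| / h, where h
  is the height of \<open>x\<close>, the damped displacement has length h y / (1 + y^2), which is at
  most h / 2 for every \<open>t\<close>.\<close>

lemma norm_damped_add_less_1:
  fixes x v :: complex and t :: real
  assumes "x \<in> disc"
  shows "cmod (x + of_real t * v * inverse (1 + of_real t ^ 2 *
    (v * cnj v * inverse (1 - x * cnj x) ^ 2))) < 1"
proof -
  define h where "h = height x"
  have h: "h > 0" "of_real h = 1 - x * cnj x"
    using height_pos[OF assms] of_real_height[of x] by (simp_all add: h_def)
  define y where "y = \<bar>t\<bar> * cmod v / h"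
  have "t\<^sup>2 * ((cmod v)\<^sup>2 * inverse h ^ 2) = y\<^sup>2"
    by (simp add: y_def power_divide power_mult_distrib power_inverse divide_inverse)
  then have "of_real t ^ 2 * (v * cnj v * inverse (1 - x * cnj x) ^ 2) = of_real (y\<^sup>2)"
    unfolding h(2)[symmetric] unfolding complex_norm_square[symmetric]
    by (simp only: of_real_mult[symmetric] of_real_power[symmetric] of_real_inverse[symmetric])
  then have "cmod (of_real t * v * inverse (1 + of_real t ^ 2 *
      (v * cnj v * inverse (1 - x * cnj x) ^ 2))) = cmod (of_real t * v * inverse (of_real (1 + y\<^sup>2)))"
    by simp
  also have "\<dots> = \<bar>t\<bar> * cmod v / (1 + y\<^sup>2)"
    using norm_of_real[of "1 + y\<^sup>2", where 'a = complex]
    by (simp only: norm_mult norm_inverse norm_of_real abs_of_nonneg divide_inverse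
        add_nonneg_nonneg zero_le_power2 zero_le_one)
  also have "\<dots> = h * (y / (1 + y\<^sup>2))"
    using h(1) by (simp add: y_def)
  also have "\<dots> \<le> h * (1 / 2)"
  proof (intro mult_left_mono)
    have "0 \<le> (1 - y)\<^sup>2"
      by simp
    then have "2 * y \<le> 1 + y\<^sup>2"
      by (simp add: power2_diff)
    moreover have "0 < 1 + y\<^sup>2"
      by (simp add: add_pos_nonneg)
    ultimately show "y / (1 + y\<^sup>2) \<le> 1 / 2"
      by (simp add: divide_le_eq)
  qed (use h(1) in simp)
  finally have le: "cmod (of_real t * v * inverse (1 + of_real t ^ 2 *
      (v * cnj v * inverse (1 - x * cnj x) ^ 2))) \<le> h / 2"
    by simp
  \<comment> \<open>Since h = (1 - |x|) (1 + |x|), half of it is less than the distance from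
    \<open>x\<close> to the circle.\<close>
  have "0 < (1 - cmod x)\<^sup>2"
    using assms by simp
  then have "cmod x + h / 2 < 1"
    by (simp add: h_def power2_diff field_simps)
  then show ?thesis
    using norm_triangle_le[of x _ "cmod x + h / 2"] le by (smt (verit, best) norm_triangle_ineq)
qed

text \<open>When \<open>A2 = B1\<close>, as for mixed second derivatives, \<open>eq\<close> says
  that \<open>B\<close> divided by the square of the height is antiholomorphic. The tension field of
  the variation is \<open>t * G t\<close>; at \<open>t = 0\<close> its connection term is 2 cnj x /
  height times 2 (A + B) + 2 i (i A - i B) = 4 B, so \<open>eq\<close> amounts to
  \<open>G 0 = 0\<close>.\<close>

lemma harmonic_field_onI:
  assumes C: "\<And>k. C_k_on k disc \<xi>"
    and d\<xi>: "\<And>z. z \<in> disc \<Longrightarrow> has_wirtinger \<xi> (A z) (B z) (at z)"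
    and dA: "\<And>z. z \<in> disc \<Longrightarrow> has_wirtinger A (A1 z) (A2 z) (at z)"
    and dB: "\<And>z. z \<in> disc \<Longrightarrow> has_wirtinger B (B1 z) (B2 z) (at z)"
    and eq: "\<And>z. z \<in> disc \<Longrightarrow> A2 z + B1 z = - 4 * cnj z * B z / of_real (height z)"
  shows "harmonic_field_on disc \<xi>"
proof -
  define V :: "(real \<times> complex) set" where "V = UNIV \<times> disc"
  have V: "open V" by (simp add: V_def open_Times)
  \<comment> \<open>\<open>n\<close> is |\<xi>|^2 / height^2, written with \<open>cnj\<close> so
    that the smoothness rules apply, and \<open>m\<close> is the damping factor. Damping changes the
    variation only from order t^3 on, with coefficient \<open>R\<close>, so no first derivative at
    \<open>t = 0\<close> sees it.\<close>
  define n where "n x = \<xi> x * cnj (\<xi> x) * inverse (1 - x * cnj x) ^ 2" for x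
  define m where "m p = inverse (1 + of_real (fst p) ^ 2 * n (snd p))" for p :: "real \<times> complex"
  define \<phi> where "\<phi> t x = x + of_real t * \<xi> x * m (t, x)" for t x
  define R where "R p = - (\<xi> (snd p) * n (snd p) * m p)" for p
  have nz: "1 + of_real t ^ 2 * n x \<noteq> 0" if "x \<in> disc" for t x
  proof -
    have "n x = of_real ((cmod (\<xi> x))\<^sup>2 * inverse (height x) ^ 2)"
      by (simp add: n_def complex_norm_square[symmetric] of_real_height[symmetric] del: of_real_diff
          of_real_power)
        (simp)
    then have "1 + of_real t ^ 2 * n x = of_real (1 + t ^ 2 * ((cmod (\<xi> x))\<^sup>2 * inverse (height x) ^ 2))"
      by simp
    moreover have "1 + t ^ 2 * ((cmod (\<xi> x))\<^sup>2 * inverse (height x) ^ 2) > 0"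
      by (intro add_pos_nonneg mult_nonneg_nonneg) auto
    ultimately show ?thesis
      by (metis of_real_eq_0_iff less_irrefl)
  qed
  have disc: "\<phi> t x \<in> disc" if "x \<in> disc" for t x
    using norm_damped_add_less_1[OF that, of t "\<xi> x"] by (simp add: \<phi>_def m_def n_def)
  have "C_k_on k disc n" for k
    unfolding n_def using one_minus_mult_cnj_nonzero
    by (intro C_k_on_mult C_k_on_power C_k_on_inverse C_k_on_diff C_k_on_const C
        C_k_on_bounded_linear[OF open_ball bounded_linear_cnj]
        C_k_on_linear bounded_linear_cnj bounded_linear_ident open_ball)
  from this[THEN C_k_on_compose_linear[OF open_ball V bounded_linear_snd, rotated]]
    C[THEN C_k_on_compose_linear[OF open_ball V bounded_linear_snd, rotated]]
  have snds: "C_k_on k V (\<lambda>p. \<xi> (snd p))" "C_k_on k V (\<lambda>p. n (snd p))" for k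
    by (auto simp: V_def)
  have t: "C_k_on k V (\<lambda>p. complex_of_real (fst p))" for k
    by (intro C_k_on_linear bounded_linear_compose[OF bounded_linear_of_real bounded_linear_fst])
  have m: "C_k_on k V m" for k
    unfolding m_def using nz
    by (intro C_k_on_inverse C_k_on_add C_k_on_const C_k_on_mult C_k_on_power snds t V) (auto simp: V_def)
  have R: "C_k_on k V R" for k
    unfolding R_def by (intro C_k_on_minus C_k_on_mult snds m V)
  have \<phi>C: "C_k_on k V (\<lambda>(t, x). \<phi> t x)" for k
  proof -
    have "C_k_on k V (\<lambda>p. snd p + of_real (fst p) * \<xi> (snd p) * m p)"
      by (intro C_k_on_add C_k_on_mult C_k_on_linear[OF bounded_linear_snd] snds t m V)
    then show ?thesis
      by (simp add: \<phi>_def case_prod_beta')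
  qed
  have \<phi>_eq: "\<phi> t x = x + of_real t * \<xi> x + of_real t ^ 3 * R (t, x)" if "x \<in> disc" for t x
  proof -
    have "m (t, x) * (1 + of_real t ^ 2 * n x) = 1"
      using nz[OF that] by (simp add: m_def)
    then have "m (t, x) = 1 - of_real t ^ 2 * n x * m (t, x)"
      by (simp add: algebra_simps)
    then have "\<phi> t x = x + of_real t * \<xi> x * (1 - of_real t ^ 2 * n x * m (t, x))"
      by (simp add: \<phi>_def)
    then show ?thesis
      by (simp add: R_def algebra_simps power2_eq_square power3_eq_cube)
  qed
  define r where "r b p = frechet_derivative R (at p) (0, b)" for b p
  define \<rho> where "\<rho> b p = frechet_derivative (r b) (at p) (0, b)" for b p
  have r: "C_k_on k V (r b)" for k b
    using R[of "Suc k"] by (simp add: r_def[abs_def])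
  have \<rho>: "C_k_on k V (\<rho> b)" for k b
    using r[of "Suc k" b] by (simp add: \<rho>_def[abs_def])
  have cont: "continuous_on UNIV (\<lambda>t. f (t, x))" if "C_k_on 0 V f" "x \<in> disc"
    for f :: "real \<times> complex \<Rightarrow> complex" and x
  proof -
    have "continuous_on V f" "continuous_on UNIV (\<lambda>t::real. (t, x))" "range (\<lambda>t. (t, x)) \<subseteq> V"
      using that by (auto intro!: continuous_intros simp: V_def)
    then show ?thesis
      by (rule continuous_on_compose2)
  qed
  have cont0: "continuous (at 0 within S) (\<lambda>t. f (t, x))" if "\<And>k. C_k_on k V f" "x \<in> disc"
    for f :: "real \<times> complex \<Rightarrow> complex" and x and S :: "real set"
    using cont[OF that(1,2)] by (simp add: continuous_on_eq_continuous_at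
        continuous_at_imp_continuous_at_within)
  have d1: "(\<phi> t has_derivative
      (\<lambda>v. v + of_real t * (A x * v + B x * cnj v) + of_real t ^ 3 * r v (t, x))) (at x)"
    if "x \<in> disc" for t x
  proof -
    have "((\<lambda>x. x + of_real t * \<xi> x + of_real t ^ 3 * R (t, x)) has_derivative
        (\<lambda>v. v + of_real t * (A x * v + B x * cnj v) + of_real t ^ 3 * r v (t, x))) (at x)"
      unfolding r_def using that
      by (intro has_derivative_add has_derivative_ident has_derivative_mult_right d\<xi>
          has_derivative_slice[OF R[of "Suc 0"] V]) (auto simp: V_def)
    then show ?thesis
      using has_derivative_cong_open[OF open_ball that, of "\<phi> t"] \<phi>_eq by simp
  qed
  have d2: "frechet_derivative (\<lambda>x. frechet_derivative (\<phi> t) (at x) b) (at x) b =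
      of_real t * ((A1 x * b + A2 x * cnj b) * b + (B1 x * b + B2 x * cnj b) * cnj b)
      + of_real t ^ 3 * \<rho> b (t, x)"
    if x: "x \<in> disc" for t x b
  proof -
    have "((\<lambda>x. b + of_real t * (A x * b + B x * cnj b) + of_real t ^ 3 * r b (t, x)) has_derivative
        (\<lambda>v. 0 + of_real t * ((A1 x * v + A2 x * cnj v) * b + (B1 x * v + B2 x * cnj v) * cnj b)
          + of_real t ^ 3 * frechet_derivative (r b) (at (t, x)) (0, v))) (at x)"
      using x
      by (intro has_derivative_add has_derivative_const has_derivative_mult_right
          has_derivative_mult_left dA dB has_derivative_slice[OF r[of "Suc 0"] V]) (auto simp: V_def)
    moreover have "frechet_derivative (\<lambda>x. frechet_derivative (\<phi> t) (at x) b) (at x) =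
        frechet_derivative (\<lambda>x. b + of_real t * (A x * b + B x * cnj b) + of_real t ^ 3 * r b (t, x))
            (at x)"
      using x by (intro frechet_derivative_cong_open[of disc]) (auto simp: frechet_derivative_eq[OF d1])
    ultimately show ?thesis
      by (simp add: frechet_derivative_eq \<rho>_def)
  qed
  have "((\<lambda>t. tension_field (\<phi> t) x) has_vector_derivative 0) (at 0 within {0..<1})"
    if x: "x \<in> disc" for x
  proof -
    \<comment> \<open>The space derivative of \<open>\<phi> t\<close> in direction \<open>b\<close>
      is \<open>b + t * u b t\<close>, and \<open>G\<close> is the tension field divided by
      \<open>t\<close>, with the division carried out so that \<open>G 0\<close> makes sense.
      Continuity of \<open>G\<close> at 0 then gives the derivative of
      \<open>t * G t\<close>.\<close>
    define u where "u b t = A x * b + B x * cnj b + of_real t ^ 2 * r b (t, x)" for b t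
    define G where "G t = (1 / conf_factor x) *\<^sub>R
      (2 * A2 x + 2 * B1 x + of_real t ^ 2 * (\<rho> 1 (t, x) + \<rho> \<i> (t, x))
        + 2 * cnj (\<phi> t x) / of_real (height (\<phi> t x)) *
          (2 * u 1 t + of_real t * (u 1 t)\<^sup>2 + 2 * \<i> * u \<i> t + of_real t * (u \<i> t)\<^sup>2))" for t
    have D: "frechet_derivative (\<phi> t) (at x) b = b + of_real t * u b t" for t b
      by (simp add: frechet_derivative_eq[OF d1[OF x]] u_def algebra_simps power2_eq_square power3_eq_cube)
    have tension: "tension_field (\<phi> t) x = of_real t * G t" for t
    proof -
      let ?g = "2 * cnj x / of_real (height x)" and ?c = "2 * cnj (\<phi> t x) / of_real (height (\<phi> t x))"
      have "linear (frechet_derivative (\<phi> t) (at x))"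
        using has_derivative_linear[OF d1[OF x]] by (simp add: frechet_derivative_eq[OF d1[OF x]])
      then have neg: "frechet_derivative (\<phi> t) (at x) (- ?g) = - frechet_derivative (\<phi> t) (at x) ?g"
        by (rule linear_neg)
      \<comment> \<open>The Christoffel terms of the domain are opposite for the directions 1 and i,
        so they cancel in the trace.\<close>
      have chr: "christoffel x 1 1 = ?g" "christoffel x \<i> \<i> = - ?g"
        by (simp_all add: christoffel_eq[OF x] mult.assoc)
      have chr\<phi>: "christoffel (\<phi> t x) v v = ?c * v\<^sup>2" for v
        by (simp add: christoffel_eq[OF disc[OF x]] power2_eq_square)
      have "tension_field (\<phi> t) x = (1 / conf_factor x) *\<^sub>R
          (of_real t * (2 * A2 x + 2 * B1 x) + of_real t ^ 3 * (\<rho> 1 (t, x) + \<rho> \<i> (t, x))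
            + ?c * ((1 + of_real t * u 1 t)\<^sup>2 + (\<i> + of_real t * u \<i> t)\<^sup>2))"
        unfolding tension_field_def metric_trace_eq second_fundamental_form_def d2[OF x] chr neg chr\<phi>
        by (simp add: D algebra_simps)
      also have "\<dots> = of_real t * G t"
      proof -
        have "T * (2 * A2 x + 2 * B1 x) + T ^ 3 * q + c * ((1 + T * u1)\<^sup>2 + (\<i> + T * u2)\<^sup>2) =
            T * (2 * A2 x + 2 * B1 x + T ^ 2 * q + c * (2 * u1 + T * u1\<^sup>2 + 2 * \<i> * u2 + T * u2\<^sup>2))"
          for T q c u1 u2 :: complex
          by (simp add: algebra_simps power2_eq_square power3_eq_cube)
        then show ?thesis
          by (simp only: G_def mult_scaleR_right)
      qed
      finally show ?thesis .
    qed
    have u: "continuous (at 0 within S) (u b)" for S b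
      unfolding u_def by (intro continuous_intros cont0[OF r x])
    have "continuous (at 0 within {0..<1}) (\<lambda>t. case (t, x) of (t, x) \<Rightarrow> \<phi> t x)"
      by (rule cont0[OF \<phi>C x])
    then have cphi: "continuous (at 0 within {0..<1}) (\<lambda>t. \<phi> t x)"
      by simp
    have "continuous (at 0 within {0..<1}) G"
      unfolding G_def using height_pos[OF disc[OF x, of 0]]
      by (intro continuous_intros cphi u cont0[OF \<rho> x]) (auto simp del: of_real_diff of_real_power)
    moreover have "G 0 = 0"
    proof -
      have "\<phi> 0 x = x"
        by (simp add: \<phi>_def)
      moreover have "2 * A2 x + 2 * B1 x = 2 * (A2 x + B1 x)"
        by simp
      ultimately show ?thesis
        by (simp only: G_def eq[OF x]) (simp add: u_def algebra_simps)
    qed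
    ultimately show ?thesis
      using has_vector_derivative_times_continuous[of "{0..<1}" G] by (simp add: tension)
  qed
  moreover have "((\<lambda>t. \<phi> t x) has_vector_derivative \<xi> x) (at 0 within {0..<1})" if "x \<in> disc" for x
  proof -
    have "((\<lambda>t. of_real t * (\<xi> x * m (t, x))) has_vector_derivative \<xi> x * m (0, x)) (at 0 within {0..<1})"
      by (intro has_vector_derivative_times_continuous continuous_intros cont0[OF m that])
    then have "((\<lambda>t. x + of_real t * (\<xi> x * m (t, x))) has_vector_derivative 0 + \<xi> x * m (0, x))
        (at 0 within {0..<1})"
      by (intro has_vector_derivative_add has_vector_derivative_const)
    then show ?thesis
      by (simp add: \<phi>_def m_def mult.assoc)
  qed
  moreover have "smooth_on ({0..<1} \<times> disc) (\<lambda>(t, x). \<phi> t x)"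
    unfolding smooth_on_def using V \<phi>C by (intro ballI exI[of _ V] exI[of _ "\<lambda>(t, x). \<phi> t x"]) (auto
        simp: V_def)
  moreover have "\<phi> 0 x = x" for x
    by (simp add: \<phi>_def)
  ultimately show ?thesis
    unfolding harmonic_field_on_def using disc smooth_on_openI[OF open_ball C]
    by (intro conjI exI[of _ 1] exI[of _ \<phi>]) auto
qed

section \<open>Integrals over the circle\<close>

lemma space_circle_measure [simp]: "space circle_measure = sphere 0 1"
  by (simp add: circle_measure_def space_restrict_space)

lemma sets_circle_measure: "sets circle_measure = sets (restrict_space borel (sphere 0 1))"
  by (simp add: circle_measure_def)

lemma measurable_cis: "cis \<in> measurable (restrict_space lborel {0..2 * pi}) (restrict_space borel
    (sphere 0 1))"
proof -
  have "cis \<in> borel_measurable lborel"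
    by (auto intro!: borel_measurable_continuous_onI continuous_intros)
  then show ?thesis
    by (intro measurable_restrict_space2 measurable_restrict_space1) auto
qed

lemma finite_measure_circle: "finite_measure circle_measure"
proof
  have "emeasure circle_measure (space circle_measure) =
      emeasure (restrict_space lborel {0..2 * pi}) (cis -` sphere 0 1 \<inter> {0..2 * pi})"
    unfolding space_circle_measure unfolding circle_measure_def
    by (subst emeasure_distr[OF measurable_cis]) (auto simp: sets_restrict_space space_restrict_space)
  also have "cis -` sphere 0 1 \<inter> {0..2 * pi} = {0..2 * pi}"
    by auto
  also have "emeasure (restrict_space lborel {0..2 * pi}) {0..2 * pi} = ennreal (2 * pi)"
    by (subst emeasure_restrict_space) auto
  finally show "emeasure circle_measure (space circle_measure) \<noteq> \<infinity>"
    by simp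
qed

lemma borel_measurable_circle:
  "continuous_on (sphere 0 1) f \<Longrightarrow> f \<in> borel_measurable circle_measure"
  using borel_measurable_continuous_on_restrict measurable_cong_sets[OF sets_circle_measure refl] by blast

lemma integrable_circle:
  fixes f :: "complex \<Rightarrow> 'b::{banach, second_countable_topology}"
  assumes "continuous_on (sphere 0 1) f"
  shows "integrable circle_measure f"
proof -
  have "bounded (f ` sphere 0 1)"
    using assms by (intro compact_imp_bounded compact_continuous_image) auto
  then obtain B where "\<forall>w\<in>sphere 0 1. norm (f w) \<le> B"
    unfolding bounded_iff by blast
  then show ?thesis
    using borel_measurable_circle[OF assms]
    by (intro finite_measure.integrable_const_bound[OF finite_measure_circle, where B = B]) auto
qed

lemma has_integral_circle:
  fixes f :: "complex \<Rightarrow> 'b::euclidean_space"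
  assumes "continuous_on (sphere 0 1) f"
  shows "((\<lambda>t. f (cis t)) has_integral (LINT w|circle_measure. f w)) {0..2 * pi}"
proof -
  have "continuous_on {0..2 * pi} (\<lambda>t. f (cis t))"
    by (rule continuous_on_compose2[OF assms]) (auto intro!: continuous_intros)
  then have int: "set_integrable lborel {0..2 * pi} (\<lambda>t. f (cis t))"
    unfolding set_integrable_def by (intro borel_integrable_compact) auto
  have "(LINT w|circle_measure. f w) = (LINT t : {0..2 * pi}|lborel. f (cis t))"
    unfolding circle_measure_def set_lebesgue_integral_def
    by (subst integral_distr[OF measurable_cis borel_measurable_continuous_on_restrict[OF assms]])
      (simp add: integral_restrict_space)
  then show ?thesis
    using set_borel_integral_eq_integral[OF int] by (simp add: integrable_integral)
qed

text \<open>On the unit circle dw = i w dt. This is the source of the factor \<open>w\<close> in all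
  arc length integrals that represent Cauchy integrals.\<close>

lemma has_contour_integral_circle:
  assumes "continuous_on (sphere 0 1) f"
  shows "(f has_contour_integral (\<i> * (LINT w|circle_measure. f w * w))) (circlepath 0 1)"
proof -
  have "continuous_on (sphere 0 1) (\<lambda>w. f w * w)"
    using assms by (intro continuous_intros)
  from has_integral_mult_right[OF has_integral_circle[OF this], of \<i>] show ?thesis
    unfolding circlepath_def by (subst has_contour_integral_part_circlepath_iff) (auto simp: mult_ac)
qed

lemma circle_integral_eq_contour:
  assumes "continuous_on (sphere 0 1) f" "(f has_contour_integral I) (circlepath 0 1)"
  shows "(LINT w|circle_measure. f w * w) = - \<i> * I"
proof -
  have "\<i> * (LINT w|circle_measure. f w * w) = I"
    using has_contour_integral_unique[OF has_contour_integral_circle[OF assms(1)] assms(2)] .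
  from arg_cong[OF this, of "\<lambda>x. - \<i> * x"] show ?thesis
    by (simp add: mult.assoc[symmetric])
qed

lemma circle_integral_cong:
  assumes "\<And>w. cmod w = 1 \<Longrightarrow> f w = g w"
  shows "(LINT w|circle_measure. f w) = (LINT w|circle_measure. g w)"
  using assms by (intro Bochner_Integration.integral_cong) auto

section \<open>Cauchy and Poisson integrals and Fourier coefficients\<close>

lemma circle_Cauchy:
  assumes "continuous_on (cball 0 1) f" "f holomorphic_on disc" "z \<in> disc"
  shows "(LINT w|circle_measure. f w * w / (w - z)) = 2 * of_real pi * f z"
proof -
  have "continuous_on (sphere 0 1) (\<lambda>w. f w / (w - z))"
    using assms(3) continuous_on_subset[OF assms(1), of "sphere 0 1"]
    by (intro continuous_intros) auto
  moreover have "((\<lambda>w. f w / (w - z)) has_contour_integral 2 * of_real pi * \<i> * f z) (circlepath 0 1)"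
    using Cauchy_integral_circlepath[OF assms(1,2), of z] assms(3) by simp
  ultimately have "(LINT w|circle_measure. f w / (w - z) * w) = - \<i> * (2 * of_real pi * \<i> * f z)"
    by (rule circle_integral_eq_contour)
  then show ?thesis
    by simp
qed

lemma circle_mean:
  assumes "continuous_on (cball 0 1) f" "f holomorphic_on disc"
  shows "(LINT w|circle_measure. f w) = 2 * of_real pi * f 0"
proof -
  have "(LINT w|circle_measure. f w) = (LINT w|circle_measure. f w * w / (w - 0))"
    by (intro circle_integral_cong) auto
  then show ?thesis
    using circle_Cauchy[OF assms, of 0] by simp
qed

lemma circle_cnj: "cmod w = 1 \<Longrightarrow> w * cnj w = 1"
  by (simp add: complex_norm_square[symmetric])

text \<open>Up to the unimodular factor \<open>w\<close>, the two denominators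
  \<open>1 - cnj z * w\<close> and \<open>w - z\<close> are conjugate, so they have the same
  modulus.\<close>

lemma dist_circle_eq:
  assumes "cmod w = 1"
  shows "1 - cnj z * w = w * cnj (w - z)"
  using circle_cnj[OF assms] by (simp add: algebra_simps)

lemma one_minus_nonzero:
  assumes "cmod w \<le> 1" "z \<in> disc"
  shows "1 - cnj z * w \<noteq> 0"
proof
  assume "1 - cnj z * w = 0"
  then have "cmod (cnj z * w) = 1"
    by simp
  moreover have "cmod z * cmod w \<le> cmod z * 1"
    using assms(1) by (intro mult_left_mono) auto
  ultimately show False
    using assms(2) by (simp add: norm_mult)
qed

lemma circle_Poisson:
  assumes z: "z \<in> disc"
  shows "(LINT w|circle_measure. height z / (cmod (w - z))\<^sup>2) = 2 * pi"
proof -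
  have ne: "w - z \<noteq> 0" if "cmod w = 1" for w
    using that z by auto
  have "complex_of_real (LINT w|circle_measure. height z / (cmod (w - z))\<^sup>2) =
      (LINT w|circle_measure. complex_of_real (height z / (cmod (w - z))\<^sup>2))"
    by (rule integral_complex_of_real[symmetric])
  \<comment> \<open>Partial fractions: the Poisson kernel is the Cauchy kernel plus a function
    holomorphic in \<open>w\<close> that vanishes at 0 and hence has mean zero.\<close>
  also have "\<dots> = (LINT w|circle_measure. 1 * w / (w - z) + cnj z * w / (1 - cnj z * w))"
  proof (rule circle_integral_cong)
    fix w :: complex assume w: "cmod w = 1"
    have "w \<noteq> 0" "cnj (w - z) \<noteq> 0"
      using w ne[OF w] by auto
    have "of_real (height z / (cmod (w - z))\<^sup>2) = (1 - z * cnj z) / ((w - z) * cnj (w - z))"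
      by (simp only: of_real_divide of_real_height complex_norm_square)
    also have "\<dots> = (w * (1 - z * cnj z)) / ((w - z) * (w * cnj (w - z)))"
      using \<open>w \<noteq> 0\<close> by simp
    also have "\<dots> = (w * (1 - z * cnj z)) / ((w - z) * (1 - cnj z * w))"
      by (simp only: dist_circle_eq[OF w])
    also have "\<dots> = 1 * w / (w - z) + cnj z * w / (1 - cnj z * w)"
      using ne[OF w] one_minus_nonzero[of w z] w z by (simp add: divide_simps) (simp add: algebra_simps)
    finally show "of_real (height z / (cmod (w - z))\<^sup>2) = 1 * w / (w - z) + cnj z * w / (1 - cnj z * w)" .
  qed
  also have "\<dots> = (LINT w|circle_measure. 1 * w / (w - z)) + (LINT w|circle_measure. cnj z * w / (1 -
      cnj z * w))"
    using ne one_minus_nonzero[of _ z] z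
    by (intro Bochner_Integration.integral_add integrable_circle continuous_intros) auto
  also have "(LINT w|circle_measure. 1 * w / (w - z)) = 2 * of_real pi * 1"
    by (intro circle_Cauchy z continuous_intros holomorphic_intros)
  also have "(LINT w|circle_measure. cnj z * w / (1 - cnj z * w)) = 2 * of_real pi * (cnj z * 0 / (1 -
      cnj z * 0))"
    using one_minus_nonzero[of _ z] z
    by (intro circle_mean continuous_intros holomorphic_intros) auto
  finally have "complex_of_real (LINT w|circle_measure. height z / (cmod (w - z))\<^sup>2) = of_real (2 * pi)"
    by simp
  then show ?thesis
    by (simp only: of_real_eq_iff)
qed

lemma circle_measure_univ: "(LINT w|circle_measure. c) = 2 * pi * (c::real)"
proof -
  have "(LINT w|circle_measure. complex_of_real c) = 2 * of_real pi * of_real c"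
    by (intro circle_mean continuous_intros holomorphic_intros)
  then have "complex_of_real (LINT w|circle_measure. c) = of_real (2 * pi * c)"
    by (simp only: integral_complex_of_real of_real_mult of_real_numeral)
  then show ?thesis
    by (simp only: of_real_eq_iff)
qed

text \<open>This is 1 / (2 pi i) times the contour integral of Y(w) / (w - z)^k. For k = 1 it is the
  Cauchy integral of \<open>Y\<close>, and raising k corresponds to differentiating.\<close>

definition Cauchy_type :: "nat \<Rightarrow> (complex \<Rightarrow> complex) \<Rightarrow> complex \<Rightarrow> complex"
  where "Cauchy_type k Y z = (LINT w|circle_measure. Y w * w / (w - z) ^ k) / (2 * of_real pi)"

lemma Cauchy_type_derivative:
  assumes "continuous_on (sphere 0 1) Y" "k \<noteq> 0" "z \<in> disc"
  shows "(Cauchy_type k Y has_field_derivative of_nat k * Cauchy_type (Suc k) Y z) (at z)"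
proof -
  define g where "g z = \<i> * (LINT w|circle_measure. Y w / (w - z) ^ k * w)" for z
  have cont: "continuous_on (sphere 0 1) (\<lambda>w. Y w / (w - z) ^ j)" if "z \<in> disc" for z j
    using that assms(1) by (intro continuous_intros) auto
  have "(g has_field_derivative (of_nat k * contour_integral (circlepath 0 1)
      (\<lambda>w. Y w / (w - z) ^ Suc k))) (at z)"
    unfolding g_def using assms
    by (intro Cauchy_next_derivative_circlepath(2) has_contour_integral_circle cont) auto
  moreover have "contour_integral (circlepath 0 1) (\<lambda>w. Y w / (w - z) ^ Suc k) =
      \<i> * (LINT w|circle_measure. Y w / (w - z) ^ Suc k * w)"
    by (intro contour_integral_unique has_contour_integral_circle cont assms)
  ultimately have "(g has_field_derivative (of_nat k *
      (\<i> * (LINT w|circle_measure. Y w / (w - z) ^ Suc k * w)))) (at z)"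
    by simp
  then have "((\<lambda>z. g z / (2 * of_real pi * \<i>)) has_field_derivative
      (of_nat k * (\<i> * (LINT w|circle_measure. Y w / (w - z) ^ Suc k * w))) / (2 * of_real pi * \<i>)) (at z)"
    by (rule DERIV_cdivide)
  moreover have "(\<lambda>z. g z / (2 * of_real pi * \<i>)) = Cauchy_type k Y"
    by (simp add: fun_eq_iff g_def Cauchy_type_def field_simps)
  ultimately show ?thesis
    by (simp add: Cauchy_type_def field_simps)
qed

lemma Cauchy_type_holomorphic:
  assumes "continuous_on (sphere 0 1) Y" "k \<noteq> 0"
  shows "Cauchy_type k Y holomorphic_on disc"
  unfolding holomorphic_on_open[OF open_ball] using Cauchy_type_derivative[OF assms] by blast

text \<open>Dilation by \<open>r < 1\<close> makes \<open>f\<close> holomorphic past the unit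
  circle, so Cauchy's formulas apply whatever the boundary behaviour of \<open>f\<close>. The second
  equation says that negative Fourier modes are absent.\<close>

lemma circle_coefficient:
  assumes f: "f holomorphic_on disc" and r: "0 < r" "r < 1"
  shows "(LINT w|circle_measure. f (of_real r * w) * cnj w ^ k) =
      2 * of_real pi * (of_real r ^ k * ((deriv ^^ k) f 0 / fact k))"
    and "(LINT w|circle_measure. f (of_real r * w) * w ^ Suc k) = 0"
proof -
  define F where "F w = f (of_real r * w)" for w
  have sub: "of_real r * w \<in> disc" if "cmod w < 1 / r" for w
    using that r by (simp add: norm_mult field_simps)
  have F: "F holomorphic_on ball 0 (1 / r)"
    unfolding F_def using sub
    by (intro holomorphic_on_compose_gen[OF _ f, unfolded o_def] holomorphic_intros) auto
  moreover have "1 < 1 / r"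
    using r by simp
  ultimately have c: "continuous_on (cball 0 1) F" "F holomorphic_on disc" "continuous_on (sphere 0 1) F"
    by (auto intro!: holomorphic_on_subset[OF F] holomorphic_on_imp_continuous_on)
  have "(LINT w|circle_measure. F w * cnj w ^ k) = (LINT w|circle_measure. F w / (w - 0) ^ Suc k * w)"
  proof (rule circle_integral_cong)
    fix w :: complex assume "cmod w = 1"
    then have "w \<noteq> 0" and cnj: "cnj w = inverse w"
      using inverse_unique[OF circle_cnj[of w]] by auto
    then show "F w * cnj w ^ k = F w / (w - 0) ^ Suc k * w"
      unfolding cnj by (simp add: field_simps)
  qed
  also have "\<dots> = - \<i> * (2 * pi * \<i> / fact k * (deriv ^^ k) F 0)"
    using c by (intro circle_integral_eq_contour Cauchy_has_contour_integral_higher_derivative_circlepath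
        continuous_intros) auto
  also have "(deriv ^^ k) F 0 = of_real r ^ k * (deriv ^^ k) f 0"
    unfolding F_def using higher_deriv_compose_linear[OF f, of disc 0 "of_real r" k] r sub
    by (auto simp: less_trans)
  finally show "(LINT w|circle_measure. f (of_real r * w) * cnj w ^ k) =
      2 * of_real pi * (of_real r ^ k * ((deriv ^^ k) f 0 / fact k))"
    by (simp add: F_def mult_ac)
  have "(LINT w|circle_measure. F w * w ^ Suc k) = 2 * of_real pi * (F 0 * 0 ^ Suc k)"
    using c by (intro circle_mean continuous_intros holomorphic_intros) auto
  then show "(LINT w|circle_measure. f (of_real r * w) * w ^ Suc k) = 0"
    by (simp add: F_def)
qed

section \<open>The operator F\<close>

lemma has_wirtinger_eqI: "has_wirtinger f a b F \<Longrightarrow> a = a' \<Longrightarrow> b = b' \<Longrightarrow> has_wirtinger f a' b' F"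
  by simp

text \<open>The density is chosen so that on the unit circle the conjugate of the integrand is
  \<open>Y w * w / (1 - cnj z * w) ^ k\<close>.\<close>

definition conj_Cauchy :: "nat \<Rightarrow> (complex \<Rightarrow> complex) \<Rightarrow> complex \<Rightarrow> complex"
  where "conj_Cauchy k Y = Cauchy_type k (\<lambda>w. cnj (Y w) * w ^ k * cnj w ^ 2)"

lemma cnj_conj_Cauchy:
  "cnj (conj_Cauchy k Y z) = (LINT w|circle_measure. Y w * w / (1 - cnj z * w) ^ k) / (2 * of_real pi)"
proof -
  have "cnj (LINT w|circle_measure. cnj (Y w) * w ^ k * cnj w ^ 2 * w / (w - z) ^ k) =
      (LINT w|circle_measure. cnj (cnj (Y w) * w ^ k * cnj w ^ 2 * w / (w - z) ^ k))"
    by (rule Bochner_Integration.integral_cnj[symmetric])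
  also have "\<dots> = (LINT w|circle_measure. Y w * w / (1 - cnj z * w) ^ k)"
  proof (rule circle_integral_cong)
    fix w :: complex assume w: "cmod w = 1"
    have "w \<noteq> 0" and cnj: "cnj w = inverse w"
      using w inverse_unique[OF circle_cnj[of w]] by auto
    have "cnj (cnj (Y w) * w ^ k * cnj w ^ 2 * w / (w - z) ^ k) = Y w * cnj w ^ k * w ^ 2 * cnj w / cnj
        (w - z) ^ k"
      by simp
    also have "\<dots> = Y w * w / (w * cnj (w - z)) ^ k"
    proof -
      have "y * inverse w ^ k * w ^ 2 * inverse w / d ^ k = y * w / (w * d) ^ k" for y d
        using \<open>w \<noteq> 0\<close> by (simp add: field_simps power2_eq_square)
      then show ?thesis
        unfolding cnj by blast
    qed
    finally show "cnj (cnj (Y w) * w ^ k * cnj w ^ 2 * w / (w - z) ^ k) = Y w * w / (1 - cnj z * w) ^ k"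
      by (simp only: dist_circle_eq[OF w])
  qed
  finally show ?thesis
    by (simp add: conj_Cauchy_def Cauchy_type_def)
qed

text \<open>The kernel of \<open>F_op\<close> against \<open>Y\<close> itself rather than its real
  density: the \<open>i\<close> of \<open>K_kernel\<close> cancels the one in
  \<open>Y w / (i * w)\<close>, and the squared modulus becomes (1 - cnj z w) (w - z) / w on the
  circle.\<close>

definition F_kernel :: "complex \<Rightarrow> complex \<Rightarrow> complex"
  where "F_kernel z w = (1 - z * cnj z) ^ 3 * w / ((w - z) * (1 - cnj z * w) ^ 3)"

lemma F_op_kernel:
  assumes z: "z \<in> disc"
  shows "F_op Y z = (LINT w|circle_measure. Y w * F_kernel z w) / (2 * of_real pi)"
proof -
  have "(LINT w|circle_measure. (Y w / (\<i> * w)) * w * K_kernel (z / w)) = (LINT w|circle_measure. Y w *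
      F_kernel z w)"
  proof (rule circle_integral_cong)
    fix w :: complex assume w: "cmod w = 1"
    have w0: "w \<noteq> 0" and cnj: "cnj w = inverse w"
      using w inverse_unique[OF circle_cnj[of w]] by auto
    define u where "u = 1 - cnj z * w"
    have cu: "cnj u = (w - z) / w"
      using w0 by (simp add: u_def cnj field_simps)
    have "1 - cnj (z / w) = u"
      using w0 by (simp add: u_def cnj divide_inverse)
    moreover have "of_real ((cmod u)\<^sup>2) = u * ((w - z) / w)"
      by (simp only: complex_norm_square cu)
    moreover have "of_real ((1 - (cmod (z / w))\<^sup>2) ^ 3) = (1 - z * cnj z) ^ 3"
      using w by (simp only: norm_divide div_by_1 of_real_power of_real_height)
    ultimately have "K_kernel (z / w) = \<i> * (1 - z * cnj z) ^ 3 / (u * ((w - z) / w) * u\<^sup>2)"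
      by (simp only: K_kernel_def)
    moreover have "F_kernel z w = (1 - z * cnj z) ^ 3 * w / ((w - z) * u ^ 3)"
      by (simp only: F_kernel_def u_def)
    ultimately show "(Y w / (\<i> * w)) * w * K_kernel (z / w) = Y w * F_kernel z w"
      using w0 by (simp add: power2_eq_square power3_eq_cube mult_ac)
  qed
  then show ?thesis
    by (simp add: F_op_def)
qed

text \<open>With s = 1 - z cnj z, d = w - z and u = 1 - cnj z w one has s - u = cnj z d. Dividing
  s^3 - u^3 = (s - u) (u^2 + s u + s^2) by d u^3 splits off the Cauchy kernel; the remaining terms
  are antiholomorphic in \<open>z\<close> up to powers of s.\<close>

lemma F_kernel_eq:
  assumes z: "z \<in> disc" and w: "cmod w = 1"
  shows "F_kernel z w = w / (w - z) + cnj z * (w / (1 - cnj z * w) + (1 - z * cnj z) * (w / (1 - cnj z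
      * w) ^ 2)
    + (1 - z * cnj z) ^ 2 * (w / (1 - cnj z * w) ^ 3))"
proof -
  have "s ^ 3 * w / (d * u ^ 3) = w / d + c * (w / u + s * (w / u ^ 2) + s ^ 2 * (w / u ^ 3))"
    if "d \<noteq> 0" "u \<noteq> 0" "s = u + c * d" for s d u c :: complex
    using that(1,2) unfolding that(3) by (simp add: divide_simps) algebra
  moreover have "w - z \<noteq> 0" "1 - cnj z * w \<noteq> 0" "1 - z * cnj z = (1 - cnj z * w) + cnj z * (w - z)"
    using z w one_minus_nonzero[of w z] by (auto simp: algebra_simps)
  ultimately show ?thesis
    unfolding F_kernel_def by blast
qed

lemma continuous_on_F_kernel: "z \<in> disc \<Longrightarrow> continuous_on (sphere 0 1) (F_kernel z)"
  unfolding F_kernel_def using one_minus_nonzero[of _ z]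
  by (intro continuous_intros) auto

lemma F_op_decomposition:
  assumes Y: "continuous_on (sphere 0 1) Y" and z: "z \<in> disc"
  shows "F_op Y z = Cauchy_type 1 Y z + cnj (z * (conj_Cauchy 1 Y z
    + (1 - z * cnj z) * conj_Cauchy 2 Y z + (1 - z * cnj z) ^ 2 * conj_Cauchy 3 Y z))"
proof -
  have cont: "continuous_on (sphere 0 1) (\<lambda>w. Y w * w / (w - z))"
    "continuous_on (sphere 0 1) (\<lambda>w. Y w * w / (1 - cnj z * w) ^ k)" for k
    using z one_minus_nonzero[of _ z] by (intro continuous_intros Y; auto)+
  have "(LINT w|circle_measure. Y w * F_kernel z w) = (LINT w|circle_measure. Y w * w / (w - z)
      + cnj z * (Y w * w / (1 - cnj z * w) ^ 1 + (1 - z * cnj z) * (Y w * w / (1 - cnj z * w) ^ 2)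
      + (1 - z * cnj z) ^ 2 * (Y w * w / (1 - cnj z * w) ^ 3)))"
    by (intro circle_integral_cong) (simp add: F_kernel_eq[OF z] algebra_simps)
  also have "\<dots> = (LINT w|circle_measure. Y w * w / (w - z))
      + cnj z * ((LINT w|circle_measure. Y w * w / (1 - cnj z * w) ^ 1)
      + (1 - z * cnj z) * (LINT w|circle_measure. Y w * w / (1 - cnj z * w) ^ 2)
      + (1 - z * cnj z) ^ 2 * (LINT w|circle_measure. Y w * w / (1 - cnj z * w) ^ 3))"
    by (simp only: Bochner_Integration.integral_add integral_mult_right_zero integrable_circle[OF cont(1)]
        integrable_circle[OF cont(2)] integrable_mult_right Bochner_Integration.integrable_add)
  finally show ?thesis
    using cnj_conj_Cauchy[of 1 Y z] cnj_conj_Cauchy[of 2 Y z] cnj_conj_Cauchy[of 3 Y z]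
    unfolding F_op_kernel[OF z]
    by (simp add: Cauchy_type_def add_divide_distrib distrib_left mult.commute[of "cnj z" z])
qed

text \<open>Writing z = w - (w - z) lowers the power of the denominator, and the extra factor
  \<open>w\<close> is the one by which the density of \<open>conj_Cauchy (Suc k)\<close> differs.
  The factor \<open>z\<close> stays with \<open>g\<close> because the recurrence cannot be divided
  by it at 0; \<open>l\<close> stands beside \<open>Suc k\<close> so that numerals can be
  inserted.\<close>

lemma conj_Cauchy_derivative:
  assumes Y: "continuous_on (sphere 0 1) Y" and "k \<noteq> 0" and l: "l = Suc k" and z: "z \<in> disc"
  shows "\<exists>g. (conj_Cauchy k Y has_field_derivative g) (at z) \<and>
    z * g = of_nat k * (conj_Cauchy l Y z - conj_Cauchy k Y z)"
proof (intro exI conjI)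
  let ?U = "\<lambda>w. cnj (Y w) * w ^ k * cnj w ^ 2"
  have U: "continuous_on (sphere 0 1) ?U"
    by (intro continuous_intros Y)
  show "(conj_Cauchy k Y has_field_derivative of_nat k * Cauchy_type (Suc k) ?U z) (at z)"
    unfolding conj_Cauchy_def by (rule Cauchy_type_derivative[OF U assms(2) z])
  have cont: "continuous_on (sphere 0 1) (\<lambda>w. ?U w * w / (w - z) ^ j)"
    "continuous_on (sphere 0 1) (\<lambda>w. cnj (Y w) * w ^ j * cnj w ^ 2 * w / (w - z) ^ j)" for j
    using z by (intro continuous_intros Y; auto)+
  have "z * (LINT w|circle_measure. ?U w * w / (w - z) ^ Suc k) =
      (LINT w|circle_measure. z * (?U w * w / (w - z) ^ Suc k))"
    by (rule integral_mult_right_zero[symmetric])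
  also have "\<dots> = (LINT w|circle_measure. cnj (Y w) * w ^ Suc k * cnj w ^ 2 * w / (w - z) ^ Suc k
      - ?U w * w / (w - z) ^ k)"
  proof (rule circle_integral_cong)
    fix w :: complex assume "cmod w = 1"
    then have "w - z \<noteq> 0"
      using z by auto
    then show "z * (?U w * w / (w - z) ^ Suc k) =
        cnj (Y w) * w ^ Suc k * cnj w ^ 2 * w / (w - z) ^ Suc k - ?U w * w / (w - z) ^ k"
      by (simp add: divide_simps) (simp add: algebra_simps)
  qed
  also have "\<dots> = (LINT w|circle_measure. cnj (Y w) * w ^ Suc k * cnj w ^ 2 * w / (w - z) ^ Suc k)
      - (LINT w|circle_measure. ?U w * w / (w - z) ^ k)"
    by (intro Bochner_Integration.integral_diff integrable_circle cont)
  finally have "z * Cauchy_type (Suc k) ?U z = conj_Cauchy (Suc k) Y z - conj_Cauchy k Y z"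
    by (simp add: conj_Cauchy_def Cauchy_type_def diff_divide_distrib)
  then show "z * (of_nat k * Cauchy_type (Suc k) ?U z) = of_nat k * (conj_Cauchy l Y z - conj_Cauchy k Y z)"
    by (simp add: mult.left_commute l)
qed

lemma conj_Cauchy_holomorphic:
  assumes "continuous_on (sphere 0 1) Y" "k \<noteq> 0"
  shows "conj_Cauchy k Y holomorphic_on disc"
  unfolding conj_Cauchy_def using assms by (intro Cauchy_type_holomorphic continuous_intros)

lemma C_k_on_F_op:
  assumes Y: "continuous_on (sphere 0 1) Y"
  shows "C_k_on k disc (F_op Y)"
proof -
  note C = C_k_on_bounded_linear[OF open_ball bounded_linear_cnj] holomorphic_on_imp_C_k_on[OF open_ball]
    conj_Cauchy_holomorphic[OF Y] Cauchy_type_holomorphic[OF Y]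
  have "C_k_on k disc (\<lambda>z. Cauchy_type 1 Y z + cnj (z * (conj_Cauchy 1 Y z
    + (1 - z * cnj z) * conj_Cauchy 2 Y z + (1 - z * cnj z) ^ 2 * conj_Cauchy 3 Y z)))"
    by (intro C_k_on_add open_ball C C_k_on_mult C_k_on_diff C_k_on_power C_k_on_const
        C_k_on_linear bounded_linear_cnj bounded_linear_ident) auto
  then show ?thesis
    by (rule C_k_on_cong[OF open_ball]) (simp only: F_op_decomposition[OF Y])
qed

text \<open>Write G k for \<open>conj_Cauchy k Y\<close> and s for the height. By the recurrence and
  z cnj z = 1 - s, the z-derivative of z (G 1 + s G 2 + s^2 G 3) telescopes to 3 s^2 G 4, and
  conjugation makes it a dbar-derivative. The two mixed derivatives in the harmonicity criterion
  both come out as cnj (- 6 s z G 4).\<close>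

lemma F_op_harmonic:
  assumes Y: "continuous_on (sphere 0 1) Y"
  shows "harmonic_field_on disc (F_op Y)"
    and "z \<in> disc \<Longrightarrow> \<exists>a. has_wirtinger (F_op Y) a (cnj (3 * (1 - z * cnj z) ^ 2 * conj_Cauchy 4 Y z)) (at z)"
proof -
  let ?G = "\<lambda>k. conj_Cauchy k Y"
  define A where "A z = Cauchy_type 2 Y z - cnj (z * z * (?G 2 z + 2 * (1 - z * cnj z) * ?G 3 z))" for z
  define B where "B z = cnj (3 * (1 - z * cnj z) ^ 2 * ?G 4 z)" for z
  have id: "has_wirtinger (\<lambda>z. z) 1 0 (at z)" for z
    by simp
  have s: "has_wirtinger (\<lambda>z. c * (1 - z * cnj z)) (- (c * cnj z)) (- (c * z)) (at z)" for z c
    by (rule has_derivative_eq_rhs[OF has_derivative_mult_right[OF has_wirtinger_height]])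
      (simp add: fun_eq_iff algebra_simps)
  have dF: "has_wirtinger (F_op Y) (A z) (B z) (at z)" if z: "z \<in> disc" for z
  proof -
    obtain g1 g2 g3 where g: "(?G 1 has_field_derivative g1) (at z)" "(?G 2 has_field_derivative g2) (at z)"
      "(?G 3 has_field_derivative g3) (at z)"
      and zg: "z * g1 = ?G 2 z - ?G 1 z" "z * g2 = 2 * (?G 3 z - ?G 2 z)" "z * g3 = 3 * (?G 4 z - ?G 3 z)"
      using conj_Cauchy_derivative[OF Y _ _ z, of 1 2] conj_Cauchy_derivative[OF Y _ _ z, of 2 3]
        conj_Cauchy_derivative[OF Y _ _ z, of 3 4] by auto
    note w = g[THEN has_wirtinger_field]
    have C: "(Cauchy_type 1 Y has_field_derivative Cauchy_type 2 Y z) (at z)"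
      using Cauchy_type_derivative[OF Y, of 1 z] z by (simp add: numeral_2_eq_2)
    have "has_wirtinger (\<lambda>z. z * (?G 1 z + (1 - z * cnj z) * ?G 2 z + (1 - z * cnj z) * ((1 - z * cnj
        z) * ?G 3 z)))
        (3 * (1 - z * cnj z) ^ 2 * ?G 4 z) (- (z * z * (?G 2 z + 2 * (1 - z * cnj z) * ?G 3 z))) (at z)"
      by (rule has_wirtinger_eqI[OF has_wirtinger_mult[OF id has_wirtinger_add[OF has_wirtinger_add[OF w(1)
            has_wirtinger_mult[OF has_wirtinger_height w(2)]]
            has_wirtinger_mult[OF has_wirtinger_height has_wirtinger_mult[OF has_wirtinger_height w(3)]]]]])
        (use zg in algebra, simp add: algebra_simps)
    from has_wirtinger_add[OF has_wirtinger_field[OF C] has_wirtinger_cnj[OF this]]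
    have "has_wirtinger (\<lambda>z. Cauchy_type 1 Y z + cnj (z * (?G 1 z + (1 - z * cnj z) * ?G 2 z
        + (1 - z * cnj z) ^ 2 * ?G 3 z))) (A z) (B z) (at z)"
      by (simp add: A_def B_def power2_eq_square mult.assoc)
    then show ?thesis
      using has_derivative_cong_open[OF open_ball z, of "F_op Y"] F_op_decomposition[OF Y] by simp
  qed
  then show "\<exists>a. has_wirtinger (F_op Y) a (cnj (3 * (1 - z * cnj z) ^ 2 * ?G 4 z)) (at z)" if "z \<in> disc"
    using that unfolding B_def by blast
  have dA: "\<exists>a. has_wirtinger A a (cnj (- 6 * (1 - z * cnj z) * z * ?G 4 z)) (at z)" if z: "z \<in> disc" for z
  proof -
    obtain g2 g3 where g: "(?G 2 has_field_derivative g2) (at z)" "(?G 3 has_field_derivative g3) (at z)"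
      and zg: "z * g2 = 2 * (?G 3 z - ?G 2 z)" "z * g3 = 3 * (?G 4 z - ?G 3 z)"
      using conj_Cauchy_derivative[OF Y _ _ z, of 2 3] conj_Cauchy_derivative[OF Y _ _ z, of 3 4] by auto
    note w = g[THEN has_wirtinger_field]
    obtain c where C: "(Cauchy_type 2 Y has_field_derivative c) (at z)"
      using Cauchy_type_derivative[OF Y _ z, of 2] by auto
    have "\<exists>b. has_wirtinger (\<lambda>z. z * z * (?G 2 z + 2 * (1 - z * cnj z) * ?G 3 z)) (6 * (1 - z * cnj z)
        * z * ?G 4 z) b (at z)"
      by (rule exI, rule has_wirtinger_eqI[OF has_wirtinger_mult[OF has_wirtinger_mult[OF id id]
            has_wirtinger_add[OF w(1) has_wirtinger_mult[OF s w(2)]]] _ refl]) (use zg in algebra)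
    then obtain b where "has_wirtinger (\<lambda>z. z * z * (?G 2 z + 2 * (1 - z * cnj z) * ?G 3 z)) (6 * (1 -
        z * cnj z) * z * ?G 4 z) b (at z)"
      by blast
    from has_wirtinger_diff[OF has_wirtinger_field[OF C] has_wirtinger_cnj[OF this]]
    have "has_wirtinger A (c - cnj b) (0 - cnj (6 * (1 - z * cnj z) * z * ?G 4 z)) (at z)"
      unfolding A_def[abs_def] .
    then have "has_wirtinger A (c - cnj b) (cnj (- 6 * (1 - z * cnj z) * z * ?G 4 z)) (at z)"
      by (rule has_wirtinger_eqI) (simp_all add: algebra_simps)
    then show ?thesis
      by blast
  qed
  have dB: "\<exists>b. has_wirtinger B (cnj (- 6 * (1 - z * cnj z) * z * ?G 4 z)) b (at z)" if z: "z \<in> disc" for z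
  proof -
    obtain g4 where g: "(?G 4 has_field_derivative g4) (at z)"
      using conj_Cauchy_derivative[OF Y _ _ z, of 4 5] by auto
    have "\<exists>b. has_wirtinger (\<lambda>z. 3 * (1 - z * cnj z) * (1 - z * cnj z) * ?G 4 z) b (- 6 * (1 - z * cnj
        z) * z * ?G 4 z) (at z)"
      by (rule exI, rule has_wirtinger_eqI[OF has_wirtinger_mult[OF has_wirtinger_mult[OF s
          has_wirtinger_height]
            has_wirtinger_field[OF g]] refl]) algebra
    then obtain b where "has_wirtinger (\<lambda>z. 3 * (1 - z * cnj z) * (1 - z * cnj z) * ?G 4 z) b (- 6 * (1
        - z * cnj z) * z * ?G 4 z) (at z)"
      by blast
    from has_wirtinger_cnj[OF this] show ?thesis
      unfolding B_def[abs_def] power2_eq_square mult.assoc by blast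
  qed
  from dA obtain A1 where A1: "\<And>z. z \<in> disc \<Longrightarrow> has_wirtinger A (A1 z) (cnj (- 6 * (1 - z * cnj z) * z *
      ?G 4 z)) (at z)"
    by metis
  from dB obtain B2 where B2: "\<And>z. z \<in> disc \<Longrightarrow> has_wirtinger B (cnj (- 6 * (1 - z * cnj z) * z * ?G 4
      z)) (B2 z) (at z)"
    by metis
  show "harmonic_field_on disc (F_op Y)"
  proof (rule harmonic_field_onI[OF C_k_on_F_op[OF Y] dF A1 B2])
    fix z assume z: "z \<in> disc"
    show "cnj (- 6 * (1 - z * cnj z) * z * ?G 4 z) + cnj (- 6 * (1 - z * cnj z) * z * ?G 4 z) =
        - 4 * cnj z * B z / of_real (height z)"
      unfolding of_real_height B_def using one_minus_mult_cnj_nonzero[OF z]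
      by (simp add: field_simps power2_eq_square)
  qed
qed

text \<open>The conformal factor 4 / s^2 cancels the s^2 of the dbar-derivative, and 24 = 2 * 4 *
  3.\<close>

lemma part_2_0_F_op:
  assumes Y: "continuous_on (sphere 0 1) Y" and z: "z \<in> disc"
  shows "part_2_0 (F_op Y) z = 24 * conj_Cauchy 4 Y z"
proof -
  obtain a where "has_wirtinger (F_op Y) a (cnj (3 * (1 - z * cnj z) ^ 2 * conj_Cauchy 4 Y z)) (at z)"
    using F_op_harmonic(2)[OF Y z] by blast
  from part_2_0_eq[OF z this] show ?thesis
    unfolding conf_factor_def of_real_divide of_real_power of_real_height
    using one_minus_mult_cnj_nonzero[OF z] by simp
qed

section \<open>Values of F on holomorphic fields and its boundary behaviour\<close>

lemma F_op_add:
  assumes "continuous_on (sphere 0 1) Y" "continuous_on (sphere 0 1) X" and z: "z \<in> disc"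
  shows "F_op (\<lambda>w. Y w + X w) z = F_op Y z + F_op X z"
proof -
  have "(LINT w|circle_measure. (Y w + X w) * F_kernel z w) =
      (LINT w|circle_measure. Y w * F_kernel z w + X w * F_kernel z w)"
    by (simp add: distrib_right)
  also have "\<dots> = (LINT w|circle_measure. Y w * F_kernel z w) + (LINT w|circle_measure. X w * F_kernel z w)"
    using assms
    by (intro Bochner_Integration.integral_add integrable_circle continuous_on_mult continuous_on_F_kernel)
  finally show ?thesis
    by (simp add: F_op_kernel[OF z] add_divide_distrib)
qed

lemma F_op_cong_AE:
  assumes "Y \<in> borel_measurable circle_measure" "continuous_on (sphere 0 1) X"
    and "AE w in circle_measure. Y w = X w" and z: "z \<in> disc"
  shows "F_op Y z = F_op X z"
proof -
  have "(LINT w|circle_measure. Y w * F_kernel z w) = (LINT w|circle_measure. X w * F_kernel z w)"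
    using assms borel_measurable_circle[OF assms(2)] borel_measurable_circle[OF
        continuous_on_F_kernel[OF z]]
    by (intro integral_cong_AE) auto
  then show ?thesis
    by (simp add: F_op_kernel[OF z])
qed

text \<open>The integrals behind \<open>conj_Cauchy k p\<close> have integrands holomorphic in
  \<open>w\<close> that vanish at 0, so only the Cauchy integral survives. Constants and Killing
  polynomials are the cases needed.\<close>

lemma F_op_holomorphic:
  assumes p: "continuous_on (cball 0 1) p" "p holomorphic_on disc" and z: "z \<in> disc"
  shows "F_op p z = p z"
proof -
  have sph: "continuous_on (sphere 0 1) p"
    using continuous_on_subset[OF p(1)] by auto
  have "conj_Cauchy k p z = 0" for k
  proof -
    have "(LINT w|circle_measure. p w * w / (1 - cnj z * w) ^ k) = 2 * of_real pi * (p 0 * 0 / (1 - cnj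
        z * 0) ^ k)"
      using one_minus_nonzero[OF _ z] by (intro circle_mean continuous_intros holomorphic_intros p) auto
    then have "cnj (conj_Cauchy k p z) = 0"
      by (simp add: cnj_conj_Cauchy)
    then show ?thesis
      by simp
  qed
  moreover have "Cauchy_type 1 p z = p z"
    using circle_Cauchy[OF p z] by (simp add: Cauchy_type_def)
  ultimately show ?thesis
    by (simp add: F_op_decomposition[OF sph z])
qed

text \<open>The kernel has modulus height^3 / |w - z|^4, and the height is at most 2 |w - z|. Two of
  the powers can thus be traded, which leaves a multiple of the Poisson kernel with its known
  integral.\<close>

lemma norm_F_kernel_le:
  assumes z: "z \<in> disc" and w: "cmod w = 1"
  shows "cmod (F_kernel z w) \<le> 4 * (height z / (cmod (w - z))\<^sup>2)"
proof -
  define d where "d = cmod (w - z)"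
  have d: "d > 0"
    using z w by (auto simp: d_def)
  have h: "height z > 0"
    using height_pos[OF z] .
  have "cmod (1 - cnj z * w) = d"
    unfolding dist_circle_eq[OF w] d_def using w by (simp add: norm_mult flip: complex_cnj_diff)
  moreover have "cmod (1 - z * cnj z) = height z"
    unfolding of_real_height[symmetric] norm_of_real using h by simp
  ultimately have "cmod (F_kernel z w) = height z ^ 3 / (d * d ^ 3)"
    unfolding F_kernel_def norm_divide norm_mult norm_power d_def[symmetric] w by simp
  also have "\<dots> = (height z)\<^sup>2 * (height z / d\<^sup>2) / d\<^sup>2"
    by (simp add: power2_eq_square power3_eq_cube)
  also have "\<dots> \<le> (2 * d)\<^sup>2 * (height z / d\<^sup>2) / d\<^sup>2"
  proof -
    have "1 - cmod z \<le> d"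
      using norm_triangle_ineq2[of w z] w by (simp add: d_def)
    moreover have "height z = (1 - cmod z) * (1 + cmod z)"
      by (simp add: power2_eq_square algebra_simps)
    moreover have "(1 - cmod z) * (1 + cmod z) \<le> (1 - cmod z) * 2"
      using z by (intro mult_left_mono) auto
    ultimately have "1 - cmod z \<le> d" "height z \<le> (1 - cmod z) * 2"
      by simp_all
    then have "height z \<le> 2 * d"
      using order_trans[of "height z" "(1 - cmod z) * 2" "d * 2"] by simp
    then have "(height z)\<^sup>2 \<le> (2 * d)\<^sup>2"
      using h by (intro power_mono) auto
    then show ?thesis
      using h d by (intro divide_right_mono mult_right_mono) auto
  qed
  also have "\<dots> = 4 * (height z / d\<^sup>2)"
    using d by (simp add: power2_eq_square)
  finally show ?thesis
    by (simp add: d_def)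
qed

text \<open>Since \<open>F_op\<close> reproduces constants, only \<open>Y w - Y p\<close> is
  integrated. A quadratic modulus of continuity fits the Poisson bound: |w - p|^2 <= 2 |w - z|^2 + 2
  |z - p|^2, and |w - z|^2 cancels the denominator, so the circle need not be split into near and
  far arcs.\<close>

lemma F_op_boundary_estimate:
  assumes Y: "continuous_on (sphere 0 1) Y" and z: "z \<in> disc" and c: "c \<ge> 0"
    and mod: "\<And>w. cmod w = 1 \<Longrightarrow> cmod (Y w - Y p) \<le> e + c * (cmod (w - p))\<^sup>2"
  shows "cmod (F_op Y z - Y p) \<le> 4 * e + 8 * c * (height z + (cmod (z - p))\<^sup>2)"
proof -
  let ?P = "\<lambda>w. height z / (cmod (w - z))\<^sup>2"
  have ne: "w - z \<noteq> 0" if "cmod w = 1" for w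
    using that z by auto
  have P: "continuous_on (sphere 0 1) ?P"
    using ne by (intro continuous_intros) auto
  have Yp: "continuous_on (sphere 0 1) (\<lambda>w. (Y w - Y p) * F_kernel z w)"
    by (intro continuous_intros Y continuous_on_F_kernel z)
  have "F_op (\<lambda>w. Y w + - Y p) z = F_op Y z + F_op (\<lambda>w. - Y p) z"
    by (intro F_op_add Y z continuous_intros)
  also have "F_op (\<lambda>w. - Y p) z = - Y p"
    using F_op_holomorphic[of "\<lambda>w. - Y p"] z by (simp add: continuous_intros holomorphic_intros)
  finally have eq: "F_op Y z - Y p = F_op (\<lambda>w. Y w + - Y p) z"
    by simp
  have norm_eq: "cmod (F_op Y z - Y p) = cmod (LINT w|circle_measure. (Y w - Y p) * F_kernel z w) / (2
      * pi)"
    unfolding eq unfolding F_op_kernel[OF z] by (simp add: norm_divide norm_mult)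
  have "cmod (LINT w|circle_measure. (Y w - Y p) * F_kernel z w) \<le>
      (LINT w|circle_measure. cmod ((Y w - Y p) * F_kernel z w))"
    by (rule integral_norm_bound)
  also have "\<dots> \<le> (LINT w|circle_measure. (4 * e + 8 * c * (cmod (z - p))\<^sup>2) * ?P w + 8 * c * height z)"
  proof (intro integral_mono integrable_circle continuous_on_norm[OF Yp] continuous_intros P)
    fix w assume "w \<in> space circle_measure"
    then have w: "cmod w = 1"
      by simp
    have pos: "?P w \<ge> 0" "(cmod (w - z))\<^sup>2 > 0"
      using height_pos[OF z] ne[OF w] by auto
    have tri: "(cmod (w - p))\<^sup>2 \<le> 2 * (cmod (w - z))\<^sup>2 + 2 * (cmod (z - p))\<^sup>2"
    proof -
      have "cmod (w - p) \<le> cmod (w - z) + cmod (z - p)"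
        using norm_triangle_ineq[of "w - z" "z - p"] by simp
      then have "(cmod (w - p))\<^sup>2 \<le> (cmod (w - z) + cmod (z - p))\<^sup>2"
        by (intro power_mono) auto
      also have "\<dots> \<le> 2 * (cmod (w - z))\<^sup>2 + 2 * (cmod (z - p))\<^sup>2"
        using sum_squares_bound[of "cmod (w - z)" "cmod (z - p)"] by (simp add: power2_sum)
      finally show ?thesis .
    qed
    have "cmod ((Y w - Y p) * F_kernel z w) \<le> (e + c * (cmod (w - p))\<^sup>2) * (4 * ?P w)"
      unfolding norm_mult
      by (rule mult_mono[OF mod[OF w] norm_F_kernel_le[OF z w] order_trans[OF norm_ge_zero mod[OF w]]
          norm_ge_zero])
    also have "\<dots> \<le> (e + c * (2 * (cmod (w - z))\<^sup>2 + 2 * (cmod (z - p))\<^sup>2)) * (4 * ?P w)"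
      by (intro mult_right_mono add_left_mono mult_left_mono tri c) (use pos(1) in linarith)
    also have "\<dots> = (4 * e + 8 * c * (cmod (z - p))\<^sup>2) * ?P w + 8 * c * height z"
    proof -
      have "(e + c * (2 * q + 2 * r)) * (4 * (h / q)) = (4 * e + 8 * c * r) * (h / q) + 8 * c * h"
        if "q > 0" for q r h :: real
        using that by (simp add: field_simps)
      then show ?thesis
        using pos(2) by blast
    qed
    finally show "cmod ((Y w - Y p) * F_kernel z w) \<le> (4 * e + 8 * c * (cmod (z - p))\<^sup>2) * ?P w + 8 * c
        * height z" .
  qed (use ne in auto)
  also have "\<dots> = (4 * e + 8 * c * (cmod (z - p))\<^sup>2) * (LINT w|circle_measure. ?P w)
      + (LINT w|circle_measure. 8 * c * height z)"
    by (subst Bochner_Integration.integral_add)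
      (auto intro!: integrable_mult_right integrable_circle P continuous_intros simp del:
          times_divide_eq_right)
  also have "\<dots> = 2 * pi * (4 * e + 8 * c * (height z + (cmod (z - p))\<^sup>2))"
    unfolding circle_Poisson[OF z] circle_measure_univ by (simp add: algebra_simps)
  finally show ?thesis
    unfolding norm_eq by (simp add: divide_le_eq mult.commute)
qed

lemma continuous_on_F_op_extension:
  assumes Y: "continuous_on (sphere 0 1) Y"
  shows "continuous_on (cball 0 1) (\<lambda>z. if z \<in> disc then F_op Y z else Y z)" (is "continuous_on _ ?U")
  unfolding continuous_on_eq_continuous_within
proof
  fix p :: complex assume p: "p \<in> cball 0 1"
  show "continuous (at p within cball 0 1) ?U"
  proof (cases "p \<in> disc")
    case True
    have "continuous_on disc (F_op Y)"
      by (rule C_k_on_continuous_on[OF open_ball C_k_on_F_op[OF Y]])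
    then have "continuous_on disc ?U"
      by (rule continuous_on_eq) simp
    then show ?thesis
      using True by (simp add: continuous_on_eq_continuous_at continuous_at_imp_continuous_at_within)
  next
    case False
    then have p1: "cmod p = 1"
      using p by auto
    have "bounded (Y ` sphere 0 1)"
      using Y by (intro compact_imp_bounded compact_continuous_image) auto
    then obtain M where M: "\<forall>w\<in>sphere 0 1. cmod (Y w) \<le> M" "M > 0"
      unfolding bounded_pos by auto
    show ?thesis
      unfolding continuous_within_eps_delta
    proof (intro allI impI)
      fix e :: real assume "e > 0"
      then obtain d where d: "d > 0" "\<forall>w\<in>sphere 0 1. dist w p < d \<longrightarrow> dist (Y w) (Y p) < e / 8"
        using Y p1 unfolding continuous_on_iff by (metis dist_0_norm mem_sphere zero_less_divide_iff
            zero_less_numeral)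
      \<comment> \<open>Beyond distance \<open>d\<close> from \<open>p\<close> the term c |w - p|^2
        is at least 2 M, which bounds the oscillation of \<open>Y\<close>.\<close>
      define c where "c = 2 * M / d\<^sup>2"
      have c: "c \<ge> 0"
        using M d by (simp add: c_def)
      have mod: "cmod (Y w - Y p) \<le> e / 8 + c * (cmod (w - p))\<^sup>2" if w: "cmod w = 1" for w
      proof (cases "dist w p < d")
        case True
        then have "cmod (Y w - Y p) < e / 8"
          using d(2) w by (simp add: dist_norm)
        moreover have "0 \<le> c * (cmod (w - p))\<^sup>2"
          using c by simp
        ultimately show ?thesis
          by linarith
      next
        case False
        then have "d\<^sup>2 \<le> (cmod (w - p))\<^sup>2"
          using d(1) by (intro power_mono) (auto simp: dist_norm)
        then have "c * d\<^sup>2 \<le> c * (cmod (w - p))\<^sup>2"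
          by (intro mult_left_mono c)
        moreover have "c * d\<^sup>2 = 2 * M"
          using d(1) by (simp add: c_def)
        moreover have "cmod (Y w - Y p) \<le> M + M"
          using M w p1 by (intro norm_triangle_le_diff add_mono) auto
        ultimately show ?thesis
          using \<open>e > 0\<close> by linarith
      qed
      have bound: "cmod (?U z - Y p) \<le> e / 2 + 8 * c * (height z + (cmod (z - p))\<^sup>2)" if "z \<in> cball 0
          1" for z
      proof (cases "z \<in> disc")
        case True
        then show ?thesis
          using F_op_boundary_estimate[OF Y True c mod] by simp
      next
        case False
        then have z: "cmod z = 1"
          using that by auto
        have "c * (cmod (z - p))\<^sup>2 \<ge> 0"
          using c by simp
        with mod[OF z] \<open>e > 0\<close> show ?thesis
          using False z by simp
      qed
      have "isCont (\<lambda>z. 8 * c * (height z + (cmod (z - p))\<^sup>2)) p"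
        by (intro continuous_intros)
      then obtain k where k: "k > 0" "\<And>z. dist z p < k \<Longrightarrow>
          dist (8 * c * (height z + (cmod (z - p))\<^sup>2)) (8 * c * (height p + (cmod (p - p))\<^sup>2)) < e / 2"
        using \<open>e > 0\<close> unfolding continuous_at_eps_delta by (metis half_gt_zero)
      show "\<exists>k>0. \<forall>z\<in>cball 0 1. dist z p < k \<longrightarrow> dist (?U z) (?U p) < e"
      proof (intro exI[of _ k] conjI ballI impI k(1))
        fix z assume "z \<in> cball 0 1" "dist z p < k"
        then have "cmod (?U z - Y p) < e"
          using bound[of z] k(2)[of z] p1 by (simp add: dist_real_def abs_less_iff)
        then show "dist (?U z) (?U p) < e"
          using False by (simp add: dist_norm)
      qed
    qed
  qed
qed

section \<open>Square integrable boundary values\<close>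

lemma L2_circle_continuous: "continuous_on (sphere 0 1) Y \<Longrightarrow> L2_circle Y"
  unfolding L2_circle_def by (intro conjI borel_measurable_circle integrable_circle continuous_intros)

lemma norm_diff_sq_le: "(norm (a - b))\<^sup>2 \<le> 2 * (norm a)\<^sup>2 + 2 * (norm (b :: 'a::real_normed_vector))\<^sup>2"
proof -
  have "(norm (a - b))\<^sup>2 \<le> (norm a + norm b)\<^sup>2"
    by (intro power_mono norm_triangle_ineq4) auto
  also have "\<dots> \<le> 2 * (norm a)\<^sup>2 + 2 * (norm b)\<^sup>2"
    using sum_squares_bound[of "norm a" "norm b"] by (simp add: power2_sum)
  finally show ?thesis .
qed

lemma L2_circle_diff:
  assumes "L2_circle X" "L2_circle Y"
  shows "L2_circle (\<lambda>w. X w - Y w)"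
    and "(LINT w|circle_measure. (cmod (X w - Y w))\<^sup>2) \<le>
      2 * (LINT w|circle_measure. (cmod (X w))\<^sup>2) + 2 * (LINT w|circle_measure. (cmod (Y w))\<^sup>2)"
proof -
  note [measurable] = assms[unfolded L2_circle_def, THEN conjunct1]
  note int = assms[unfolded L2_circle_def, THEN conjunct2]
  have i2: "integrable circle_measure (\<lambda>w. 2 * (cmod (X w))\<^sup>2 + 2 * (cmod (Y w))\<^sup>2)"
    using int by (intro Bochner_Integration.integrable_add integrable_mult_right) auto
  have i: "integrable circle_measure (\<lambda>w. (cmod (X w - Y w))\<^sup>2)"
    by (rule Bochner_Integration.integrable_bound[OF i2])
      (auto intro!: AE_I2 order_trans[OF norm_diff_sq_le])
  then show "L2_circle (\<lambda>w. X w - Y w)"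
    by (simp add: L2_circle_def)
  have "(LINT w|circle_measure. (cmod (X w - Y w))\<^sup>2) \<le>
      (LINT w|circle_measure. 2 * (cmod (X w))\<^sup>2 + 2 * (cmod (Y w))\<^sup>2)"
    by (intro integral_mono i i2 norm_diff_sq_le)
  also have "\<dots> = 2 * (LINT w|circle_measure. (cmod (X w))\<^sup>2) + 2 * (LINT w|circle_measure. (cmod (Y w))\<^sup>2)"
    using int by simp
  finally show "(LINT w|circle_measure. (cmod (X w - Y w))\<^sup>2) \<le>
      2 * (LINT w|circle_measure. (cmod (X w))\<^sup>2) + 2 * (LINT w|circle_measure. (cmod (Y w))\<^sup>2)" .
qed

lemma continuous_on_dilation:
  assumes "continuous_on disc X" "0 < \<epsilon>" "\<epsilon> < 1"
  shows "continuous_on (sphere 0 1) (\<lambda>w. X (of_real (1 - \<epsilon>) * w))"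
proof (rule continuous_on_compose2[OF assms(1)])
  show "(\<lambda>w. of_real (1 - \<epsilon>) * w) ` sphere 0 1 \<subseteq> disc"
  proof (rule image_subsetI)
    fix w :: complex assume "w \<in> sphere 0 1"
    then show "of_real (1 - \<epsilon>) * w \<in> disc"
      unfolding mem_ball dist_0_norm norm_mult norm_of_real using assms(2,3) by simp
  qed
qed (intro continuous_intros)

lemma eventually_at_right_0_1: "eventually (\<lambda>\<epsilon>::real. 0 < \<epsilon> \<and> \<epsilon> < 1) (at_right 0)"
  unfolding eventually_at_right_field by (intro exI[of _ 1]) auto

lemma has_L2_boundary_diff:
  assumes X: "has_L2_boundary X1 Y1" "has_L2_boundary X2 Y2"
  shows "has_L2_boundary (\<lambda>z. X1 z - X2 z) (\<lambda>w. Y1 w - Y2 w)"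
proof -
  have c: "continuous_on disc X1" "continuous_on disc X2" and Y: "L2_circle Y1" "L2_circle Y2"
    using X by (auto simp: has_L2_boundary_def)
  let ?I = "\<lambda>X Y \<epsilon>. LINT w|circle_measure. (cmod (X (of_real (1 - \<epsilon>) * w) - Y w))\<^sup>2"
  have "((\<lambda>\<epsilon>. 2 * ?I X1 Y1 \<epsilon> + 2 * ?I X2 Y2 \<epsilon>) \<longlongrightarrow> 2 * 0 + 2 * 0) (at_right 0)"
    using X by (intro tendsto_intros) (auto simp: has_L2_boundary_def)
  then have lim: "((\<lambda>\<epsilon>. 2 * ?I X1 Y1 \<epsilon> + 2 * ?I X2 Y2 \<epsilon>) \<longlongrightarrow> 0) (at_right 0)"
    by simp
  have "?I (\<lambda>z. X1 z - X2 z) (\<lambda>w. Y1 w - Y2 w) \<epsilon> \<le> 2 * ?I X1 Y1 \<epsilon> + 2 * ?I X2 Y2 \<epsilon>"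
    if "0 < \<epsilon> \<and> \<epsilon> < 1" for \<epsilon>
  proof -
    have "L2_circle (\<lambda>w. X1 (of_real (1 - \<epsilon>) * w) - Y1 w)" "L2_circle (\<lambda>w. X2 (of_real (1 - \<epsilon>) * w) - Y2 w)"
      using that L2_circle_diff(1)[OF L2_circle_continuous[OF continuous_on_dilation]] c Y by simp_all
    from L2_circle_diff(2)[OF this] show ?thesis
      by (simp add: algebra_simps)
  qed
  then have "eventually (\<lambda>\<epsilon>. ?I (\<lambda>z. X1 z - X2 z) (\<lambda>w. Y1 w - Y2 w) \<epsilon> \<le> 2 * ?I X1 Y1 \<epsilon> + 2 * ?I X2 Y2
      \<epsilon>) (at_right 0)"
    using eventually_at_right_0_1 by (rule eventually_mono[rotated])
  then have "(?I (\<lambda>z. X1 z - X2 z) (\<lambda>w. Y1 w - Y2 w) \<longlongrightarrow> 0) (at_right 0)"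
    by (intro tendsto_sandwich[OF _ _ tendsto_const lim]) (auto intro!: always_eventually)
  then show ?thesis
    using c Y by (simp add: has_L2_boundary_def continuous_on_diff L2_circle_diff)
qed

lemma has_L2_boundary_unique:
  assumes "has_L2_boundary X Y1" "has_L2_boundary X Y2"
  shows "AE w in circle_measure. Y1 w = Y2 w"
proof -
  have "has_L2_boundary (\<lambda>z. X z - X z) (\<lambda>w. Y1 w - Y2 w)"
    by (rule has_L2_boundary_diff[OF assms])
  then have L: "L2_circle (\<lambda>w. Y1 w - Y2 w)"
    and "((\<lambda>\<epsilon>::real. LINT w|circle_measure. (cmod (Y1 w - Y2 w))\<^sup>2) \<longlongrightarrow> 0) (at_right 0)"
    by (auto simp: has_L2_boundary_def norm_minus_commute)
  then have "(LINT w|circle_measure. (cmod (Y1 w - Y2 w))\<^sup>2) = 0"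
    by (simp add: tendsto_const_iff trivial_limit_at_right_real)
  then have "AE w in circle_measure. (cmod (Y1 w - Y2 w))\<^sup>2 = 0"
    using L by (subst (asm) integral_nonneg_eq_0_iff_AE) (auto simp: L2_circle_def)
  then show ?thesis
    by simp
qed

lemma has_L2_boundaryI:
  assumes U: "continuous_on (cball 0 1) U"
    and X: "\<And>z. z \<in> disc \<Longrightarrow> X z = U z" and Y: "\<And>w. w \<in> sphere 0 1 \<Longrightarrow> Y w = U w"
  shows "has_L2_boundary X Y"
proof -
  have cX: "continuous_on disc X"
    by (rule continuous_on_eq[OF continuous_on_subset[OF U]]) (auto simp: X)
  have cY: "continuous_on (sphere 0 1) Y"
    by (rule continuous_on_eq[OF continuous_on_subset[OF U]]) (auto simp: Y)
  have uc: "uniformly_continuous_on (cball 0 1) U"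
    by (rule compact_uniformly_continuous[OF U compact_cball])
  let ?I = "\<lambda>\<epsilon>. LINT w|circle_measure. (cmod (X (of_real (1 - \<epsilon>) * w) - Y w))\<^sup>2"
  have "(?I \<longlongrightarrow> 0) (at_right 0)"
  proof (rule tendstoI)
    fix e :: real assume "e > 0"
    \<comment> \<open>The circle has mass 2 pi, so a uniform error below \<open>k\<close>
      contributes at most 2 pi k^2 = e / 2.\<close>
    define k where "k = sqrt (e / (4 * pi))"
    have k: "k > 0" "2 * pi * k\<^sup>2 < e"
      using \<open>e > 0\<close> by (simp_all add: k_def)
    then obtain d where d: "d > 0"
      "\<And>x y. x \<in> cball 0 1 \<Longrightarrow> y \<in> cball 0 1 \<Longrightarrow> dist y x < d \<Longrightarrow> dist (U y) (U x) < k"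
      using uc unfolding uniformly_continuous_on_def by metis
    have "dist (?I \<epsilon>) 0 < e" if \<epsilon>: "0 < \<epsilon>" "\<epsilon> < min d 1" for \<epsilon>
    proof -
      have le: "(cmod (X (of_real (1 - \<epsilon>) * w) - Y w))\<^sup>2 \<le> k\<^sup>2" if w: "cmod w = 1" for w
      proof -
        have "cmod (of_real (1 - \<epsilon>) * w) = 1 - \<epsilon>"
          unfolding norm_mult norm_of_real w using \<epsilon> by simp
        moreover have "dist (of_real (1 - \<epsilon>) * w) w < d"
          using \<epsilon> w by (simp add: dist_norm algebra_simps norm_mult)
        ultimately have "cmod (X (of_real (1 - \<epsilon>) * w) - Y w) < k"
          using d(2)[of w "of_real (1 - \<epsilon>) * w"] \<epsilon> w X[of "of_real (1 - \<epsilon>) * w"] Y[of w]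
          by (simp add: dist_norm)
        then show ?thesis
          by (intro power_mono) auto
      qed
      have "?I \<epsilon> \<le> (LINT w|circle_measure. k\<^sup>2)"
        using \<epsilon> by (intro integral_mono integrable_circle continuous_intros continuous_on_dilation cX
            cY) (use le in auto)
      also have "\<dots> < e"
        using k(2) by (simp only: circle_measure_univ)
      finally show ?thesis
        by (simp add: dist_real_def)
    qed
    then show "eventually (\<lambda>\<epsilon>. dist (?I \<epsilon>) 0 < e) (at_right 0)"
      unfolding eventually_at_right_field using d(1) by (intro exI[of _ "min d 1"]) auto
  qed
  then show ?thesis
    using cX L2_circle_continuous[OF cY] by (simp add: has_L2_boundary_def)
qed

lemma L2_circle_integrable:
  assumes "L2_circle Y" "continuous_on (sphere 0 1) \<phi>"
  shows "integrable circle_measure (\<lambda>w. Y w * \<phi> w)"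
proof -
  have [measurable]: "Y \<in> borel_measurable circle_measure" "\<phi> \<in> borel_measurable circle_measure"
    using assms borel_measurable_circle by (auto simp: L2_circle_def)
  have i: "integrable circle_measure (\<lambda>w. (cmod (Y w))\<^sup>2 + (cmod (\<phi> w))\<^sup>2)"
    using assms L2_circle_continuous[OF assms(2)]
    by (intro Bochner_Integration.integrable_add) (auto simp: L2_circle_def)
  show ?thesis
  proof (rule Bochner_Integration.integrable_bound[OF i])
    have "cmod (Y w * \<phi> w) \<le> (cmod (Y w))\<^sup>2 + (cmod (\<phi> w))\<^sup>2" for w
    proof -
      have "0 \<le> cmod (Y w) * cmod (\<phi> w)"
        by simp
      then show ?thesis
        unfolding norm_mult using sum_squares_bound[of "cmod (Y w)" "cmod (\<phi> w)"]
        by (simp only: mult.assoc)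
    qed
    then show "AE w in circle_measure. cmod (Y w * \<phi> w) \<le> norm ((cmod (Y w))\<^sup>2 + (cmod (\<phi> w))\<^sup>2)"
      by simp
  qed measurable
qed

text \<open>Instead of Cauchy-Schwarz the proof uses x <= \<eta> + x^2 / \<eta> pointwise. With
  \<eta> fixed so that the constant integrates to e / 2, the quadratic term is small by convergence
  in mean square.\<close>

lemma has_L2_boundary_weak_limit:
  assumes X: "has_L2_boundary X Y" and \<phi>: "continuous_on (sphere 0 1) \<phi>" "\<And>w. cmod w = 1 \<Longrightarrow> cmod (\<phi> w) \<le> 1"
  shows "((\<lambda>\<epsilon>. LINT w|circle_measure. X (of_real (1 - \<epsilon>) * w) * \<phi> w) \<longlongrightarrow>
    (LINT w|circle_measure. Y w * \<phi> w)) (at_right 0)"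
proof (rule tendstoI)
  fix e :: real assume e: "e > 0"
  have c: "continuous_on disc X" and Y: "L2_circle Y"
    and lim: "((\<lambda>\<epsilon>::real. LINT w|circle_measure. (cmod (X (of_real (1 - \<epsilon>) * w) - Y w))\<^sup>2) \<longlongrightarrow> 0)
        (at_right 0)"
    using X by (auto simp: has_L2_boundary_def)
  define \<eta> where "\<eta> = e / (4 * pi)"
  have \<eta>: "\<eta> > 0" "2 * pi * \<eta> = e / 2"
    using e by (simp_all add: \<eta>_def)
  have "eventually (\<lambda>\<epsilon>::real. dist (LINT w|circle_measure. (cmod (X (of_real (1 - \<epsilon>) * w) - Y w))\<^sup>2) 0
      < \<eta> * (e / 2)) (at_right 0)"
    using e \<eta> by (intro tendstoD[OF lim]) simp
  with eventually_at_right_0_1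
  show "eventually (\<lambda>\<epsilon>. dist (LINT w|circle_measure. X (of_real (1 - \<epsilon>) * w) * \<phi> w)
      (LINT w|circle_measure. Y w * \<phi> w) < e) (at_right 0)"
  proof eventually_elim
    case (elim \<epsilon>)
    let ?Z = "\<lambda>w. X (of_real (1 - \<epsilon>) * w)"
    have AM_GM: "x \<le> \<eta> + (1 / \<eta>) * x\<^sup>2" for x :: real
    proof -
      have "\<eta> * x \<le> \<eta>\<^sup>2 + x\<^sup>2"
        using sum_squares_bound[of \<eta> x] zero_le_power2[of \<eta>] zero_le_power2[of x] by linarith
      then show ?thesis
        using \<eta>(1) by (simp add: field_simps power2_eq_square)
    qed
    have Z: "L2_circle ?Z"
      using elim by (intro L2_circle_continuous continuous_on_dilation c) auto
    have ZY: "L2_circle (\<lambda>w. ?Z w - Y w)"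
      by (rule L2_circle_diff[OF Z Y])
    have "(LINT w|circle_measure. ?Z w * \<phi> w) - (LINT w|circle_measure. Y w * \<phi> w) =
        (LINT w|circle_measure. (?Z w - Y w) * \<phi> w)"
      using L2_circle_integrable[OF Z \<phi>(1)] L2_circle_integrable[OF Y \<phi>(1)] by (simp add: left_diff_distrib)
    then have "dist (LINT w|circle_measure. ?Z w * \<phi> w) (LINT w|circle_measure. Y w * \<phi> w) \<le>
        (LINT w|circle_measure. cmod ((?Z w - Y w) * \<phi> w))"
      using integral_norm_bound[of circle_measure "\<lambda>w. (?Z w - Y w) * \<phi> w"] by (simp add: dist_norm)
    also have "\<dots> \<le> (LINT w|circle_measure. \<eta> + (1 / \<eta>) * (cmod (?Z w - Y w))\<^sup>2)"
    proof (rule integral_mono)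
      show "integrable circle_measure (\<lambda>w. cmod ((?Z w - Y w) * \<phi> w))"
        by (rule integrable_norm[OF L2_circle_integrable[OF ZY \<phi>(1)]])
      show "integrable circle_measure (\<lambda>w. \<eta> + (1 / \<eta>) * (cmod (?Z w - Y w))\<^sup>2)"
        using ZY integrable_circle[of "\<lambda>w. \<eta>", OF continuous_on_const]
        by (intro Bochner_Integration.integrable_add integrable_mult_right) (simp_all add: L2_circle_def)
      fix w assume "w \<in> space circle_measure"
      then have "cmod ((?Z w - Y w) * \<phi> w) \<le> cmod (?Z w - Y w) * 1"
        unfolding norm_mult using \<phi>(2)[of w] by (intro mult_left_mono) auto
      also have "\<dots> \<le> \<eta> + (1 / \<eta>) * (cmod (?Z w - Y w))\<^sup>2"
        using AM_GM[of "cmod (?Z w - Y w)"] by simp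
      finally show "cmod ((?Z w - Y w) * \<phi> w) \<le> \<eta> + (1 / \<eta>) * (cmod (?Z w - Y w))\<^sup>2" .
    qed
    also have "\<dots> = 2 * pi * \<eta> + (1 / \<eta>) * (LINT w|circle_measure. (cmod (?Z w - Y w))\<^sup>2)"
      using ZY integrable_circle[of "\<lambda>w. \<eta>"] circle_measure_univ[of 1]
      by (subst Bochner_Integration.integral_add) (auto simp: L2_circle_def)
    also have "\<dots> < e / 2 + (1 / \<eta>) * (\<eta> * (e / 2))"
      unfolding \<eta>(2) using elim(2) \<eta>(1) by (intro add_strict_left_mono mult_strict_left_mono) auto
    also have "\<dots> = e"
      using \<eta>(1) by simp
    finally show ?case .
  qed
qed

section \<open>Taylor coefficients and Killing fields\<close>

definition taylor_coeff :: "(complex \<Rightarrow> complex) \<Rightarrow> nat \<Rightarrow> complex"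
  where "taylor_coeff f n = (deriv ^^ n) f 0 / fact n"

lemma taylor_coeff_sums:
  assumes "f holomorphic_on disc" "z \<in> disc"
  shows "(\<lambda>n. taylor_coeff f n * z ^ n) sums f z"
  using holomorphic_power_series[OF assms] by (simp add: taylor_coeff_def)

lemmas circle_taylor = circle_coefficient[folded taylor_coeff_def]

lemma taylor_coeff_deriv:
  assumes "\<And>z. z \<in> disc \<Longrightarrow> (G has_field_derivative g z) (at z)"
  shows "taylor_coeff G (Suc n) = taylor_coeff g n / of_nat (Suc n)"
proof -
  have "eventually (\<lambda>z. z \<in> disc) (nhds 0)"
    by (intro eventually_nhds_in_open) auto
  then have "eventually (\<lambda>z. deriv G z = g z) (nhds 0)"
    by eventually_elim (rule DERIV_imp_deriv[OF assms])
  then have "(deriv ^^ n) (deriv G) 0 = (deriv ^^ n) g 0"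
    by (intro higher_deriv_cong_ev) auto
  then show ?thesis
    by (simp add: taylor_coeff_def funpow_swap1 field_simps)
qed

lemma taylor_coeff_times:
  assumes f: "f holomorphic_on disc"
  shows "taylor_coeff (\<lambda>z. z * f z) (Suc n) = taylor_coeff f n"
proof -
  have "2 * of_real pi * (of_real (1/2) ^ Suc n * taylor_coeff (\<lambda>z. z * f z) (Suc n)) =
      (LINT w|circle_measure. of_real (1/2) * w * f (of_real (1/2) * w) * cnj w ^ Suc n)"
    by (rule circle_taylor(1)[symmetric]) (auto intro!: holomorphic_intros f)
  also have "\<dots> = (LINT w|circle_measure. of_real (1/2) * (f (of_real (1/2) * w) * cnj w ^ n))"
    by (rule circle_integral_cong) (use circle_cnj in \<open>simp add: mult_ac\<close>)
  also have "\<dots> = of_real (1/2) * (LINT w|circle_measure. f (of_real (1/2) * w) * cnj w ^ n)"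
    by (rule integral_mult_right_zero)
  also have "\<dots> = of_real (1/2) * (2 * of_real pi * (of_real (1/2) ^ n * taylor_coeff f n))"
    by (subst circle_taylor(1)[OF f]) auto
  finally show ?thesis
    by simp
qed

lemma holomorphic_quadratic:
  assumes "f holomorphic_on disc" "\<And>n. taylor_coeff f (n + 3) = 0" "z \<in> disc"
  shows "f z = taylor_coeff f 0 + taylor_coeff f 1 * z + taylor_coeff f 2 * z\<^sup>2"
proof -
  have "taylor_coeff f n = 0" if "n \<notin> {..<3}" for n
    using assms(2)[of "n - 3"] that by simp
  then have "(\<lambda>n. taylor_coeff f n * z ^ n) sums (\<Sum>n<3. taylor_coeff f n * z ^ n)"
    by (intro sums_finite) auto
  then show ?thesis
    using sums_unique2[OF taylor_coeff_sums[OF assms(1,3)]] by (simp add: eval_nat_numeral)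
qed

lemma dilation_in_disc: "0 < r \<Longrightarrow> r < 1 \<Longrightarrow> cmod w = 1 \<Longrightarrow> of_real r * w \<in> disc"
  by (simp add: norm_mult)

lemma holomorphic_continuous_on_dilation:
  assumes "f holomorphic_on disc" "0 < r" "r < 1"
  shows "continuous_on (sphere 0 1) (\<lambda>w. f (of_real r * w))"
  using continuous_on_dilation[OF holomorphic_on_imp_continuous_on[OF assms(1)], of "1 - r"] assms(2,3)
      by simp

lemma circle_taylor_cnj:
  assumes "f holomorphic_on disc" "0 < r" "r < 1"
  shows "(LINT w|circle_measure. cnj (f (of_real r * w)) * w ^ k) =
      2 * of_real pi * (of_real r ^ k * cnj (taylor_coeff f k))"
    and "(LINT w|circle_measure. cnj (f (of_real r * w)) * cnj w ^ Suc k) = 0"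
proof -
  have "cnj (LINT w|circle_measure. f (of_real r * w) * cnj w ^ k) =
      (LINT w|circle_measure. cnj (f (of_real r * w) * cnj w ^ k))"
    by (rule Bochner_Integration.integral_cnj[symmetric])
  then show "(LINT w|circle_measure. cnj (f (of_real r * w)) * w ^ k) =
      2 * of_real pi * (of_real r ^ k * cnj (taylor_coeff f k))"
    unfolding circle_taylor(1)[OF assms] by simp
  have "cnj (LINT w|circle_measure. f (of_real r * w) * w ^ Suc k) =
      (LINT w|circle_measure. cnj (f (of_real r * w) * w ^ Suc k))"
    by (rule Bochner_Integration.integral_cnj[symmetric])
  then show "(LINT w|circle_measure. cnj (f (of_real r * w)) * cnj w ^ Suc k) = 0"
    unfolding circle_taylor(2)[OF assms] by simp
qed

text \<open>These polynomials are the Lie algebra su(1,1) in the coordinate z. Holomorphy leaves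
  only the conformal term of \<open>lie_metric_eq\<close>, and it cancels because the inner product
  of z with X is Re (cnj a z) times the height while Re X' = - 2 Re (cnj a z).\<close>

lemma killing_fieldsI:
  assumes X: "\<And>z. z \<in> disc \<Longrightarrow> X z = a + b * z - cnj a * z\<^sup>2" and b: "Re b = 0"
  shows "X \<in> killing_fields"
proof -
  let ?p = "\<lambda>z. a + b * z - cnj a * z\<^sup>2"
  have "C_k_on k disc ?p" for k
    by (intro holomorphic_on_imp_C_k_on open_ball holomorphic_intros)
  then have "C_k_on k disc X" for k
    by (rule C_k_on_cong[OF open_ball]) (simp add: X)
  then have "smooth_on disc X"
    by (intro smooth_on_openI open_ball)
  moreover have "lie_metric X z u v = 0" if z: "z \<in> disc" for z u v
  proof -
    have "(?p has_field_derivative (b - 2 * cnj a * z)) (at z)"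
      by (auto intro!: derivative_eq_intros)
    then have "has_wirtinger ?p (b - 2 * cnj a * z) 0 (at z)"
      by (rule has_wirtinger_field)
    then have d: "has_wirtinger X (b - 2 * cnj a * z) 0 (at z)"
      using has_derivative_cong_open[where f = X and g = ?p, OF open_ball z X] by blast
    have "z \<bullet> X z = Re (cnj a * z) * height z"
    proof -
      have "z \<bullet> X z = Re (cnj z * a + b * (z * cnj z) - cnj a * z * (z * cnj z))"
        unfolding inner_eq_Re X[OF z] by (simp add: algebra_simps power2_eq_square)
      also have "\<dots> = Re (cnj z * a) + Re b * (cmod z)\<^sup>2 - Re (cnj a * z) * (cmod z)\<^sup>2"
        unfolding complex_norm_square[symmetric] by (simp del: of_real_power)
      also have "Re (cnj z * a) = Re (cnj a * z)"
        by simp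
      finally show ?thesis
        using b by (simp add: algebra_simps)
    qed
    moreover have "16 * (x * h) / h ^ 3 + 2 * (4 / h\<^sup>2) * (- 2 * x) = 0" if "h > 0" for x h :: real
      using that by (simp add: field_simps power2_eq_square power3_eq_cube)
    moreover have "Re (b - 2 * cnj a * z) = - 2 * Re (cnj a * z)"
      using b by simp
    ultimately have "16 * (z \<bullet> X z) / (height z) ^ 3 + 2 * conf_factor z * Re (b - 2 * cnj a * z) = 0"
      using height_pos[OF z] by (simp only: conf_factor_def)
    then show ?thesis
      by (simp only: lie_metric_eq[OF z d]) simp
  qed
  ultimately show ?thesis
    by (simp add: killing_fields_def)
qed

lemma killing_fields_holomorphic:
  assumes X: "X \<in> killing_fields" and z: "z \<in> disc"
  shows "\<exists>a. (X has_field_derivative a) (at z) \<and> height z * Re a + 2 * Re (cnj z * X z) = 0"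
proof -
  have "X differentiable (at z)"
    using X smooth_on_differentiable[OF open_ball _ z] by (auto simp: killing_fields_def)
  then obtain a b where ab: "has_wirtinger X a b (at z)"
    by (rule differentiable_has_wirtinger)
  define K where "K = 16 * (z \<bullet> X z) / (height z) ^ 3 + 2 * conf_factor z * Re a"
  define h where "h = 2 * of_real (conf_factor z) * cnj b"
  have "K * (u \<bullet> v) + Re (h * (u * v)) = 0" for u v
    using X lie_metric_eq[OF z ab, of u v] z by (simp add: killing_fields_def K_def h_def)
  \<comment> \<open>The first two pairs give K + Re h = 0 and K - Re h = 0, the third gives Im h =
    0.\<close>
  from this[of 1 1] this[of \<i> \<i>] this[of 1 \<i>] have "K = 0" "h = 0"
    by (auto simp: inner_complex_def complex_eq_iff)
  then have "b = 0"
    using conf_factor_pos[OF z] by (simp add: h_def)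
  then have "(X has_field_derivative a) (at z)"
    using ab by (simp add: has_field_derivative_def)
  moreover have "height z * Re a + 2 * Re (cnj z * X z) = 0"
  proof -
    have "h * r + 2 * x = 0" if "16 * x / h ^ 3 + 2 * (4 / h\<^sup>2) * r = 0" "h > 0" for h r x :: real
      using that by (simp add: field_simps power2_eq_square power3_eq_cube)
    then show ?thesis
      using \<open>K = 0\<close> height_pos[OF z] unfolding K_def conf_factor_def inner_eq_Re by blast
  qed
  ultimately show ?thesis
    by blast
qed

text \<open>The field is holomorphic, and on a single circle the remaining equation relates its
  Taylor coefficients to their conjugates. In the mode of \<open>cnj w ^ m\<close> with m at least 2
  the conjugate terms drop out and c (m + 1) carries a positive factor, so it vanishes. Modes 1 and
  0 give c 2 = - cnj (c 0) and Re (c 1) = 0.\<close>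

lemma killing_fieldsD:
  assumes X: "X \<in> killing_fields"
  obtains a b where "Re b = 0" "\<And>z. z \<in> disc \<Longrightarrow> X z = a + b * z - cnj a * z\<^sup>2"
proof -
  obtain X' where X': "\<And>z. z \<in> disc \<Longrightarrow> (X has_field_derivative X' z) (at z)"
    and eq: "\<And>z. z \<in> disc \<Longrightarrow> height z * Re (X' z) + 2 * Re (cnj z * X z) = 0"
    using killing_fields_holomorphic[OF X] by metis
  have hX: "X holomorphic_on disc"
    unfolding holomorphic_on_open[OF open_ball] using X' by blast
  have "X' z = deriv X z" if "z \<in> disc" for z
    using DERIV_imp_deriv[OF X'[OF that]] by simp
  then have hX': "X' holomorphic_on disc"
    by (intro holomorphic_transform[OF holomorphic_deriv[OF hX open_ball]]) simp
  \<comment> \<open>On this circle the height is 3 / 4 and 2 r = 1, which explains the coefficients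
    in \<open>rel\<close>.\<close>
  define r :: real where "r = 1 / 2"
  define c where "c = taylor_coeff X"
  have r: "0 < r" "r < 1"
    by (simp_all add: r_def)
  have c': "taylor_coeff X' n = of_nat (Suc n) * c (Suc n)" for n
    using taylor_coeff_deriv[OF X', of n] by (simp add: c_def del: of_nat_Suc)
  note cont = holomorphic_continuous_on_dilation[OF hX r] holomorphic_continuous_on_dilation[OF hX' r]
  text \<open>On the circle of radius \<open>r\<close> the Killing equation is a relation between Fourier series.\<close>
  have rel: "of_real (3 / 4) * (X' (of_real r * w) + cnj (X' (of_real r * w)))
      + (cnj w * X (of_real r * w) + w * cnj (X (of_real r * w))) = 0" if w: "cmod w = 1" for w
  proof -
    have "cmod (of_real r * w) = r"
      using w r by (simp add: norm_mult)
    then have "height (of_real r * w) = 3 / 4"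
      by (simp add: r_def power2_eq_square)
    with eq[OF dilation_in_disc[OF r w]]
    have "3 / 4 * Re (X' (of_real r * w)) + 2 * Re (cnj (of_real r * w) * X (of_real r * w)) = 0"
      by (simp only:)
    moreover have "2 * Re (cnj (of_real r * w) * x) = Re (cnj w * x)" for x
      by (simp add: r_def)
    ultimately have "3 / 4 * Re (X' (of_real r * w)) + Re (cnj w * X (of_real r * w)) = 0"
      by (simp only:)
    then show ?thesis
      by (simp add: complex_eq_iff)
  qed
  have modes: "of_real (3 / 4) * ((LINT w|circle_measure. X' (of_real r * w) * cnj w ^ m)
      + (LINT w|circle_measure. cnj (X' (of_real r * w)) * cnj w ^ m))
      + ((LINT w|circle_measure. X (of_real r * w) * cnj w ^ Suc m)
        + (LINT w|circle_measure. cnj (X (of_real r * w)) * (w * cnj w ^ m))) = 0" for m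
  proof -
    have i: "integrable circle_measure (\<lambda>w. X' (of_real r * w) * cnj w ^ m)"
      "integrable circle_measure (\<lambda>w. cnj (X' (of_real r * w)) * cnj w ^ m)"
      "integrable circle_measure (\<lambda>w. X (of_real r * w) * cnj w ^ Suc m)"
      "integrable circle_measure (\<lambda>w. cnj (X (of_real r * w)) * (w * cnj w ^ m))"
      by (intro integrable_circle continuous_intros cont)+
    have "(LINT w|circle_measure. of_real (3 / 4) * (X' (of_real r * w) * cnj w ^ m + cnj (X' (of_real
        r * w)) * cnj w ^ m)
        + (X (of_real r * w) * cnj w ^ Suc m + cnj (X (of_real r * w)) * (w * cnj w ^ m))) =
        (LINT w|circle_measure. (0::complex))"
    proof (rule circle_integral_cong)
      fix w :: complex assume "cmod w = 1"
      from arg_cong[OF rel[OF this], of "\<lambda>x. x * cnj w ^ m"]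
      show "of_real (3 / 4) * (X' (of_real r * w) * cnj w ^ m + cnj (X' (of_real r * w)) * cnj w ^ m)
        + (X (of_real r * w) * cnj w ^ Suc m + cnj (X (of_real r * w)) * (w * cnj w ^ m)) = 0"
        by (simp add: algebra_simps)
    qed
    then show ?thesis
      using i by (simp only: Bochner_Integration.integral_add integral_mult_right_zero
          integrable_mult_right Bochner_Integration.integrable_add) simp
  qed
  have pi: "2 * complex_of_real pi \<noteq> 0"
    by simp
  note expand = circle_taylor(1)[OF hX' r] circle_taylor(1)[OF hX r] c' c_def[symmetric]
  have "c (n + 3) = 0" for n
  proof -
    define N where "N = Suc (Suc (Suc n))"
    have "(LINT w|circle_measure. cnj (X (of_real r * w)) * (w * cnj w ^ Suc (Suc n))) =
        (LINT w|circle_measure. cnj (X (of_real r * w)) * cnj w ^ Suc n)"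
      by (rule circle_integral_cong) (use circle_cnj in \<open>simp add: mult.assoc[symmetric]\<close>)
    from modes[of "Suc (Suc n)", unfolded this expand circle_taylor_cnj(2)[OF hX' r]
        circle_taylor_cnj(2)[OF hX r]]
    have "of_real (3 / 4) * (2 * of_real pi * (of_real r ^ Suc (Suc n) * (of_nat N * c N)))
        + 2 * of_real pi * (of_real r ^ Suc (Suc n) * of_real r * c N) = 0"
      unfolding N_def by (simp only: add_0_right power_Suc2)
    then have "2 * of_real pi * of_real r ^ Suc (Suc n) * (of_real (3 / 4) * of_nat N + of_real r) * c
        N = 0"
      by (simp only: algebra_simps)
    moreover have "of_real (3 / 4) * of_nat N + of_real r = complex_of_real (3 / 4 * real N + r)"
      by simp
    moreover have "3 / 4 * real N + r > 0"
      using r by (intro add_nonneg_pos) auto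
    ultimately have "c N = 0"
      using r(1) by (simp only: mult_eq_0_iff of_real_eq_0_iff power_eq_0_iff) auto
    then show ?thesis
      by (simp add: N_def eval_nat_numeral)
  qed
  then have X_eq: "X z = c 0 + c 1 * z + c 2 * z\<^sup>2" if "z \<in> disc" for z
    using holomorphic_quadratic[OF hX _ that] by (simp add: c_def)
  have "c 2 = - cnj (c 0)"
  proof -
    have "(LINT w|circle_measure. cnj (X (of_real r * w)) * (w * cnj w ^ 1)) =
        (LINT w|circle_measure. cnj (X (of_real r * w)) * w ^ 0)"
      by (rule circle_integral_cong) (use circle_cnj in simp)
    from modes[of "Suc 0", unfolded this[unfolded One_nat_def] expand circle_taylor_cnj(2)[OF hX' r]
        circle_taylor_cnj(1)[OF hX r]]
    have "2 * of_real pi * (of_real (3 / 4) * (of_real r * (2 * c 2)) + of_real r ^ 2 * c 2 + cnj (c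
        0)) = 0"
      by (simp add: numeral_2_eq_2 algebra_simps)
    then have "c 2 + cnj (c 0) = 0"
      by (simp add: r_def power2_eq_square)
    then show ?thesis
      by (simp add: add_eq_0_iff2)
  qed
  moreover have "Re (c 1) = 0"
  proof -
    have "(LINT w|circle_measure. cnj (X' (of_real r * w)) * cnj w ^ 0) =
        (LINT w|circle_measure. cnj (X' (of_real r * w)) * w ^ 0)"
      "(LINT w|circle_measure. cnj (X (of_real r * w)) * (w * cnj w ^ 0)) =
        (LINT w|circle_measure. cnj (X (of_real r * w)) * w ^ Suc 0)"
      by simp_all
    from modes[of 0, unfolded this expand circle_taylor_cnj(1)[OF hX' r] circle_taylor_cnj(1)[OF hX r]]
    have "2 * of_real pi * (of_real (3 / 4) * (c 1 + cnj (c 1)) + of_real r * (c 1 + cnj (c 1))) = 0"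
      by (simp add: field_simps)
    moreover have "x = 0" if "2 * of_real pi * (of_real (3 / 4) * x + of_real r * x) = 0" for x :: complex
      using that by (simp add: r_def field_simps)
    ultimately have "c 1 + cnj (c 1) = 0"
      by blast
    then show ?thesis
      by (simp add: complex_eq_iff)
  qed
  ultimately show thesis
    using that[of "c 1" "c 0"] X_eq by simp
qed

section \<open>Fourier coefficients of boundary values\<close>

lemma complex_of_real_tendsto_power_at_right_0:
  "((\<lambda>\<epsilon>. complex_of_real (1 - \<epsilon>) ^ k * c) \<longlongrightarrow> c) (at_right 0)"
proof -
  have "((\<lambda>\<epsilon>. complex_of_real (1 - \<epsilon>) ^ k * c) \<longlongrightarrow> complex_of_real (1 - 0) ^ k * c) (at_right 0)"
    by (intro tendsto_intros)
  then show ?thesis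
    by simp
qed

lemma at_right_0_limit_unique:
  fixes f g :: "real \<Rightarrow> complex"
  assumes "(f \<longlongrightarrow> a) (at_right 0)" "(g \<longlongrightarrow> b) (at_right 0)"
    and "\<And>\<epsilon>. 0 < \<epsilon> \<Longrightarrow> \<epsilon> < 1 \<Longrightarrow> f \<epsilon> = g \<epsilon>"
  shows "a = b"
proof -
  have "eventually (\<lambda>\<epsilon>. f \<epsilon> = g \<epsilon>) (at_right 0)"
    using eventually_at_right_0_1 by eventually_elim (use assms(3) in blast)
  from iffD1[OF tendsto_cong[OF this] assms(1)] show ?thesis
    by (rule tendsto_unique[OF trivial_limit_at_right_real _ assms(2)])
qed

text \<open>Boundary values of a holomorphic function lie in the Hardy space: the coefficient
  formulas on circles of radius 1 - \<epsilon> survive the limit by weak convergence.\<close>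

lemma L2_boundary_taylor:
  assumes f: "f holomorphic_on disc" and Y: "has_L2_boundary f Y"
  shows "(LINT w|circle_measure. Y w * cnj w ^ k) = 2 * of_real pi * taylor_coeff f k"
    and "(LINT w|circle_measure. Y w * w ^ Suc k) = 0"
proof -
  show "(LINT w|circle_measure. Y w * cnj w ^ k) = 2 * of_real pi * taylor_coeff f k"
  proof (rule at_right_0_limit_unique)
    show "((\<lambda>\<epsilon>. LINT w|circle_measure. f (of_real (1 - \<epsilon>) * w) * cnj w ^ k) \<longlongrightarrow>
        (LINT w|circle_measure. Y w * cnj w ^ k)) (at_right 0)"
      by (intro has_L2_boundary_weak_limit[OF Y] continuous_intros) (simp add: norm_power)
    show "((\<lambda>\<epsilon>. 2 * of_real pi * (of_real (1 - \<epsilon>) ^ k * taylor_coeff f k)) \<longlongrightarrow>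
        2 * of_real pi * taylor_coeff f k) (at_right 0)"
      by (intro tendsto_mult tendsto_const complex_of_real_tendsto_power_at_right_0)
  qed (rule circle_taylor(1)[OF f]; simp)
  show "(LINT w|circle_measure. Y w * w ^ Suc k) = 0"
  proof (rule at_right_0_limit_unique)
    show "((\<lambda>\<epsilon>. LINT w|circle_measure. f (of_real (1 - \<epsilon>) * w) * w ^ Suc k) \<longlongrightarrow>
        (LINT w|circle_measure. Y w * w ^ Suc k)) (at_right 0)"
      by (intro has_L2_boundary_weak_limit[OF Y] continuous_intros) (simp add: norm_power norm_mult)
    show "((\<lambda>\<epsilon>::real. 0) \<longlongrightarrow> (0::complex)) (at_right 0)"
      by (rule tendsto_const)
  qed (rule circle_taylor(2)[OF f]; simp)
qed

text \<open>Tangency means cnj (Y w) = - cnj w^2 * Y w, so conjugation sends the Fourier index k to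
  2 - k with a sign. Negative indices are absent, hence those above 2 are too, and the relations
  among the indices 0, 1, 2 are those of su(1,1).\<close>

lemma tangential_holomorphic_killing:
  assumes f: "f holomorphic_on disc" and Y: "has_L2_boundary f Y" and tan: "tangential Y"
  shows "f \<in> killing_fields"
proof -
  let ?c = "taylor_coeff f"
  have L2: "L2_circle Y"
    using Y by (simp add: has_L2_boundary_def)
  then have [measurable]: "Y \<in> borel_measurable circle_measure"
    by (simp add: L2_circle_def)
  obtain g :: "complex \<Rightarrow> real" where g: "AE w in circle_measure. Y w = of_real (g w) * (\<i> * w)"
    using tan by (auto simp: tangential_def)
  have cnj_int: "2 * of_real pi * cnj (?c k) = - (LINT w|circle_measure. Y w * (cnj w ^ 2 * w ^ k))" for k
  proof -
    have m: "(\<lambda>w. cnj w ^ 2 * w ^ k) \<in> borel_measurable circle_measure" "(\<lambda>w. w ^ k) \<in> borel_measurable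
        circle_measure"
      by (intro borel_measurable_circle continuous_intros)+
    moreover have "(\<lambda>w. cnj (Y w)) \<in> borel_measurable circle_measure"
      by (rule measurable_compose[OF \<open>Y \<in> borel_measurable circle_measure\<close>])
        (intro borel_measurable_continuous_onI continuous_intros)
    ultimately have [measurable]: "(\<lambda>w. cnj w ^ 2 * w ^ k) \<in> borel_measurable circle_measure"
      "(\<lambda>w. w ^ k) \<in> borel_measurable circle_measure" "(\<lambda>w. cnj (Y w)) \<in> borel_measurable circle_measure"
      by auto
    have "2 * of_real pi * cnj (?c k) = cnj (LINT w|circle_measure. Y w * cnj w ^ k)"
      by (simp add: L2_boundary_taylor[OF f Y])
    also have "\<dots> = (LINT w|circle_measure. cnj (Y w * cnj w ^ k))"
      by (rule Bochner_Integration.integral_cnj[symmetric])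
    also have "\<dots> = (LINT w|circle_measure. cnj (Y w) * w ^ k)"
      by simp
    also have "\<dots> = (LINT w|circle_measure. - (Y w * (cnj w ^ 2 * w ^ k)))"
    proof (rule integral_cong_AE)
      show "AE w in circle_measure. cnj (Y w) * w ^ k = - (Y w * (cnj w ^ 2 * w ^ k))"
        using g AE_space
      proof eventually_elim
        case (elim w)
        then have "w * cnj w = 1"
          using circle_cnj by simp
        then have "w * cnj w ^ 2 = cnj w"
          by (simp add: power2_eq_square mult.assoc[symmetric])
        then show ?case
          unfolding elim(1) by (simp add: mult_ac)
      qed
    qed measurable
    finally show ?thesis
      by simp
  qed
  have "?c (n + 3) = 0" for n
  proof -
    have "(LINT w|circle_measure. Y w * (cnj w ^ 2 * w ^ (n + 3))) = (LINT w|circle_measure. Y w * w ^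
        Suc n)"
    proof (rule circle_integral_cong)
      fix w :: complex assume "cmod w = 1"
      then have "cnj w ^ 2 * w ^ 2 = 1"
        using circle_cnj[of w] by (simp add: power_mult_distrib[symmetric] mult.commute)
      then have "cnj w ^ 2 * w ^ (n + 3) = w ^ Suc n"
        by (simp add: power_add eval_nat_numeral mult_ac)
      then show "Y w * (cnj w ^ 2 * w ^ (n + 3)) = Y w * w ^ Suc n"
        by simp
    qed
    then show ?thesis
      using cnj_int[of "n + 3"] L2_boundary_taylor(2)[OF f Y, of n] by simp
  qed
  then have f_eq: "f z = ?c 0 + ?c 1 * z + ?c 2 * z\<^sup>2" if "z \<in> disc" for z
    using holomorphic_quadratic[OF f _ that] by blast
  have "(LINT w|circle_measure. Y w * (cnj w ^ 2 * w ^ 2)) = (LINT w|circle_measure. Y w * cnj w ^ 0)"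
    by (rule circle_integral_cong) (use circle_cnj in \<open>simp add: power_mult_distrib[symmetric]
        mult.commute\<close>)
  then have "of_real pi * cnj (?c 2) = of_real pi * (- ?c 0)"
    using cnj_int[of 2] L2_boundary_taylor(1)[OF f Y, of 0] by simp
  then have "cnj (?c 2) = - ?c 0"
    by (simp only: mult_cancel_left of_real_eq_0_iff pi_neq_zero simp_thms)
  then have c2: "?c 2 = - cnj (?c 0)"
    by (metis complex_cnj_cnj complex_cnj_minus)
  have "(LINT w|circle_measure. Y w * (cnj w ^ 2 * w ^ 1)) = (LINT w|circle_measure. Y w * cnj w ^ 1)"
    by (rule circle_integral_cong) (use circle_cnj in \<open>simp add: power2_eq_square mult_ac\<close>)
  then have "of_real pi * cnj (?c 1) = of_real pi * (- ?c 1)"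
    using cnj_int[of 1] L2_boundary_taylor(1)[OF f Y, of 1] by simp
  then have "cnj (?c 1) = - ?c 1"
    by (simp only: mult_cancel_left of_real_eq_0_iff pi_neq_zero simp_thms)
  then have "Re (?c 1) = 0"
    by (simp add: complex_eq_iff)
  then show ?thesis
    using killing_fieldsI[of f "?c 0" "?c 1"] f_eq c2 by simp
qed

text \<open>Solving the \<open>dbar\<close> equation explicitly, a field with \<open>dbar D = (1 - |z|^2)^2 * cnj g\<close> is the sum of a
  holomorphic function and \<open>cnj G0 - 2 z cnj G1 + z^2 cnj G2\<close> with \<open>Gj' = z^j g\<close>. Its Fourier
  coefficient of index \<open>-(n + 1)\<close> on the boundary is a nonzero multiple of the conjugate of the \<open>n\<close>-th
  Taylor coefficient of \<open>g\<close>.\<close>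

lemma zero_L2_boundary_imp_zero:
  assumes g: "g holomorphic_on disc"
    and dD: "\<And>z. z \<in> disc \<Longrightarrow> \<exists>a. has_wirtinger D a ((1 - z * cnj z) ^ 2 * cnj (g z)) (at z)"
    and D0: "has_L2_boundary D (\<lambda>_. 0)" and z: "z \<in> disc"
  shows "D z = 0"
proof -
  have "\<exists>G. \<forall>z\<in>disc. (G has_field_derivative h z) (at z)" if "h holomorphic_on disc" for h
    using holomorphic_convex_primitive'[OF convex_ball open_ball that] at_within_open[OF _ open_ball]
    by metis
  from this[OF g] this[OF holomorphic_on_mult[OF holomorphic_on_ident g]]
    this[OF holomorphic_on_mult[OF holomorphic_on_ident holomorphic_on_mult[OF holomorphic_on_ident g]]]
  obtain G0 G1 G2 where G: "\<And>z. z \<in> disc \<Longrightarrow> (G0 has_field_derivative g z) (at z)"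
    "\<And>z. z \<in> disc \<Longrightarrow> (G1 has_field_derivative z * g z) (at z)"
    "\<And>z. z \<in> disc \<Longrightarrow> (G2 has_field_derivative z * (z * g z)) (at z)"
    by blast
  have hG: "G0 holomorphic_on disc" "G1 holomorphic_on disc" "G2 holomorphic_on disc"
    unfolding holomorphic_on_open[OF open_ball] using G by blast+
  define c where "c = taylor_coeff g"
  have "(\<lambda>z. z * g z) holomorphic_on disc"
    by (intro holomorphic_intros g)
  then have coeff: "taylor_coeff G0 (Suc n) = c n / of_nat (Suc n)"
    "taylor_coeff G1 (Suc (Suc n)) = c n / of_nat (Suc (Suc n))"
    "taylor_coeff G2 (Suc (Suc (Suc n))) = c n / of_nat (Suc (Suc (Suc n)))" for n
    using taylor_coeff_deriv[of G0 g n, OF G(1)] taylor_coeff_deriv[of G1 _ "Suc n", OF G(2)]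
      taylor_coeff_deriv[of G2 _ "Suc (Suc n)", OF G(3)] taylor_coeff_times[OF g]
    by (simp_all add: c_def taylor_coeff_times del: of_nat_Suc)
  define P where "P z = cnj (G0 z) - 2 * z * cnj (G1 z) + z * z * cnj (G2 z)" for z
  define f where "f z = D z - P z" for z
  have "\<exists>a. (f has_field_derivative a) (at z)" if z: "z \<in> disc" for z
  proof -
    have id: "has_wirtinger (\<lambda>z. z) 1 0 (at z)" "has_wirtinger (\<lambda>z. 2 * z) 2 0 (at z)"
      by (auto intro!: derivative_eq_intros)
    note w = G(1)[OF z, THEN has_wirtinger_field, THEN has_wirtinger_cnj]
      G(2)[OF z, THEN has_wirtinger_field, THEN has_wirtinger_cnj]
      G(3)[OF z, THEN has_wirtinger_field, THEN has_wirtinger_cnj]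
    have "\<exists>a. has_wirtinger P a ((1 - z * cnj z) ^ 2 * cnj (g z)) (at z)"
      unfolding P_def
      by (rule exI, rule has_wirtinger_eqI[OF has_wirtinger_add[OF has_wirtinger_diff[OF w(1)
            has_wirtinger_mult[OF id(2) w(2)]] has_wirtinger_mult[OF has_wirtinger_mult[OF id(1) id(1)]
                w(3)]] refl])
        (simp add: algebra_simps power2_eq_square)
    then obtain a b where "has_wirtinger P a ((1 - z * cnj z) ^ 2 * cnj (g z)) (at z)"
      "has_wirtinger D b ((1 - z * cnj z) ^ 2 * cnj (g z)) (at z)"
      using dD[OF z] by blast
    from has_wirtinger_diff[OF this(2,1)] show ?thesis
      by (auto simp: f_def[abs_def] has_field_derivative_def)
  qed
  then have f: "f holomorphic_on disc"
    unfolding holomorphic_on_open[OF open_ball] by blast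
  have mode: "(LINT w|circle_measure. D (of_real r * w) * w ^ Suc n) =
      2 * of_real pi * (of_real r ^ Suc n * cnj (c n / of_nat (Suc n))
        - 2 * of_real r * (of_real r ^ Suc (Suc n) * cnj (c n / of_nat (Suc (Suc n))))
        + of_real r ^ 2 * (of_real r ^ Suc (Suc (Suc n)) * cnj (c n / of_nat (Suc (Suc (Suc n))))))"
    if r: "0 < r" "r < 1" for r n
  proof -
    note cont = holomorphic_continuous_on_dilation[OF f r] hG[THEN
        holomorphic_continuous_on_dilation[OF _ r]]
    have i: "integrable circle_measure (\<lambda>w. f (of_real r * w) * w ^ Suc n)"
      "integrable circle_measure (\<lambda>w. cnj (G0 (of_real r * w)) * w ^ Suc n)"
      "integrable circle_measure (\<lambda>w. cnj (G1 (of_real r * w)) * w ^ Suc (Suc n))"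
      "integrable circle_measure (\<lambda>w. cnj (G2 (of_real r * w)) * w ^ Suc (Suc (Suc n)))"
      by (intro integrable_circle continuous_intros cont)+
    have "(LINT w|circle_measure. D (of_real r * w) * w ^ Suc n) =
        (LINT w|circle_measure. f (of_real r * w) * w ^ Suc n + (cnj (G0 (of_real r * w)) * w ^ Suc n
          - 2 * of_real r * (cnj (G1 (of_real r * w)) * w ^ Suc (Suc n))
          + of_real r ^ 2 * (cnj (G2 (of_real r * w)) * w ^ Suc (Suc (Suc n)))))"
      by (rule circle_integral_cong) (simp add: f_def P_def algebra_simps power2_eq_square)
    also have "\<dots> = (LINT w|circle_measure. f (of_real r * w) * w ^ Suc n)
        + ((LINT w|circle_measure. cnj (G0 (of_real r * w)) * w ^ Suc n)
          - 2 * of_real r * (LINT w|circle_measure. cnj (G1 (of_real r * w)) * w ^ Suc (Suc n))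
          + of_real r ^ 2 * (LINT w|circle_measure. cnj (G2 (of_real r * w)) * w ^ Suc (Suc (Suc n))))"
      by (simp only: Bochner_Integration.integral_add Bochner_Integration.integral_diff
          integral_mult_right_zero integrable_mult_right Bochner_Integration.integrable_add
          Bochner_Integration.integrable_diff i)
    finally show ?thesis
      unfolding circle_taylor(2)[OF f r] circle_taylor_cnj(1)[OF hG(1) r] circle_taylor_cnj(1)[OF hG(2) r]
        circle_taylor_cnj(1)[OF hG(3) r] coeff by (simp only: algebra_simps) simp
  qed
  have "c n = 0" for n
  proof -
    let ?F = "\<lambda>r::real. 2 * of_real pi * (of_real r ^ Suc n * cnj (c n / of_nat (Suc n))
        - 2 * of_real r * (of_real r ^ Suc (Suc n) * cnj (c n / of_nat (Suc (Suc n))))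
        + of_real r ^ 2 * (of_real r ^ Suc (Suc (Suc n)) * cnj (c n / of_nat (Suc (Suc (Suc n))))))"
    \<comment> \<open>The modes of \<open>D\<close> tend to those of its boundary value 0, whereas
      the explicit formula \<open>?F\<close> is continuous up to radius 1.\<close>
    have "(LINT w|circle_measure. 0 * w ^ Suc n) = ?F (1 - 0)"
    proof (rule at_right_0_limit_unique)
      show "((\<lambda>\<epsilon>. LINT w|circle_measure. D (of_real (1 - \<epsilon>) * w) * w ^ Suc n) \<longlongrightarrow>
          (LINT w|circle_measure. 0 * w ^ Suc n)) (at_right 0)"
        by (intro has_L2_boundary_weak_limit[OF D0] continuous_intros) (simp add: norm_power norm_mult)
      show "((\<lambda>\<epsilon>. ?F (1 - \<epsilon>)) \<longlongrightarrow> ?F (1 - 0)) (at_right 0)"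
        by (intro tendsto_intros)
    qed (rule mode; simp)
    then have "?F 1 = 0"
      by simp
    moreover have "?F 1 = 2 * of_real pi * (cnj (c n) * (2 / (of_nat (Suc n) * of_nat (Suc (Suc n)) *
        of_nat (Suc (Suc (Suc n))))))"
    proof -
      \<comment> \<open>The second difference of 1 / N. That it is nonzero at N = n + 1 is why the
        coefficient \<open>c n\<close> can be recovered from the boundary.\<close>
      have "x / N - 2 * (x / (N + 1)) + x / (N + 2) = x * (2 / (N * (N + 1) * (N + 2)))"
        if "N \<noteq> 0" "N + 1 \<noteq> 0" "N + 2 \<noteq> 0" for N x :: complex
        using that by (simp add: divide_simps) (simp add: algebra_simps)
      moreover have N: "of_nat (Suc n) + 1 = complex_of_nat (Suc (Suc n))" "of_nat (Suc n) + 2 =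
          complex_of_nat (Suc (Suc (Suc n)))"
        by simp_all
      ultimately have key: "cnj (c n) / of_nat (Suc n) - 2 * (cnj (c n) / of_nat (Suc (Suc n))) + cnj
          (c n) / of_nat (Suc (Suc (Suc n))) =
          cnj (c n) * (2 / (of_nat (Suc n) * of_nat (Suc (Suc n)) * of_nat (Suc (Suc (Suc n)))))"
        by (metis of_nat_neq_0)
      show ?thesis
        unfolding key[symmetric] by (simp del: of_nat_Suc)
    qed
    ultimately show ?thesis
      by (simp del: of_nat_Suc)
  qed
  then have "g z = 0" if "z \<in> disc" for z
    using holomorphic_quadratic[OF g _ that] by (simp add: c_def)
  then have D: "D holomorphic_on disc"
    unfolding holomorphic_on_open[OF open_ball] using dD by (auto simp: has_field_derivative_def)
  have "taylor_coeff D n = 0" for n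
    using L2_boundary_taylor(1)[OF D D0, of n] by simp
  then show ?thesis
    using holomorphic_quadratic[OF D _ z] by simp
qed

section \<open>Isometries of the disc and cocompact groups\<close>

text \<open>The automorphy factor: the derivative of \<open>mob p\<close> is 1 / mob_den^2, so
  pulling back a vector field multiplies it by mob_den^2, and the height is divided by
  |mob_den|^2.\<close>

definition mob_den :: "complex \<times> complex \<Rightarrow> complex \<Rightarrow> complex"
  where "mob_den p z = cnj (snd p) * z + cnj (fst p)"

text \<open>In contrast to \<open>mobius\<close> it is not cut off outside the open disc, so it also
  acts on the circle.\<close>

definition mob :: "complex \<times> complex \<Rightarrow> complex \<Rightarrow> complex"
  where "mob p z = (fst p * z + snd p) / mob_den p z"

lemma mobius_eq_mob: "z \<in> disc \<Longrightarrow> mobius p z = mob p z"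
  by (simp add: mobius_def mob_def mob_den_def case_prod_beta)

lemma SU11_eq: "p \<in> SU11 \<Longrightarrow> fst p * cnj (fst p) - snd p * cnj (snd p) = 1"
  using SU11_iff[of "fst p" "snd p"] by simp

lemma SU11_norm: "p \<in> SU11 \<Longrightarrow> cmod (snd p) < cmod (fst p)"
proof -
  assume "p \<in> SU11"
  then have "(cmod (fst p))\<^sup>2 - (cmod (snd p))\<^sup>2 = 1"
    by (auto simp: SU11_def)
  then have "(cmod (snd p))\<^sup>2 < (cmod (fst p))\<^sup>2"
    by linarith
  then show ?thesis
    by (rule power2_less_imp_less) simp
qed

text \<open>The first bound grows with \<open>fst p\<close> but degenerates at the circle. The
  second is uniform on the closed disc for a fixed \<open>p\<close>.\<close>

lemma norm_mob_den_ge: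
  assumes "p \<in> SU11" "cmod z \<le> 1"
  shows "cmod (fst p) * (1 - cmod z) \<le> cmod (mob_den p z)" "cmod (fst p) - cmod (snd p) \<le> cmod (mob_den
      p z)"
proof -
  have "cmod (fst p) - cmod (snd p) * cmod z \<le> cmod (mob_den p z)"
    using norm_triangle_ineq2[of "cnj (fst p)" "- (cnj (snd p) * z)"]
    by (simp add: mob_den_def norm_mult add.commute)
  moreover have "cmod (snd p) * cmod z \<le> cmod (fst p) * cmod z" "cmod (snd p) * cmod z \<le> cmod (snd p) * 1"
    using SU11_norm[OF assms(1)] assms(2) by (intro mult_right_mono mult_left_mono; simp)+
  ultimately show "cmod (fst p) * (1 - cmod z) \<le> cmod (mob_den p z)" "cmod (fst p) - cmod (snd p) \<le>
      cmod (mob_den p z)"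
    by (simp_all add: algebra_simps)
qed

lemma mob_den_nonzero: "p \<in> SU11 \<Longrightarrow> cmod z \<le> 1 \<Longrightarrow> mob_den p z \<noteq> 0"
  using norm_mob_den_ge(2)[of p z] SU11_norm[of p] by auto

lemma one_minus_mob:
  assumes "p \<in> SU11" "cmod z \<le> 1"
  shows "1 - mob p z * cnj (mob p z) = (1 - z * cnj z) / (mob_den p z * cnj (mob_den p z))"
proof -
  have "mob_den p z * cnj (mob_den p z) - (fst p * z + snd p) * cnj (fst p * z + snd p) =
      (fst p * cnj (fst p) - snd p * cnj (snd p)) * (1 - z * cnj z)"
    by (simp add: mob_den_def algebra_simps)
  moreover have "1 - n / d * cnj (n / d) = e / (d * cnj d)" if "d \<noteq> 0" "d * cnj d - n * cnj n = e" for n d e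
    using that(1) unfolding that(2)[symmetric] by (simp add: diff_divide_distrib)
  ultimately show ?thesis
    unfolding mob_def using mob_den_nonzero[OF assms] by (simp only: SU11_eq[OF assms(1)] mult_1_left)
qed

lemma height_mob:
  assumes "p \<in> SU11" "cmod z \<le> 1"
  shows "height (mob p z) = height z / (cmod (mob_den p z))\<^sup>2"
proof -
  have "complex_of_real (height (mob p z)) = of_real (height z / (cmod (mob_den p z))\<^sup>2)"
    unfolding of_real_height of_real_divide complex_norm_square by (rule one_minus_mob[OF assms])
  then show ?thesis
    by (simp only: of_real_eq_iff)
qed

lemma height_pos_iff: "height z > 0 \<longleftrightarrow> z \<in> disc"
  by (simp add: abs_square_less_1)

lemma mob_disc:
  assumes "p \<in> SU11" "z \<in> disc"
  shows "mob p z \<in> disc"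
proof -
  have z: "cmod z \<le> 1"
    using assms(2) by simp
  have "height z / (cmod (mob_den p z))\<^sup>2 > 0"
    using height_pos[OF assms(2)] mob_den_nonzero[OF assms(1) z] by (intro divide_pos_pos) auto
  then show ?thesis
    by (simp only: height_mob[OF assms(1) z, symmetric] height_pos_iff)
qed

lemma mob_sphere:
  assumes "p \<in> SU11" "cmod w = 1"
  shows "cmod (mob p w) = 1"
proof -
  have "height (mob p w) = 0"
    using assms by (simp add: height_mob)
  then show ?thesis
    by (simp add: power2_eq_1_iff) (use norm_ge_zero[of "mob p w"] in linarith)
qed

lemma mob_cball: "p \<in> SU11 \<Longrightarrow> cmod z \<le> 1 \<Longrightarrow> cmod (mob p z) \<le> 1"
  using mob_disc[of p z] mob_sphere[of p z] by (cases "cmod z = 1") auto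

lemma mob_diff:
  assumes "p \<in> SU11" "cmod z \<le> 1" "cmod w \<le> 1"
  shows "mob p w - mob p z = (w - z) / (mob_den p w * mob_den p z)"
proof -
  have "(fst p * w + snd p) * mob_den p z - (fst p * z + snd p) * mob_den p w =
      (fst p * cnj (fst p) - snd p * cnj (snd p)) * (w - z)"
    by (simp add: mob_den_def algebra_simps)
  then show ?thesis
    using mob_den_nonzero[OF assms(1)] assms SU11_eq[OF assms(1)] by (simp add: mob_def field_simps)
qed

lemma mob_has_derivative:
  assumes "p \<in> SU11" "cmod z \<le> 1"
  shows "(mob p has_field_derivative 1 / (mob_den p z)\<^sup>2) (at z)"
proof -
  have "mob_den p z \<noteq> 0"
    by (rule mob_den_nonzero[OF assms])
  then have "((\<lambda>z. (fst p * z + snd p) / (cnj (snd p) * z + cnj (fst p))) has_field_derivative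
      (fst p * mob_den p z - (fst p * z + snd p) * cnj (snd p)) / (mob_den p z * mob_den p z)) (at z)"
    unfolding mob_den_def by (auto intro!: derivative_eq_intros)
  moreover have "fst p * mob_den p z - (fst p * z + snd p) * cnj (snd p) = 1"
    unfolding SU11_eq[OF assms(1), symmetric] by (simp add: mob_den_def algebra_simps)
  ultimately show ?thesis
    by (simp add: mob_def[abs_def] mob_den_def power2_eq_square)
qed

lemma mobius_has_derivative:
  assumes "p \<in> SU11" "z \<in> disc"
  shows "(mobius p has_field_derivative 1 / (mob_den p z)\<^sup>2) (at z)" "deriv (mobius p) z = 1 / (mob_den
      p z)\<^sup>2"
proof -
  have "(mob p has_field_derivative 1 / (mob_den p z)\<^sup>2) (at z)"
    using assms by (intro mob_has_derivative) auto
  then show "(mobius p has_field_derivative 1 / (mob_den p z)\<^sup>2) (at z)"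
    by (rule has_field_derivative_transform_within_open[OF _ open_ball assms(2)]) (simp add: mobius_eq_mob)
  then show "deriv (mobius p) z = 1 / (mob_den p z)\<^sup>2"
    by (rule DERIV_imp_deriv)
qed

lemma continuous_on_mob: "p \<in> SU11 \<Longrightarrow> continuous_on (cball 0 1) (mob p)"
  and continuous_on_mob_den: "continuous_on S (mob_den p)"
proof -
  show "continuous_on S (mob_den p)" for S
    unfolding mob_den_def by (intro continuous_intros)
  then show "p \<in> SU11 \<Longrightarrow> continuous_on (cball 0 1) (mob p)"
    unfolding mob_def using mob_den_nonzero by (intro continuous_intros) auto
qed

text \<open>Distances to \<open>z\<close> comparable to the distance of \<open>z\<close> to the circle are hyperbolically bounded, so
  the derivatives at the two points are comparable uniformly in the isometry.\<close>

lemma mob_den_growth: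
  assumes p: "p \<in> SU11" and z: "z \<in> disc" and w: "cmod (w - z) \<le> M * (1 - cmod z)" and M: "M \<ge> 0"
  shows "cmod (mob_den p w) \<le> (1 + M) * cmod (mob_den p z)"
proof -
  have "mob_den p w = mob_den p z + cnj (snd p) * (w - z)"
    by (simp add: mob_den_def algebra_simps)
  then have "cmod (mob_den p w) \<le> cmod (mob_den p z) + cmod (snd p) * cmod (w - z)"
    using norm_triangle_ineq[of "mob_den p z" "cnj (snd p) * (w - z)"] by (simp add: norm_mult)
  also have "cmod (snd p) * cmod (w - z) \<le> cmod (fst p) * (M * (1 - cmod z))"
    using SU11_norm[OF p] w by (intro mult_mono) auto
  also have "\<dots> = M * (cmod (fst p) * (1 - cmod z))"
    by simp
  also have "\<dots> \<le> M * cmod (mob_den p z)"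
    using norm_mob_den_ge(1)[OF p, of z] z M by (intro mult_left_mono) auto
  finally show ?thesis
    by (simp add: algebra_simps)
qed

lemma height_bounds:
  assumes "cmod z \<le> 1"
  shows "1 - cmod z \<le> height z" "height z \<le> 2 * (1 - cmod z)"
proof -
  have h: "height z = (1 - cmod z) * (1 + cmod z)"
    by (simp add: power2_eq_square algebra_simps)
  have "(1 - cmod z) * 1 \<le> (1 - cmod z) * (1 + cmod z)" "(1 - cmod z) * (1 + cmod z) \<le> (1 - cmod z) * 2"
    using assms by (intro mult_left_mono; simp)+
  then show "1 - cmod z \<le> height z" "height z \<le> 2 * (1 - cmod z)"
    unfolding h by simp_all
qed

lemma inv_mobius:
  assumes "p \<in> SU11"
  shows "inv\<^bsub>PSU11\<^esub> (mobius p) = mobius (cnj (fst p), - snd p)" "(cnj (fst p), - snd p) \<in> SU11"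
proof -
  obtain a b where p: "p = (a, b)"
    by (cases p)
  have ab: "(a, b) \<in> SU11"
    using assms p by simp
  show mem: "(cnj (fst p), - snd p) \<in> SU11"
    using assms by (auto simp: SU11_def)
  have "cnj a * a + - b * cnj b = 1" "cnj a * b + - b * cnj a = 0"
    using ab by (simp_all add: SU11_iff mult.commute)
  then have "compose disc (mobius (cnj a, - b)) (mobius (a, b)) = mobius (1, 0)"
    using mobius_compose(1)[of "cnj a" "- b" a b] mem ab p by simp
  also have "mobius (1, 0) = (\<lambda>z\<in>disc. z)"
    by (simp add: mobius_def)
  finally have "mobius (cnj (fst p), - snd p) \<otimes>\<^bsub>PSU11\<^esub> mobius p = \<one>\<^bsub>PSU11\<^esub>"
    by (simp add: PSU11_def p)
  then show "inv\<^bsub>PSU11\<^esub> (mobius p) = mobius (cnj (fst p), - snd p)"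
    using mem assms by (intro group.inv_equality[OF group_PSU11]) (auto simp: PSU11_def)
qed

lemma PSU11_mult_apply: "z \<in> disc \<Longrightarrow> (g \<otimes>\<^bsub>PSU11\<^esub> h) z = g (h z)"
  by (simp add: PSU11_def compose_eq)

section \<open>Consequences of discreteness and cocompactness\<close>

lemma openin_PSU11_topology:
  "openin PSU11_topology U \<longleftrightarrow> U \<subseteq> mobius ` SU11 \<and> openin (top_of_set SU11) {p \<in> SU11. mobius p \<in> U}"
  by (simp add: PSU11_topology_def openin_quotient_topology)

lemma topspace_quotient_topology: "topspace (quotient_topology X p) = p ` topspace X"
proof
  show "topspace (quotient_topology X p) \<subseteq> p ` topspace X"
    unfolding topspace_def[of "quotient_topology X p"] by (auto simp: openin_quotient_topology)
  have "{x \<in> topspace X. p x \<in> p ` topspace X} = topspace X"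
    by auto
  then have "openin (quotient_topology X p) (p ` topspace X)"
    by (simp add: openin_quotient_topology)
  then show "p ` topspace X \<subseteq> topspace (quotient_topology X p)"
    by (rule openin_subset)
qed

locale PSU11_subgroup =
  fixes \<Gamma> :: "(complex \<Rightarrow> complex) set"
  assumes subgroup: "subgroup \<Gamma> PSU11"
begin

lemma lift: "\<gamma> \<in> \<Gamma> \<Longrightarrow> \<exists>p\<in>SU11. \<gamma> = mobius p"
  using subgroup.subset[OF subgroup] by (auto simp: PSU11_def)

lemma maps_disc: "\<gamma> \<in> \<Gamma> \<Longrightarrow> z \<in> disc \<Longrightarrow> \<gamma> z \<in> disc"
  using lift mobius_eq_mob mob_disc by metis

lemma mult_closed: "\<gamma> \<in> \<Gamma> \<Longrightarrow> \<eta> \<in> \<Gamma> \<Longrightarrow> \<gamma> \<otimes>\<^bsub>PSU11\<^esub> \<eta> \<in> \<Gamma>"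
  and inv_closed: "\<gamma> \<in> \<Gamma> \<Longrightarrow> inv\<^bsub>PSU11\<^esub> \<gamma> \<in> \<Gamma>"
  and one_closed: "\<one>\<^bsub>PSU11\<^esub> \<in> \<Gamma>"
  using subgroup by (auto intro: subgroup.m_closed subgroup.m_inv_closed subgroup.one_closed)

lemma mult_inv_cancel:
  assumes "\<gamma> \<in> \<Gamma>" "\<eta> \<in> \<Gamma>"
  shows "\<gamma> \<otimes>\<^bsub>PSU11\<^esub> inv\<^bsub>PSU11\<^esub> \<eta> \<otimes>\<^bsub>PSU11\<^esub> \<eta> = \<gamma>"
  using assms group.inv_solve_right'[OF group_PSU11] subgroup.mem_carrier[OF subgroup]
  by (metis group.inv_closed group.l_inv group.is_monoid group_PSU11 monoid.m_assoc monoid.r_one)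

lemma mult_inv_apply:
  assumes "\<gamma> \<in> \<Gamma>" "\<eta> \<in> \<Gamma>" "z \<in> disc"
  shows "(\<gamma> \<otimes>\<^bsub>PSU11\<^esub> inv\<^bsub>PSU11\<^esub> \<eta>) (\<eta> z) = \<gamma> z"
proof -
  have "(\<gamma> \<otimes>\<^bsub>PSU11\<^esub> inv\<^bsub>PSU11\<^esub> \<eta>) (\<eta> z) = (\<gamma> \<otimes>\<^bsub>PSU11\<^esub> inv\<^bsub>PSU11\<^esub> \<eta> \<otimes>\<^bsub>PSU11\<^esub> \<eta>) z"
    using PSU11_mult_apply[OF assms(3)] by simp
  then show ?thesis
    by (simp add: mult_inv_cancel[OF assms(1,2)])
qed

text \<open>Openness in the quotient topology is openness of the preimage among matrices, so the
  isolation of the identity can be measured by a distance in \<open>SU11\<close>.\<close>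

lemma discrete_isolated_one:
  assumes "discrete_in_PSU11 \<Gamma>"
  obtains e where "e > 0" "\<And>p. p \<in> SU11 \<Longrightarrow> dist p (1, 0) < e \<Longrightarrow> mobius p \<in> \<Gamma> \<Longrightarrow> mobius p = \<one>\<^bsub>PSU11\<^esub>"
proof -
  have one: "mobius (1, 0) = \<one>\<^bsub>PSU11\<^esub>" "(1, 0) \<in> SU11"
    by (simp_all add: mobius_def PSU11_def SU11_def)
  have "openin (subtopology PSU11_topology \<Gamma>) {\<one>\<^bsub>PSU11\<^esub>}"
    using assms one_closed by (simp add: discrete_in_PSU11_def)
  then obtain U where U: "openin PSU11_topology U" "{\<one>\<^bsub>PSU11\<^esub>} = U \<inter> \<Gamma>"
    by (auto simp: openin_subtopology)
  then obtain T where T: "open T" "{p \<in> SU11. mobius p \<in> U} = SU11 \<inter> T"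
    by (auto simp: openin_PSU11_topology openin_open)
  have "(1, 0) \<in> T"
    using T(2) U(2) one by blast
  then obtain e where e: "e > 0" "ball (1, 0) e \<subseteq> T"
    using T(1) open_contains_ball by blast
  have "mobius p = \<one>\<^bsub>PSU11\<^esub>" if "p \<in> SU11" "dist p (1, 0) < e" "mobius p \<in> \<Gamma>" for p
  proof -
    have "p \<in> T"
      using e(2) that(2) by (auto simp: dist_commute)
    then have "mobius p \<in> U"
      using T(2) that(1) by blast
    then show ?thesis
      using U(2) that(3) by blast
  qed
  with e(1) that show thesis
    by blast
qed

text \<open>A bound on the first entry confines the matrix to a compact set. Infinitely many
  elements would have lifts accumulating there, and two distinct lifts close to the same limit have
  a quotient so near the identity that discreteness makes it trivial.\<close>

lemma finite_bounded:
  assumes discrete: "discrete_in_PSU11 \<Gamma>"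
  shows "finite {\<gamma> \<in> \<Gamma>. \<exists>p\<in>SU11. \<gamma> = mobius p \<and> cmod (fst p) \<le> R}" (is "finite ?S")
proof (rule ccontr)
  assume inf: "infinite ?S"
  obtain e where e: "e > 0" "\<And>p. p \<in> SU11 \<Longrightarrow> dist p (1, 0) < e \<Longrightarrow> mobius p \<in> \<Gamma> \<Longrightarrow> mobius p = \<one>\<^bsub>PSU11\<^esub>"
    using discrete_isolated_one[OF discrete] by blast
  have "\<forall>\<gamma>\<in>?S. \<exists>p. p \<in> SU11 \<and> mobius p = \<gamma> \<and> cmod (fst p) \<le> R"
    by blast
  \<comment> \<open>Each element has the two lifts p and - p; choosing one makes \<open>f\<close>
    injective, so distinct lifts belong to distinct group elements.\<close>
  from bchoice[OF this] obtain f where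
    f: "\<forall>\<gamma>\<in>?S. f \<gamma> \<in> SU11 \<and> mobius (f \<gamma>) = \<gamma> \<and> cmod (fst (f \<gamma>)) \<le> R"
    by blast
  define K where "K = {p \<in> SU11. cmod (fst p) \<le> R}"
  have "closed K"
  proof -
    have "K = {p. (cmod (fst p))\<^sup>2 - (cmod (snd p))\<^sup>2 = 1} \<inter> {p. cmod (fst p) \<le> R}"
      by (auto simp: K_def SU11_def)
    then show ?thesis
      by (simp only:) (intro closed_Int closed_Collect_eq closed_Collect_le continuous_intros)
  qed
  moreover have "bounded K"
  proof -
    have "K \<subseteq> cball 0 R \<times> cball 0 R"
      using SU11_norm by (force simp: K_def)
    then show ?thesis
      by (rule bounded_subset[rotated]) (intro bounded_Times bounded_cball)
  qed
  ultimately have "compact K"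
    by (simp add: compact_eq_bounded_closed)
  have "inj_on f ?S"
    using f by (intro inj_on_inverseI[where g = mobius]) blast
  then have "infinite (f ` ?S)"
    using inf finite_imageD by blast
  moreover have "f ` ?S \<subseteq> K"
    using f unfolding K_def by blast
  ultimately obtain x where x: "x \<in> K" "x islimpt (f ` ?S)"
    using \<open>compact K\<close> unfolding compact_eq_Bolzano_Weierstrass by blast
  \<comment> \<open>The matrix of the inverse of the first argument times the second; it is
    continuous, with value \<open>(1, 0)\<close> on the diagonal of \<open>SU11\<close>.\<close>
  define q where "q p = (cnj (fst (fst p)) * fst (snd p) - snd (fst p) * cnj (snd (snd p)),
    cnj (fst (fst p)) * snd (snd p) - snd (fst p) * cnj (fst (snd p)))" for p :: "(complex \<times> complex) \<times>
        complex \<times> complex"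
  have "isCont q (x, x)"
    unfolding q_def by (intro continuous_intros)
  moreover have "q (x, x) = (1, 0)"
    using SU11_eq[of x] x(1) by (simp add: q_def K_def mult.commute)
  ultimately obtain d where d: "d > 0" "\<And>p. dist p (x, x) < d \<Longrightarrow> dist (q p) (1, 0) < e"
    unfolding continuous_at_eps_delta using e(1) by metis
  define A where "A = f ` ?S \<inter> ball x (d / 2)"
  have A: "infinite A"
    unfolding A_def using x(2) d(1) by (simp add: islimpt_eq_infinite_ball)
  obtain p1 where p1: "p1 \<in> A"
    using infinite_imp_nonempty[OF A] by blast
  have "infinite (A - {p1})"
    using A by simp
  from infinite_imp_nonempty[OF this] obtain p2 where p2: "p2 \<in> A" "p1 \<noteq> p2"
    by blast
  have "p1 \<in> f ` ?S" "p2 \<in> f ` ?S" and near: "dist x p1 < d / 2" "dist x p2 < d / 2"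
    using p1 p2(1) by (simp_all only: A_def Int_iff mem_ball)
  then obtain \<gamma>1 \<gamma>2 where \<gamma>: "\<gamma>1 \<in> ?S" "\<gamma>2 \<in> ?S" "p1 = f \<gamma>1" "p2 = f \<gamma>2"
    by (elim imageE)
  have "dist (p1, p2) (x, x) \<le> dist p1 x + dist p2 x"
    unfolding dist_Pair_Pair by (rule sqrt_sum_squares_le_sum) auto
  also have "\<dots> < d"
    using near by (simp add: dist_commute)
  finally have near: "dist (q (p1, p2)) (1, 0) < e"
    by (rule d(2))
  have p12: "p1 \<in> SU11" "p2 \<in> SU11" "\<gamma>1 = mobius p1" "\<gamma>2 = mobius p2"
    using bspec[OF f \<gamma>(1)] bspec[OF f \<gamma>(2)] \<gamma>(3,4) by simp_all
  have "(fst p2, snd p2) \<in> SU11" "(cnj (fst p1), - snd p1) \<in> SU11"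
    using p12 inv_mobius(2)[of p1] by simp_all
  note comp = mobius_compose[OF this(2,1)]
  have "inv\<^bsub>PSU11\<^esub> \<gamma>1 \<otimes>\<^bsub>PSU11\<^esub> \<gamma>2 = mobius (q (p1, p2))" "q (p1, p2) \<in> SU11"
    using comp p12 inv_mobius(1)[of p1] by (simp_all add: PSU11_def q_def)
  moreover have "inv\<^bsub>PSU11\<^esub> \<gamma>1 \<otimes>\<^bsub>PSU11\<^esub> \<gamma>2 \<in> \<Gamma>"
    using \<gamma> by (auto intro: mult_closed inv_closed)
  ultimately have "inv\<^bsub>PSU11\<^esub> \<gamma>1 \<otimes>\<^bsub>PSU11\<^esub> \<gamma>2 = \<one>\<^bsub>PSU11\<^esub>"
    using e(2) near by metis
  moreover have "\<gamma>1 \<in> carrier PSU11" "\<gamma>2 \<in> carrier PSU11"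
    using \<gamma> subgroup.mem_carrier[OF subgroup] by auto
  ultimately have "\<gamma>1 = \<gamma>2"
    by (metis group.inv_equality group.inv_inv group.inv_closed group_PSU11)
  then show False
    using p2(2) \<gamma>(3,4) by simp
qed

text \<open>This is proper discontinuity for the compact set where the height is at least
  \<open>c\<close>: height at both ends bounds \<open>mob_den\<close> from above, and with it the
  first matrix entry.\<close>

lemma finite_return:
  assumes discrete: "discrete_in_PSU11 \<Gamma>" and c: "c > 0"
  shows "finite {\<sigma> \<in> \<Gamma>. \<exists>z\<in>disc. height z \<ge> c \<and> height (\<sigma> z) \<ge> c}"
proof (rule finite_subset[OF _ finite_bounded[OF discrete]])
  show "{\<sigma> \<in> \<Gamma>. \<exists>z\<in>disc. height z \<ge> c \<and> height (\<sigma> z) \<ge> c} \<subseteq>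
      {\<gamma> \<in> \<Gamma>. \<exists>p\<in>SU11. \<gamma> = mobius p \<and> cmod (fst p) \<le> 2 / c * (1 / sqrt c)}"
  proof (intro subsetI CollectI conjI)
    fix \<sigma> assume "\<sigma> \<in> {\<sigma> \<in> \<Gamma>. \<exists>z\<in>disc. height z \<ge> c \<and> height (\<sigma> z) \<ge> c}"
    then obtain z where \<sigma>: "\<sigma> \<in> \<Gamma>" and z: "z \<in> disc" "height z \<ge> c" "height (\<sigma> z) \<ge> c"
      by blast
    show "\<sigma> \<in> \<Gamma>"
      by fact
    obtain p where p: "p \<in> SU11" "\<sigma> = mobius p"
      using lift[OF \<sigma>] by blast
    have den: "cmod (mob_den p z) > 0"
      using mob_den_nonzero[OF p(1), of z] z(1) by simp
    have "c \<le> height z / (cmod (mob_den p z))\<^sup>2"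
      using z p by (simp add: mobius_eq_mob height_mob)
    also have "\<dots> \<le> 1 / (cmod (mob_den p z))\<^sup>2"
      by (intro divide_right_mono) auto
    finally have "(cmod (mob_den p z))\<^sup>2 \<le> 1 / c"
      using den c by (simp add: field_simps)
    then have "cmod (mob_den p z) \<le> 1 / sqrt c"
      using real_le_rsqrt by (metis real_sqrt_divide real_sqrt_one)
    moreover have "cmod (fst p) * (c / 2) \<le> cmod (fst p) * (1 - cmod z)"
      using height_bounds(2)[of z] z by (intro mult_left_mono) auto
    moreover have "cmod (fst p) * (1 - cmod z) \<le> cmod (mob_den p z)"
      using z by (intro norm_mob_den_ge(1)[OF p(1)]) auto
    ultimately have "cmod (fst p) * (c / 2) \<le> 1 / sqrt c"
      by linarith
    then have "cmod (fst p) \<le> 2 / c * (1 / sqrt c)"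
      using c by (simp add: field_simps)
    with p show "\<exists>p\<in>SU11. \<sigma> = mobius p \<and> cmod (fst p) \<le> 2 / c * (1 / sqrt c)"
      by blast
  qed
qed

text \<open>The sets \<open>V n\<close> are open, invariant under \<Gamma> from the left and
  increasing in \<open>n\<close>, and they exhaust the group because heights are positive.
  Compactness of the coset space selects a single \<open>n\<close>; transitivity on the disc turns
  this into a statement about points.\<close>

lemma cocompact_height:
  assumes cocompact: "cocompact_in_PSU11 \<Gamma>"
  obtains c where "c > 0" "\<And>z. z \<in> disc \<Longrightarrow> \<exists>\<gamma>\<in>\<Gamma>. height (\<gamma> z) \<ge> c"
proof -
  let ?p = "\<lambda>g. \<Gamma> #>\<^bsub>PSU11\<^esub> g"
  let ?Q = "quotient_topology PSU11_topology ?p"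
  define V where "V n = {g \<in> carrier PSU11. \<exists>\<gamma>\<in>\<Gamma>. height (\<gamma> (g 0)) > 1 / real (Suc n)}" for n
  have top: "topspace PSU11_topology = carrier PSU11"
    by (simp add: PSU11_topology_def topspace_quotient_topology PSU11_def)
  have at0: "mobius p 0 = snd p / cnj (fst p)" for p
    by (simp add: mobius_eq_mob mob_def mob_den_def)
  have g0: "g 0 \<in> disc" if g: "g \<in> carrier PSU11" for g
    using g mob_disc[of _ 0] mobius_eq_mob[of 0] by (auto simp: PSU11_def)
  have saturated: "g \<in> V n" if g: "g \<in> carrier PSU11" and gV: "?p g \<in> ?p ` V n" for g n
  proof -
    obtain g' where g': "g' \<in> V n" "?p g = ?p g'"
      using gV by blast
    have "\<one>\<^bsub>PSU11\<^esub> \<otimes>\<^bsub>PSU11\<^esub> g = g"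
      by (rule monoid.l_one[OF group.is_monoid[OF group_PSU11] g])
    then have "g \<in> ?p g"
      using one_closed unfolding r_coset_def by force
    then obtain \<eta> where \<eta>: "\<eta> \<in> \<Gamma>" "g = \<eta> \<otimes>\<^bsub>PSU11\<^esub> g'"
      unfolding g'(2) by (auto simp: r_coset_def)
    obtain \<gamma> where \<gamma>: "\<gamma> \<in> \<Gamma>" "height (\<gamma> (g' 0)) > 1 / real (Suc n)" and g'c: "g' \<in> carrier PSU11"
      using g'(1) by (auto simp: V_def)
    have "g 0 = \<eta> (g' 0)"
      using \<eta>(2) by (simp add: PSU11_mult_apply)
    then have "(\<gamma> \<otimes>\<^bsub>PSU11\<^esub> inv\<^bsub>PSU11\<^esub> \<eta>) (g 0) = \<gamma> (g' 0)"
      using mult_inv_apply[OF \<gamma>(1) \<eta>(1) g0[OF g'c]] by simp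
    then show ?thesis
      using \<gamma> \<eta> g mult_closed inv_closed unfolding V_def by (metis (mono_tags, lifting) mem_Collect_eq)
  qed
  have open_V: "openin PSU11_topology (V n)" for n
    unfolding openin_PSU11_topology
  proof
    show "V n \<subseteq> mobius ` SU11"
      by (auto simp: V_def PSU11_def)
    have "openin (top_of_set SU11) (SU11 \<inter> (\<lambda>p. height (\<gamma> (mobius p 0))) -` {1 / real (Suc n)<..})"
      if \<gamma>: "\<gamma> \<in> \<Gamma>" for \<gamma>
    proof (rule continuous_openin_preimage_gen)
      obtain q where q: "q \<in> SU11" "\<gamma> = mobius q"
        using lift[OF \<gamma>] by blast
      have cq: "continuous_on disc \<gamma>"
        by (rule continuous_on_eq[OF continuous_on_subset[OF continuous_on_mob[OF q(1)]]])
          (auto simp: q(2) mobius_eq_mob)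
      have "fst p \<noteq> 0" if "p \<in> SU11" for p
        using SU11_norm[OF that] by auto
      then have "continuous_on SU11 (\<lambda>p. mobius p 0)"
        unfolding at0 by (intro continuous_intros) auto
      moreover have "(\<lambda>p. mobius p 0) ` SU11 \<subseteq> disc"
        using g0 by (auto simp: PSU11_def)
      ultimately have "continuous_on SU11 (\<lambda>p. \<gamma> (mobius p 0))"
        by (rule continuous_on_compose2[OF cq])
      then show "continuous_on SU11 (\<lambda>p. height (\<gamma> (mobius p 0)))"
        by (intro continuous_intros)
    qed simp
    then have "openin (top_of_set SU11) (\<Union>\<gamma>\<in>\<Gamma>. SU11 \<inter> (\<lambda>p. height (\<gamma> (mobius p 0))) -` {1 / real (Suc
        n)<..})"
      by blast
    moreover have "(\<Union>\<gamma>\<in>\<Gamma>. SU11 \<inter> (\<lambda>p. height (\<gamma> (mobius p 0))) -` {1 / real (Suc n)<..}) = {p \<in> SU11.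
        mobius p \<in> V n}"
      by (auto simp: V_def PSU11_def)
    ultimately show "openin (top_of_set SU11) {p \<in> SU11. mobius p \<in> V n}"
      by simp
  qed
  have "openin ?Q (?p ` V n)" for n
  proof -
    have "V n \<subseteq> carrier PSU11"
      by (auto simp: V_def)
    moreover from this have "{g \<in> carrier PSU11. ?p g \<in> ?p ` V n} = V n"
      using saturated by auto
    ultimately show ?thesis
      using open_V[of n] unfolding openin_quotient_topology top by auto
  qed
  moreover have "topspace ?Q \<subseteq> \<Union>(range (\<lambda>n. ?p ` V n))"
  proof
    fix x assume "x \<in> topspace ?Q"
    then obtain g where g: "g \<in> carrier PSU11" "x = ?p g"
      by (auto simp: topspace_quotient_topology top)
    have "height (g 0) > 0"
      using height_pos[OF g0[OF g(1)]] .
    then obtain n where "1 / real (Suc n) < height (g 0)"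
      using reals_Archimedean[of "height (g 0)"] by (auto simp: inverse_eq_divide)
    moreover have "\<one>\<^bsub>PSU11\<^esub> (g 0) = g 0"
      using g0[OF g(1)] by (simp add: PSU11_def)
    ultimately have "g \<in> V n"
      using g(1) one_closed by (auto simp: V_def intro!: bexI[of _ "\<one>\<^bsub>PSU11\<^esub>"])
    then show "x \<in> \<Union>(range (\<lambda>n. ?p ` V n))"
      using g(2) by blast
  qed
  ultimately obtain F where F: "finite F" "F \<subseteq> range (\<lambda>n. ?p ` V n)" "topspace ?Q \<subseteq> \<Union>F"
    using cocompact unfolding cocompact_in_PSU11_def compact_space_def compactin_def by (metis
        (no_types, lifting) rangeE)
  then obtain N where N: "finite N" "F = (\<lambda>n. ?p ` V n) ` N"
    by (meson finite_subset_image)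
  \<comment> \<open>Inserting 0 keeps \<open>Max\<close> meaningful when \<open>N\<close> is
    empty.\<close>
  define m where "m = Max (insert 0 N)"
  have "\<exists>\<gamma>\<in>\<Gamma>. height (\<gamma> z) \<ge> 1 / real (Suc m)" if z: "z \<in> disc" for z
  proof -
    define r where "r = sqrt (height z)"
    have r: "r > 0" "r\<^sup>2 = height z"
      using height_pos[OF z] by (simp_all add: r_def)
    \<comment> \<open>A matrix that carries 0 to \<open>z\<close>; its determinant is normalised by
      r^2 = height z.\<close>
    define p where "p = (complex_of_real (1 / r), z / of_real r)"
    have "(cmod (fst p))\<^sup>2 - (cmod (snd p))\<^sup>2 = height z / r\<^sup>2"
      by (simp add: p_def norm_divide power_divide diff_divide_distrib)
    also have "\<dots> = 1"
      using height_pos[OF z] unfolding r(2) by simp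
    finally have "p \<in> SU11"
      by (simp add: SU11_def p_def)
    then have g: "mobius p \<in> carrier PSU11"
      by (simp add: PSU11_def)
    have p0: "mobius p 0 = z"
      using r by (simp add: at0 p_def)
    have "?p (mobius p) \<in> topspace ?Q"
      using g by (simp add: topspace_quotient_topology top)
    then obtain n where n: "n \<in> N" "?p (mobius p) \<in> ?p ` V n"
      using F(3) N(2) by blast
    have "mobius p \<in> V n"
      by (rule saturated[OF g n(2)])
    then obtain \<gamma> where "\<gamma> \<in> \<Gamma>" "height (\<gamma> z) > 1 / real (Suc n)"
      by (auto simp: V_def p0)
    moreover have "1 / real (Suc m) \<le> 1 / real (Suc n)"
      using n(1) N(1) by (simp add: m_def frac_le)
    ultimately show ?thesis
      by (metis less_imp_le order_trans)
  qed
  then show thesis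
    using that[of "1 / real (Suc m)"] by simp
qed

end

section \<open>The boundary field of a cocycle\<close>

lemma le_geometric_imp_le_0:
  fixes x :: real
  assumes "\<And>n. x \<le> K * (1 / 2) ^ n"
  shows "x \<le> 0"
proof (rule LIMSEQ_le_const)
  show "(\<lambda>n. K * (1 / 2) ^ n) \<longlonglongrightarrow> (0::real)"
    by (intro tendsto_mult_right_zero LIMSEQ_power_zero) simp
qed (use assms in blast)

lemma geometric_Cauchy_limit:
  fixes a :: "nat \<Rightarrow> complex"
  assumes "\<And>n. cmod (a (Suc n) - a n) \<le> K * (1 / 2) ^ n"
  obtains L where "\<And>n. cmod (a n - L) \<le> 2 * K * (1 / 2) ^ n"
proof -
  have K: "K \<ge> 0"
    using order_trans[OF norm_ge_zero assms[of 0]] by simp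
  have le: "cmod (a (n + k) - a n) \<le> 2 * K * (1 / 2) ^ n" for n k
  proof -
    \<comment> \<open>The subtracted tail makes the geometric bound strong enough for the induction
      on \<open>k\<close>.\<close>
    have "cmod (a (n + k) - a n) \<le> 2 * K * (1 / 2) ^ n - 2 * K * (1 / 2) ^ (n + k)"
    proof (induction k)
      case (Suc k)
      have "cmod (a (n + Suc k) - a n) \<le> cmod (a (Suc (n + k)) - a (n + k)) + cmod (a (n + k) - a n)"
        using norm_triangle_ineq[of "a (Suc (n + k)) - a (n + k)" "a (n + k) - a n"] by simp
      also have "\<dots> \<le> K * (1 / 2) ^ (n + k) + (2 * K * (1 / 2) ^ n - 2 * K * (1 / 2) ^ (n + k))"
        by (intro add_mono assms Suc.IH)
      also have "\<dots> = 2 * K * (1 / 2) ^ n - 2 * K * (1 / 2) ^ (n + Suc k)"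
        by simp
      finally show ?case .
    qed simp
    also have "\<dots> \<le> 2 * K * (1 / 2) ^ n"
      using K by simp
    finally show ?thesis .
  qed
  have lim0: "(\<lambda>n. 2 * K * (1 / 2) ^ n) \<longlonglongrightarrow> (0::real)"
    by (intro tendsto_mult_right_zero LIMSEQ_power_zero) simp
  have "Cauchy a"
  proof (rule CauchyI')
    fix e :: real assume "e > 0"
    then obtain N where N: "2 * K * (1 / 2) ^ N < e / 2"
      using order_tendstoD(2)[OF lim0, of "e / 2"] by (auto simp: eventually_sequentially)
    have "dist (a m) (a n) < e" if "m \<ge> N" "n > m" for m n
    proof -
      have "cmod (a m - a N) < e / 2" "cmod (a n - a N) < e / 2"
        using le[of N "m - N"] le[of N "n - N"] that N by auto
      then show ?thesis
        using norm_triangle_ineq4[of "a m - a N" "a n - a N"] by (simp add: dist_norm)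
    qed
    then show "\<exists>M. \<forall>m\<ge>M. \<forall>n>m. dist (a m) (a n) < e"
      by blast
  qed
  then obtain L where L: "a \<longlonglongrightarrow> L"
    using Cauchy_convergent convergent_def by blast
  have "cmod (a n - L) \<le> 2 * K * (1 / 2) ^ n" for n
  proof -
    have "(\<lambda>k. cmod (a (n + k) - a n)) \<longlonglongrightarrow> cmod (L - a n)"
      using LIMSEQ_ignore_initial_segment[OF L, of n] by (intro tendsto_intros) (simp add: add.commute)
    then have "cmod (L - a n) \<le> 2 * K * (1 / 2) ^ n"
      by (rule LIMSEQ_le_const2) (use le in blast)
    then show ?thesis
      by (simp add: norm_minus_commute)
  qed
  with that show thesis
    by blast
qed

lemma dyadic_scale:
  fixes x :: real
  assumes "0 < x" "x \<le> 1"
  obtains n where "x \<le> (1 / 2) ^ n" "(1 / 2) ^ n < 2 * x"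
proof -
  obtain m where m: "(1 / 2) ^ m < x" "\<And>k. k < m \<Longrightarrow> \<not> (1 / 2) ^ k < x"
    using exists_least_iff[of "\<lambda>n. (1 / 2) ^ n < x"] real_arch_pow_inv[OF assms(1), of "1 / 2"] by auto
  have "m \<noteq> 0"
    using m(1) assms(2) by (intro notI) simp
  then obtain n where "m = Suc n"
    using not0_implies_Suc by blast
  then show thesis
    using that[of n] m(1) m(2)[of n] by simp
qed

text \<open>The hypotheses bound the hyperbolic distance from \<open>z\<close> to \<open>z'\<close>,
  and an isometry cannot spoil that. In terms of heights, \<open>L\<close> compares them before the
  map and \<open>mob_den_growth\<close> compares the factors by which the map divides them.\<close>

lemma height_mob_comparison:
  assumes p: "p \<in> SU11" and z: "z \<in> disc" "z' \<in> disc" and M: "cmod (z' - z) \<le> M * (1 - cmod z)" "M \<ge> 0"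
    and L: "1 - cmod z \<le> L * (1 - cmod z')" "L > 0"
  shows "height (mob p z) / (2 * L * (1 + M)\<^sup>2) \<le> height (mob p z')"
proof -
  have d: "cmod (mob_den p z) > 0" "cmod (mob_den p z') > 0"
    using mob_den_nonzero[OF p] z by auto
  have "height z \<le> 2 * L * height z'"
  proof -
    have "height z \<le> 2 * (L * (1 - cmod z'))"
      using height_bounds(2)[of z] z L(1) by simp
    also have "L * (1 - cmod z') \<le> L * height z'"
      using height_bounds(1)[of z'] z L(2) by (intro mult_left_mono) auto
    finally show ?thesis
      by simp
  qed
  moreover have "(cmod (mob_den p z'))\<^sup>2 \<le> (1 + M)\<^sup>2 * (cmod (mob_den p z))\<^sup>2"
    using mob_den_growth[OF p z(1) M] by (simp add: power_mult_distrib[symmetric] power_mono)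
  ultimately have "height z * (cmod (mob_den p z'))\<^sup>2 \<le> (2 * L * height z') * ((1 + M)\<^sup>2 * (cmod
      (mob_den p z))\<^sup>2)"
    using height_pos[OF z(2)] L(2) by (intro mult_mono) auto
  moreover have "x / A / (2 * L * B) \<le> y / A'" if "x * A' \<le> (2 * L * y) * (B * A)" "A > 0" "A' > 0" "B > 0"
    for x A A' B y :: real
    using that L(2) by (simp add: field_simps)
  moreover have "(1 + M)\<^sup>2 > 0"
    using M(2) by simp
  ultimately show ?thesis
    using d z by (simp add: height_mob[OF p])
qed

lemma continuous_agree_on_cball:
  fixes f g :: "complex \<Rightarrow> complex"
  assumes "continuous_on (cball 0 1) f" "continuous_on (cball 0 1) g"
    and "\<And>z. z \<in> disc \<Longrightarrow> f z = g z" and w: "cmod w \<le> 1"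
  shows "f w = g w"
proof -
  have cl: "closure disc = cball (0::complex) 1"
    by simp
  have "f w - g w = 0"
    by (rule continuous_constant_on_closure[of disc "\<lambda>z. f z - g z"])
      (use assms in \<open>auto simp: cl intro!: continuous_intros\<close>)
  then show ?thesis
    by simp
qed

section \<open>Killing polynomials of a cocycle and their limits on the circle\<close>

locale PSU11_cocycle = PSU11_subgroup +
  fixes c :: "(complex \<Rightarrow> complex) \<Rightarrow> complex \<Rightarrow> complex"
  assumes discrete: "discrete_in_PSU11 \<Gamma>" and cocompact: "cocompact_in_PSU11 \<Gamma>" and cocycle: "c \<in>
      cocycles \<Gamma>"
begin

definition kcoeff :: "(complex \<Rightarrow> complex) \<Rightarrow> complex \<times> complex"
  where "kcoeff \<gamma> = (SOME q. Re (snd q) = 0 \<and> (\<forall>z\<in>disc. c \<gamma> z = fst q + snd q * z - cnj (fst q) * z\<^sup>2))"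

text \<open>Only the values of \<open>c \<gamma>\<close> on the open disc are meaningful. The
  polynomial form of a Killing field extends them to the circle, where the boundary field is
  built.\<close>

definition C :: "(complex \<Rightarrow> complex) \<Rightarrow> complex \<Rightarrow> complex"
  where "C \<gamma> w = fst (kcoeff \<gamma>) + snd (kcoeff \<gamma>) * w - cnj (fst (kcoeff \<gamma>)) * w\<^sup>2"

lemma kcoeff:
  assumes "\<gamma> \<in> \<Gamma>"
  shows "Re (snd (kcoeff \<gamma>)) = 0" "z \<in> disc \<Longrightarrow> c \<gamma> z = C \<gamma> z"
proof -
  have "c \<gamma> \<in> killing_fields"
    using cocycle assms by (auto simp: cocycles_def)
  then obtain a b where "Re b = 0" "\<And>z. z \<in> disc \<Longrightarrow> c \<gamma> z = a + b * z - cnj a * z\<^sup>2"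
    by (rule killing_fieldsD) blast
  then have "\<exists>q. Re (snd q) = 0 \<and> (\<forall>z\<in>disc. c \<gamma> z = fst q + snd q * z - cnj (fst q) * z\<^sup>2)"
    by (intro exI[of _ "(a, b)"]) auto
  from someI_ex[OF this, folded kcoeff_def]
  show "Re (snd (kcoeff \<gamma>)) = 0" "z \<in> disc \<Longrightarrow> c \<gamma> z = C \<gamma> z"
    by (auto simp: C_def)
qed

lemma continuous_on_C: "continuous_on S (C \<gamma>)"
  unfolding C_def by (intro continuous_intros)

lemma C_holomorphic: "C \<gamma> holomorphic_on S"
  unfolding C_def by (intro holomorphic_intros)

lemma C_tangential:
  assumes "\<gamma> \<in> \<Gamma>" "cmod w = 1"
  shows "Re (cnj w * C \<gamma> w) = 0"
proof -
  have "cnj w * C \<gamma> w = cnj w * fst (kcoeff \<gamma>) + snd (kcoeff \<gamma>) * (w * cnj w) - cnj (fst (kcoeff \<gamma>)) *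
      w * (w * cnj w)"
    by (simp add: C_def algebra_simps power2_eq_square)
  then show ?thesis
    using kcoeff(1)[OF assms(1)] by (simp add: circle_cnj[OF assms(2)])
qed

text \<open>The identity is given on the open disc and reaches the circle by continuity; division by
  the derivative appears as multiplication by the squared automorphy factor.\<close>

lemma C_cocycle:
  assumes "\<gamma> \<in> \<Gamma>" "mobius p \<in> \<Gamma>" and p: "p \<in> SU11" and w: "cmod w \<le> 1"
  shows "C (\<gamma> \<otimes>\<^bsub>PSU11\<^esub> mobius p) w = C \<gamma> (mob p w) * (mob_den p w)\<^sup>2 + C (mobius p) w"
proof (rule continuous_agree_on_cball[OF _ _ _ w])
  show "continuous_on (cball 0 1) (C (\<gamma> \<otimes>\<^bsub>PSU11\<^esub> mobius p))"
    by (rule continuous_on_C)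
  show "continuous_on (cball 0 1) (\<lambda>w. C \<gamma> (mob p w) * (mob_den p w)\<^sup>2 + C (mobius p) w)"
    by (intro continuous_intros continuous_on_compose2[OF continuous_on_C continuous_on_mob[OF p]]
        continuous_on_mob_den continuous_on_C) auto
  fix z assume z: "z \<in> disc"
  have "c (\<gamma> \<otimes>\<^bsub>PSU11\<^esub> mobius p) z = vf_pullback (mobius p) (c \<gamma>) z + c (mobius p) z"
    using cocycle assms(1,2) z by (auto simp: cocycles_def)
  then show "C (\<gamma> \<otimes>\<^bsub>PSU11\<^esub> mobius p) z = C \<gamma> (mob p z) * (mob_den p z)\<^sup>2 + C (mobius p) z"
    using assms z kcoeff(2)[OF mult_closed[OF assms(1,2)] z] kcoeff(2)[OF assms(2) z]
      kcoeff(2)[OF assms(1) mob_disc[OF p z]]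
    by (simp add: vf_pullback_def mobius_has_derivative(2)[OF p z] mobius_eq_mob)
qed

text \<open>Two elements that move \<open>z\<close> into a fixed compact set differ by an element of a finite set, and the
  derivative of either is of size \<open>1 / (1 - |z|)\<close> near \<open>z\<close>.\<close>

lemma C_comparison:
  assumes k: "k > 0" and M: "M \<ge> 0"
  obtains K where "K \<ge> 0" "\<And>\<eta> \<eta>' z w. \<lbrakk>\<eta> \<in> \<Gamma>; \<eta>' \<in> \<Gamma>; z \<in> disc; cmod w \<le> 1; height (\<eta> z) \<ge> k;
    height (\<eta>' z) \<ge> k; cmod (w - z) \<le> M * (1 - cmod z)\<rbrakk> \<Longrightarrow> cmod (C \<eta>' w - C \<eta> w) \<le> K * (1 - cmod z)"
proof -
  define S where "S = {\<sigma> \<in> \<Gamma>. \<exists>z\<in>disc. height z \<ge> k \<and> height (\<sigma> z) \<ge> k}"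
  have "finite S"
    unfolding S_def by (rule finite_return[OF discrete k])
  then have "bounded (\<Union>\<sigma>\<in>S. C \<sigma> ` cball 0 1)"
    by (intro bounded_UN ballI compact_imp_bounded compact_continuous_image continuous_on_C) auto
  then obtain B where B: "B > 0" "\<forall>x\<in>(\<Union>\<sigma>\<in>S. C \<sigma> ` cball 0 1). cmod x \<le> B"
    unfolding bounded_pos by blast
  define K where "K = B * ((1 + M)\<^sup>2 * (2 / k))"
  have "cmod (C \<eta>' w - C \<eta> w) \<le> K * (1 - cmod z)"
    if \<eta>: "\<eta> \<in> \<Gamma>" "\<eta>' \<in> \<Gamma>" and z: "z \<in> disc" and w: "cmod w \<le> 1"
      and h: "height (\<eta> z) \<ge> k" "height (\<eta>' z) \<ge> k" and wz: "cmod (w - z) \<le> M * (1 - cmod z)" for \<eta> \<eta>' z w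
  proof -
    obtain p where p: "p \<in> SU11" "\<eta> = mobius p"
      using lift[OF \<eta>(1)] by blast
    define \<sigma> where "\<sigma> = \<eta>' \<otimes>\<^bsub>PSU11\<^esub> inv\<^bsub>PSU11\<^esub> \<eta>"
    have \<sigma>: "\<sigma> \<in> \<Gamma>" "\<sigma> \<otimes>\<^bsub>PSU11\<^esub> \<eta> = \<eta>'" "\<sigma> (\<eta> z) = \<eta>' z"
      using \<eta> z by (simp_all add: \<sigma>_def mult_closed inv_closed mult_inv_cancel mult_inv_apply)
    then have "\<sigma> \<in> S"
      using h maps_disc[OF \<eta>(1) z] by (auto simp: S_def)
    then have "cmod (C \<sigma> (mob p w)) \<le> B"
      using B(2) mob_cball[OF p(1) w] by auto
    moreover have "(cmod (mob_den p w))\<^sup>2 \<le> (1 + M)\<^sup>2 * (2 / k) * (1 - cmod z)"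
    proof -
      have d: "cmod (mob_den p z) > 0"
        using mob_den_nonzero[OF p(1)] z by auto
      have "k \<le> height z / (cmod (mob_den p z))\<^sup>2"
        using h(1) z by (simp add: p mobius_eq_mob height_mob)
      then have "(cmod (mob_den p z))\<^sup>2 \<le> height z / k"
        using d k by (simp add: field_simps)
      also have "\<dots> \<le> (2 * (1 - cmod z)) / k"
        using height_bounds(2)[of z] z k by (intro divide_right_mono) auto
      finally have "(1 + M)\<^sup>2 * (cmod (mob_den p z))\<^sup>2 \<le> (1 + M)\<^sup>2 * ((2 * (1 - cmod z)) / k)"
        by (intro mult_left_mono) auto
      moreover have "(cmod (mob_den p w))\<^sup>2 \<le> (1 + M)\<^sup>2 * (cmod (mob_den p z))\<^sup>2"
        using mob_den_growth[OF p(1) z wz M] by (simp add: power_mult_distrib[symmetric] power_mono)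
      ultimately have "(cmod (mob_den p w))\<^sup>2 \<le> (1 + M)\<^sup>2 * ((2 * (1 - cmod z)) / k)"
        by (rule order_trans[rotated])
      also have "\<dots> = (1 + M)\<^sup>2 * (2 / k) * (1 - cmod z)"
        by (simp only: times_divide_eq_right times_divide_eq_left mult.assoc)
      finally show ?thesis .
    qed
    ultimately have "cmod (C \<sigma> (mob p w)) * (cmod (mob_den p w))\<^sup>2 \<le> B * ((1 + M)\<^sup>2 * (2 / k) * (1 -
        cmod z))"
      using B(1) by (intro mult_mono) auto
    moreover have "C \<eta>' w - C \<eta> w = C \<sigma> (mob p w) * (mob_den p w)\<^sup>2"
      using C_cocycle[OF \<sigma>(1) _ p(1) w] \<eta>(1) \<sigma>(2) by (simp add: p(2))
    ultimately show ?thesis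
      by (simp add: norm_mult norm_power K_def mult.assoc)
  qed
  moreover have "K \<ge> 0"
    using B(1) k by (simp add: K_def)
  ultimately show thesis
    using that by blast
qed

definition radial :: "complex \<Rightarrow> nat \<Rightarrow> complex"
  where "radial w n = of_real (1 - (1 / 2) ^ n) * w"

lemma radial:
  assumes "cmod w = 1"
  shows "radial w n \<in> disc" "1 - cmod (radial w n) = (1 / 2) ^ n" "cmod (w - radial w n) = (1 / 2) ^ n"
    "cmod (radial w (Suc n) - radial w n) = 1 / 2 * (1 / 2) ^ n"
proof -
  have "(1 / 2) ^ n \<le> (1::real)"
    by (rule power_le_one) auto
  then have n: "cmod (radial w n) = 1 - (1 / 2) ^ n"
    unfolding radial_def norm_mult norm_of_real assms by simp
  then show "radial w n \<in> disc" "1 - cmod (radial w n) = (1 / 2) ^ n"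
    by simp_all
  have "w - radial w n = of_real ((1 / 2) ^ n) * w"
    "radial w (Suc n) - radial w n = of_real (1 / 2 * (1 / 2) ^ n) * w"
    by (simp_all add: radial_def algebra_simps)
  then show "cmod (w - radial w n) = (1 / 2) ^ n" "cmod (radial w (Suc n) - radial w n) = 1 / 2 * (1 /
      2) ^ n"
    unfolding norm_mult norm_of_real assms by (simp_all only: norm_mult norm_of_real assms) auto
qed

text \<open>The estimate is uniform in each approach region |w - z| <= M (1 - |z|). All apertures
  \<open>M\<close> are allowed because carrying the estimate to another boundary point by a group
  element changes the aperture.\<close>

lemma boundary_field_approximation:
  obtains k0 e Y where "k0 > 0" "\<And>z. z \<in> disc \<Longrightarrow> e z \<in> \<Gamma> \<and> height (e z z) \<ge> k0"
    "\<And>k M. k > 0 \<Longrightarrow> M \<ge> 0 \<Longrightarrow> \<exists>K\<ge>0. \<forall>w z \<eta>. cmod w = 1 \<longrightarrow> z \<in> disc \<longrightarrow> \<eta> \<in> \<Gamma> \<longrightarrow> height (\<eta> z) \<ge> k \<longrightarrow>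
      cmod (w - z) \<le> M * (1 - cmod z) \<longrightarrow> cmod (Y w + C \<eta> w) \<le> K * (1 - cmod z)"
proof -
  obtain k0 where k0: "k0 > 0" "\<And>z. z \<in> disc \<Longrightarrow> \<exists>\<gamma>\<in>\<Gamma>. height (\<gamma> z) \<ge> k0"
    using cocompact_height[OF cocompact] by blast
  then obtain e where e: "\<And>z. z \<in> disc \<Longrightarrow> e z \<in> \<Gamma> \<and> height (e z z) \<ge> k0"
    by metis
  \<comment> \<open>Passing from one radial point to the next costs the factor 2 * 2 * (1 + 1 / 2)^2
    = 9 of \<open>height_mob_comparison\<close>, with L = 2 and M = 1 / 2. So the same \<eta> still
    moves the next point to height at least \<open>k0 / 9\<close>.\<close>
  have k9: "k0 / 9 > 0" "k0 / 9 \<le> k0"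
    using k0(1) by auto
  obtain K where K: "K \<ge> 0" "\<And>\<eta> \<eta>' z w. \<lbrakk>\<eta> \<in> \<Gamma>; \<eta>' \<in> \<Gamma>; z \<in> disc; cmod w \<le> 1; height (\<eta> z) \<ge> k0 / 9;
    height (\<eta>' z) \<ge> k0 / 9; cmod (w - z) \<le> 1 * (1 - cmod z)\<rbrakk> \<Longrightarrow> cmod (C \<eta>' w - C \<eta> w) \<le> K * (1 - cmod z)"
    using C_comparison[OF k9(1), of 1] by (metis zero_le_one)
  have "\<exists>L. \<forall>n. cmod (C (e (radial w n)) w - L) \<le> 2 * K * (1 / 2) ^ n" if w: "cmod w = 1" for w
  proof -
    note r = radial[OF w]
    have "cmod (C (e (radial w (Suc n))) w - C (e (radial w n)) w) \<le> K * (1 / 2) ^ n" for n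
    proof -
      obtain p where p: "p \<in> SU11" "e (radial w n) = mobius p"
        using lift e[OF r(1)] by blast
      have "height (mob p (radial w n)) / (2 * 2 * (1 + 1 / 2)\<^sup>2) \<le> height (mob p (radial w (Suc n)))"
        by (rule height_mob_comparison[OF p(1) r(1) r(1)]) (simp_all only: r, simp_all)
      moreover have "k0 \<le> height (mob p (radial w n))"
        using e[OF r(1)] mobius_eq_mob[OF r(1)] p(2) by metis
      ultimately have "height (e (radial w n) (radial w (Suc n))) \<ge> k0 / 9"
        unfolding p(2) mobius_eq_mob[OF r(1)] by (simp add: power2_eq_square)
      moreover have "height (e (radial w (Suc n)) (radial w (Suc n))) \<ge> k0 / 9"
        using e[OF r(1)] k9(2) by (meson order_trans)
      ultimately have "cmod (C (e (radial w (Suc n))) w - C (e (radial w n)) w) \<le> K * (1 - cmod (radial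
          w (Suc n)))"
        using e[OF r(1)] r w by (intro K(2)) auto
      also have "\<dots> \<le> K * (1 / 2) ^ n"
        unfolding r(2) using K(1) by (intro mult_left_mono) auto
      finally show ?thesis .
    qed
    then obtain L where "\<And>n. cmod (C (e (radial w n)) w - L) \<le> 2 * K * (1 / 2) ^ n"
      using geometric_Cauchy_limit[of "\<lambda>n. C (e (radial w n)) w" K] by blast
    then show ?thesis
      by blast
  qed
  then obtain L where L: "\<And>w n. cmod w = 1 \<Longrightarrow> cmod (C (e (radial w n)) w - L w) \<le> 2 * K * (1 / 2) ^ n"
    by metis
  have "\<exists>K\<ge>0. \<forall>w z \<eta>. cmod w = 1 \<longrightarrow> z \<in> disc \<longrightarrow> \<eta> \<in> \<Gamma> \<longrightarrow> height (\<eta> z) \<ge> k \<longrightarrow>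
      cmod (w - z) \<le> M * (1 - cmod z) \<longrightarrow> cmod (- L w + C \<eta> w) \<le> K * (1 - cmod z)"
    if k: "k > 0" and M: "M \<ge> 0" for k M
  proof -
    \<comment> \<open>The point \<open>z\<close> will be compared with the radial point of its
      dyadic scale, at distance at most (2 + M) (1 - |z|): 2 comes from
      \<open>(1 / 2) ^ n < 2 * (1 - cmod z)\<close> and M from the aperture. L = 1 suffices since
      that radial point is no closer to the circle than \<open>z\<close>.\<close>
    define k' where "k' = min (k / (2 * 1 * (1 + (2 + M))\<^sup>2)) k0"
    have "0 < (1 + (2 + M))\<^sup>2"
      using M by simp
    then have k': "k' > 0"
      using k k0(1) by (simp add: k'_def)
    obtain K1 where K1: "K1 \<ge> 0" "\<And>\<eta> \<eta>' z w. \<lbrakk>\<eta> \<in> \<Gamma>; \<eta>' \<in> \<Gamma>; z \<in> disc; cmod w \<le> 1; height (\<eta> z) \<ge> k';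
      height (\<eta>' z) \<ge> k'; cmod (w - z) \<le> 1 * (1 - cmod z)\<rbrakk> \<Longrightarrow> cmod (C \<eta>' w - C \<eta> w) \<le> K1 * (1 - cmod z)"
      using C_comparison[OF k', of 1] by (metis zero_le_one)
    have "cmod (- L w + C \<eta> w) \<le> (2 * (K1 + 2 * K)) * (1 - cmod z)"
      if w: "cmod w = 1" and z: "z \<in> disc" and \<eta>: "\<eta> \<in> \<Gamma>" "height (\<eta> z) \<ge> k" and wz: "cmod (w - z) \<le> M
          * (1 - cmod z)"
      for w z \<eta>
    proof -
      note r = radial[OF w]
      obtain n where n: "1 - cmod z \<le> (1 / 2) ^ n" "(1 / 2) ^ n < 2 * (1 - cmod z)"
        using dyadic_scale[of "1 - cmod z"] z by auto
      obtain p where p: "p \<in> SU11" "\<eta> = mobius p"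
        using lift[OF \<eta>(1)] by blast
      have "cmod (radial w n - z) \<le> cmod (w - z) + cmod (w - radial w n)"
        using norm_triangle_ineq4[of "w - z" "w - radial w n"] by simp
      also have "\<dots> \<le> (2 + M) * (1 - cmod z)"
        unfolding r(3) using n(2) wz by (simp add: algebra_simps)
      finally have "height (mob p z) / (2 * 1 * (1 + (2 + M))\<^sup>2) \<le> height (mob p (radial w n))"
        using M n(1) by (intro height_mob_comparison[OF p(1) z r(1)]) (simp_all add: r(2))
      moreover have "k / (2 * 1 * (1 + (2 + M))\<^sup>2) \<le> height (mob p z) / (2 * 1 * (1 + (2 + M))\<^sup>2)"
        using \<eta>(2) z by (intro divide_right_mono) (simp_all add: p(2) mobius_eq_mob)
      ultimately have "height (\<eta> (radial w n)) \<ge> k'"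
        unfolding p(2) mobius_eq_mob[OF r(1)] k'_def by linarith
      moreover have "height (e (radial w n) (radial w n)) \<ge> k'"
        using e[OF r(1), of n] unfolding k'_def by linarith
      ultimately have "cmod (C \<eta> w - C (e (radial w n)) w) \<le> K1 * (1 - cmod (radial w n))"
        using e[OF r(1)] r w \<eta> by (intro K1(2)) auto
      then have "cmod (C \<eta> w - C (e (radial w n)) w) \<le> K1 * (1 / 2) ^ n"
        by (simp only: r(2))
      moreover have "cmod (- L w + C \<eta> w) \<le> cmod (C \<eta> w - C (e (radial w n)) w) + cmod (C (e (radial w
          n)) w - L w)"
        using norm_triangle_ineq[of "C \<eta> w - C (e (radial w n)) w" "C (e (radial w n)) w - L w"] by
            (simp add: add.commute)
      ultimately have "cmod (- L w + C \<eta> w) \<le> (K1 + 2 * K) * (1 / 2) ^ n"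
        using L[OF w, of n] by (simp add: algebra_simps)
      also have "\<dots> \<le> (K1 + 2 * K) * (2 * (1 - cmod z))"
        using n(2) K(1) K1(1) by (intro mult_left_mono) auto
      finally show ?thesis
        by (simp only: mult_ac)
    qed
    then show ?thesis
      using K(1) K1(1) by (intro exI[of _ "2 * (K1 + 2 * K)"]) auto
  qed
  with that[of k0 e "\<lambda>w. - L w"] k0(1) e show thesis
    by blast
qed

text \<open>All three properties are inherited from the Killing polynomials: each polynomial is
  continuous and tangential, and the cocycle identity relates those used at \<open>w\<close> to
  those used at its image.\<close>

theorem boundary_field:
  obtains Y where "continuous_on (sphere 0 1) Y" "\<And>w. cmod w = 1 \<Longrightarrow> Re (cnj w * Y w) = 0"
    "\<And>p w. p \<in> SU11 \<Longrightarrow> mobius p \<in> \<Gamma> \<Longrightarrow> cmod w = 1 \<Longrightarrow> Y (mob p w) * (mob_den p w)\<^sup>2 - Y w = C (mobius p) w"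
proof -
  obtain k0 e Y where k0: "k0 > 0" and e: "\<And>z. z \<in> disc \<Longrightarrow> e z \<in> \<Gamma> \<and> height (e z z) \<ge> k0"
    and Y: "\<And>k M. k > 0 \<Longrightarrow> M \<ge> 0 \<Longrightarrow> \<exists>K\<ge>0. \<forall>w z \<eta>. cmod w = 1 \<longrightarrow> z \<in> disc \<longrightarrow> \<eta> \<in> \<Gamma> \<longrightarrow> height (\<eta> z) \<ge> k \<longrightarrow>
      cmod (w - z) \<le> M * (1 - cmod z) \<longrightarrow> cmod (Y w + C \<eta> w) \<le> K * (1 - cmod z)"
    using boundary_field_approximation by metis
  \<comment> \<open>Aperture 2 rather than 1 lets the radial point over \<open>w0\<close> at scale
    \<open>(1 / 2) ^ n\<close> serve every \<open>w\<close> within that distance of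
    \<open>w0\<close>.\<close>
  obtain K where K: "K \<ge> 0" "\<And>w z \<eta>. cmod w = 1 \<Longrightarrow> z \<in> disc \<Longrightarrow> \<eta> \<in> \<Gamma> \<Longrightarrow> height (\<eta> z) \<ge> k0 \<Longrightarrow>
      cmod (w - z) \<le> 2 * (1 - cmod z) \<Longrightarrow> cmod (Y w + C \<eta> w) \<le> K * (1 - cmod z)"
    using Y[OF k0, of 2] by auto
  have approx: "cmod (Y w + C (e (radial w n)) w) \<le> K * (1 / 2) ^ n" if w: "cmod w = 1" for w n
    using K(2)[OF w radial(1)[OF w], of "e (radial w n)" n] e[OF radial(1)[OF w], of n]
    by (simp add: radial(2,3)[OF w])
  have "continuous_on (sphere 0 1) Y"
    unfolding continuous_on_iff
  proof (intro ballI allI impI)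
    fix w0 :: complex and \<epsilon> :: real assume w0: "w0 \<in> sphere 0 1" and \<epsilon>: "\<epsilon> > 0"
    then have w0': "cmod w0 = 1"
      by simp
    have "(\<lambda>n. K * (1 / 2) ^ n) \<longlonglongrightarrow> (0::real)"
      by (intro tendsto_mult_right_zero LIMSEQ_power_zero) simp
    then obtain n where n: "K * (1 / 2) ^ n < \<epsilon> / 3"
      using order_tendstoD(2)[of _ 0 sequentially "\<epsilon> / 3"] \<epsilon> by (auto simp: eventually_sequentially)
    define z where "z = radial w0 n"
    note r = radial[OF w0', of n, folded z_def]
    \<comment> \<open>A single polynomial \<open>C (e z)\<close> approximates - Y throughout a
      neighbourhood of \<open>w0\<close>, so its continuity passes to \<open>Y\<close> up to the
      error.\<close>
    have near: "cmod (Y w + C (e z) w) < \<epsilon> / 3" if w: "cmod w = 1" "cmod (w - w0) \<le> (1 / 2) ^ n" for w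
    proof -
      have "cmod (w - z) \<le> cmod (w - w0) + cmod (w0 - z)"
        using norm_triangle_ineq[of "w - w0" "w0 - z"] by simp
      then have "cmod (w - z) \<le> 2 * (1 - cmod z)"
        using w(2) r(2,3) by simp
      then have "cmod (Y w + C (e z) w) \<le> K * (1 - cmod z)"
        using e[OF r(1)] w(1) r(1) by (intro K(2)) auto
      then show ?thesis
        using n r(2) by simp
    qed
    have "continuous_on UNIV (C (e z))"
      by (rule continuous_on_C)
    then obtain d where d: "d > 0" "\<And>w. dist w w0 < d \<Longrightarrow> dist (C (e z) w) (C (e z) w0) < \<epsilon> / 3"
      using \<epsilon> unfolding continuous_on_iff by (metis UNIV_I divide_pos_pos zero_less_numeral)
    show "\<exists>d>0. \<forall>w\<in>sphere 0 1. dist w w0 < d \<longrightarrow> dist (Y w) (Y w0) < \<epsilon>"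
    proof (intro exI[of _ "min d ((1 / 2) ^ n)"] conjI ballI impI)
      fix w assume w: "w \<in> sphere 0 1" "dist w w0 < min d ((1 / 2) ^ n)"
      have "cmod (Y w + C (e z) w) < \<epsilon> / 3" "cmod (Y w0 + C (e z) w0) < \<epsilon> / 3"
        using w w0' by (intro near; simp add: dist_norm)+
      moreover have "cmod (C (e z) w - C (e z) w0) < \<epsilon> / 3"
        using d(2)[of w] w(2) by (simp add: dist_norm)
      moreover have "Y w - Y w0 = (Y w + C (e z) w) - (Y w0 + C (e z) w0) - (C (e z) w - C (e z) w0)"
        by simp
      moreover from this have "cmod (Y w - Y w0) \<le> cmod (Y w + C (e z) w) + cmod (Y w0 + C (e z) w0)
          + cmod (C (e z) w - C (e z) w0)"
        by (simp only: order_trans[OF norm_triangle_ineq4 add_right_mono[OF norm_triangle_ineq4]])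
      ultimately show "dist (Y w) (Y w0) < \<epsilon>"
        unfolding dist_norm by linarith
    qed (use d(1) in simp)
  qed
  moreover have "Re (cnj w * Y w) = 0" if w: "cmod w = 1" for w
  proof -
    have "\<bar>Re (cnj w * Y w)\<bar> \<le> K * (1 / 2) ^ n" for n
    proof -
      have "Re (cnj w * Y w) = Re (cnj w * (Y w + C (e (radial w n)) w))"
        using C_tangential[OF _ w] e[OF radial(1)[OF w]] by (simp add: distrib_left)
      also have "\<bar>\<dots>\<bar> \<le> cmod (cnj w * (Y w + C (e (radial w n)) w))"
        by (rule abs_Re_le_cmod)
      finally show ?thesis
        using approx[OF w, of n] by (simp add: norm_mult w)
    qed
    then have "\<bar>Re (cnj w * Y w)\<bar> \<le> 0"
      by (rule le_geometric_imp_le_0)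
    then show ?thesis
      by simp
  qed
  moreover have "Y (mob p w) * (mob_den p w)\<^sup>2 - Y w = C (mobius p) w"
    if p: "p \<in> SU11" and \<gamma>: "mobius p \<in> \<Gamma>" and w: "cmod w = 1" for p w
  proof -
    define d where "d = cmod (fst p) - cmod (snd p)"
    have d: "d > 0" "\<And>z. cmod z \<le> 1 \<Longrightarrow> d \<le> cmod (mob_den p z)"
      using SU11_norm[OF p] norm_mob_den_ge(2)[OF p] by (simp_all add: d_def)
    have up: "cmod (mob_den p z) \<le> cmod (fst p) + cmod (snd p)" if "cmod z \<le> 1" for z
    proof -
      have "cmod (mob_den p z) \<le> cmod (snd p) * cmod z + cmod (fst p)"
        using norm_triangle_ineq[of "cnj (snd p) * z" "cnj (fst p)"] by (simp add: mob_den_def norm_mult)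
      moreover have "cmod (snd p) * cmod z \<le> cmod (snd p) * 1"
        using that by (intro mult_left_mono) auto
      ultimately show ?thesis
        by simp
    qed
    \<comment> \<open>The aperture at the image point: by \<open>mob_diff\<close> distances are
      divided by \<open>mob_den\<close> at both points, while heights are divided by its square at
      \<open>z\<close>. The ratio of the two factors is at most (|fst p| + |snd p|) / d, and the 2
      comes from comparing height and distance to the circle.\<close>
    define M where "M = 2 * (cmod (fst p) + cmod (snd p)) / d"
    have "M \<ge> 0"
      using d(1) by (simp add: M_def)
    then obtain K' where K': "K' \<ge> 0" "\<And>w z \<eta>. cmod w = 1 \<Longrightarrow> z \<in> disc \<Longrightarrow> \<eta> \<in> \<Gamma> \<Longrightarrow> height (\<eta> z) \<ge> k0 \<Longrightarrow>
        cmod (w - z) \<le> M * (1 - cmod z) \<Longrightarrow> cmod (Y w + C \<eta> w) \<le> K' * (1 - cmod z)"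
      using Y[OF k0, of M] by auto
    define D where "D = (cmod (mob_den p w))\<^sup>2"
    have "cmod (Y (mob p w) * (mob_den p w)\<^sup>2 - Y w - C (mobius p) w) \<le> (K' * (2 / d\<^sup>2) * D + K) * (1 /
        2) ^ n" for n
    proof -
      define z where "z = radial w n"
      note r = radial[OF w, of n, folded z_def]
      \<comment> \<open>This element moves the image of \<open>z\<close> exactly to where
        \<open>e z\<close> moves \<open>z\<close>, so it is admissible at the image, and the cocycle
        identity expresses \<open>C (e z)\<close> through it.\<close>
      define \<eta> where "\<eta> = e z \<otimes>\<^bsub>PSU11\<^esub> inv\<^bsub>PSU11\<^esub> (mobius p)"
      have z1: "cmod z \<le> 1"
        using r(1) by simp
      have ez: "e z \<in> \<Gamma>" "height (e z z) \<ge> k0"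
        using e[OF r(1)] by auto
      have \<eta>: "\<eta> \<in> \<Gamma>" "\<eta> \<otimes>\<^bsub>PSU11\<^esub> mobius p = e z" "\<eta> (mob p z) = e z z"
        using ez(1) \<gamma> mult_inv_apply[OF ez(1) \<gamma> r(1)] mobius_eq_mob[OF r(1), of p]
        by (simp_all add: \<eta>_def mult_closed inv_closed mult_inv_cancel)
      have dz: "d \<le> cmod (mob_den p z)" "cmod (mob_den p z) > 0" "d \<le> cmod (mob_den p w)"
        using d d(2)[OF z1] d(2)[of w] w by auto
      have hz: "height (mob p z) = height z / (cmod (mob_den p z))\<^sup>2"
        by (rule height_mob[OF p z1])
      have mz: "cmod (mob p z) \<le> 1"
        by (rule mob_cball[OF p z1])
      have "cmod (mob p w - mob p z) \<le> M * (1 - cmod (mob p z))"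
      proof -
        have "cmod (mob p w - mob p z) = (1 - cmod z) / (cmod (mob_den p w) * cmod (mob_den p z))"
          using mob_diff[OF p z1, of w] w r(2,3) by (simp add: norm_divide norm_mult)
        also have "\<dots> \<le> (1 - cmod z) / (d * cmod (mob_den p z))"
          using dz d(1) z1 by (intro divide_left_mono mult_right_mono mult_pos_pos) auto
        also have "\<dots> = (2 * cmod (mob_den p z) / d) * ((1 - cmod z) / (cmod (mob_den p z))\<^sup>2 / 2)"
        proof -
          have "x / (d * m) = (2 * m / d) * (x / m\<^sup>2 / 2)" if "m \<noteq> 0" for x m
            using that by (simp add: power2_eq_square)
          then show ?thesis
            using dz(2) by (metis less_irrefl)
        qed
        also have "\<dots> \<le> M * (1 - cmod (mob p z))"
        proof (intro mult_mono)
          show "2 * cmod (mob_den p z) / d \<le> M"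
            unfolding M_def using up[OF z1] d(1) by (intro divide_right_mono mult_left_mono) auto
          have "(1 - cmod z) / (cmod (mob_den p z))\<^sup>2 \<le> height (mob p z)"
            unfolding hz using height_bounds(1)[OF z1] by (intro divide_right_mono) auto
          then show "(1 - cmod z) / (cmod (mob_den p z))\<^sup>2 / 2 \<le> 1 - cmod (mob p z)"
            using height_bounds(2)[OF mz] by simp
        qed (use \<open>M \<ge> 0\<close> z1 in auto)
        finally show ?thesis .
      qed
      then have "cmod (Y (mob p w) + C \<eta> (mob p w)) \<le> K' * (1 - cmod (mob p z))"
        using \<eta> ez mob_disc[OF p r(1)] by (intro K'(2) mob_sphere[OF p w]) auto
      also have "\<dots> \<le> K' * (2 / d\<^sup>2 * (1 / 2) ^ n)"
      proof (intro mult_left_mono K'(1))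
        have "1 - cmod (mob p z) \<le> height z / (cmod (mob_den p z))\<^sup>2"
          using height_bounds(1)[OF mz] by (simp add: hz)
        also have "\<dots> \<le> (2 * (1 / 2) ^ n) / (cmod (mob_den p z))\<^sup>2"
          using height_bounds(2)[OF z1] by (intro divide_right_mono) (simp_all add: r(2))
        also have "\<dots> \<le> (2 * (1 / 2) ^ n) / d\<^sup>2"
          using dz d(1) by (intro divide_left_mono power_mono) auto
        finally show "1 - cmod (mob p z) \<le> 2 / d\<^sup>2 * (1 / 2) ^ n"
          by simp
      qed
      finally have "cmod (Y (mob p w) + C \<eta> (mob p w)) * D \<le> K' * (2 / d\<^sup>2 * (1 / 2) ^ n) * D"
        by (intro mult_right_mono) (auto simp: D_def)
      moreover have "cmod (Y w + C (e z) w) \<le> K * (1 / 2) ^ n"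
        using approx[OF w, of n] by (simp add: z_def)
      moreover have "C (e z) w = C \<eta> (mob p w) * (mob_den p w)\<^sup>2 + C (mobius p) w"
        using C_cocycle[OF \<eta>(1) \<gamma> p, of w] \<eta>(2) w by simp
      then have eq: "Y (mob p w) * (mob_den p w)\<^sup>2 - Y w - C (mobius p) w =
          (Y (mob p w) + C \<eta> (mob p w)) * (mob_den p w)\<^sup>2 - (Y w + C (e z) w)"
        by (simp add: algebra_simps)
      have "cmod (Y (mob p w) * (mob_den p w)\<^sup>2 - Y w - C (mobius p) w) \<le>
          cmod (Y (mob p w) + C \<eta> (mob p w)) * D + cmod (Y w + C (e z) w)"
        using norm_triangle_ineq4[of "(Y (mob p w) + C \<eta> (mob p w)) * (mob_den p w)\<^sup>2" "Y w + C (e z) w"]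
        unfolding eq D_def by (simp only: norm_mult norm_power)
      ultimately show ?thesis
        by (simp add: algebra_simps)
    qed
    then have "cmod (Y (mob p w) * (mob_den p w)\<^sup>2 - Y w - C (mobius p) w) \<le> 0"
      by (rule le_geometric_imp_le_0)
    then show ?thesis
      by (simp add: algebra_simps)
  qed
  ultimately show thesis
    using that by blast
qed

end

section \<open>Primitives of cocycles and the maps Phi and Psi\<close>

text \<open>The factor 1 / \<gamma>' is holomorphic, so dbar falls on \<xi> alone. The result is the
  transformation rule of a Beltrami differential.\<close>

lemma has_wirtinger_pullback:
  assumes p: "p \<in> SU11" and z: "z \<in> disc" and \<xi>: "has_wirtinger \<xi> a b (at (mob p z))"
  shows "\<exists>a. has_wirtinger (vf_pullback (mobius p) \<xi>) a (b * (mob_den p z)\<^sup>2 / cnj ((mob_den p z)\<^sup>2))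
      (at z)"
proof -
  let ?d = "mob_den p z"
  have z1: "cmod z \<le> 1"
    using z by simp
  have "(mob p has_derivative (\<lambda>v. 1 / ?d\<^sup>2 * v)) (at z)"
    using mob_has_derivative[OF p z1] unfolding has_field_derivative_def .
  from has_derivative_compose[OF this \<xi>]
  have "has_wirtinger (\<lambda>z. \<xi> (mob p z)) (a / ?d\<^sup>2) (b / cnj (?d\<^sup>2)) (at z)"
    by (simp add: mult.assoc)
  moreover have "((\<lambda>z. (mob_den p z)\<^sup>2) has_field_derivative 2 * ?d * cnj (snd p)) (at z)"
    unfolding mob_den_def by (auto intro!: derivative_eq_intros simp: mult_ac)
  then have "has_wirtinger (\<lambda>z. (mob_den p z)\<^sup>2) (2 * ?d * cnj (snd p)) 0 (at z)"
    by (rule has_wirtinger_field)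
  ultimately have "has_wirtinger (\<lambda>z. \<xi> (mob p z) * (mob_den p z)\<^sup>2)
      (a / ?d\<^sup>2 * ?d\<^sup>2 + \<xi> (mob p z) * (2 * ?d * cnj (snd p))) (b / cnj (?d\<^sup>2) * ?d\<^sup>2 + \<xi> (mob p z) *
          0) (at z)"
    by (rule has_wirtinger_mult)
  then have "has_wirtinger (vf_pullback (mobius p) \<xi>)
      (a / ?d\<^sup>2 * ?d\<^sup>2 + \<xi> (mob p z) * (2 * ?d * cnj (snd p))) (b / cnj (?d\<^sup>2) * ?d\<^sup>2 + \<xi> (mob p z) *
          0) (at z)"
    by (rule iffD2[OF has_derivative_cong_open[OF open_ball z], rotated])
      (simp add: vf_pullback_def mobius_has_derivative(2)[OF p] mobius_eq_mob)
  then have "has_wirtinger (vf_pullback (mobius p) \<xi>)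
      (a / ?d\<^sup>2 * ?d\<^sup>2 + \<xi> (mob p z) * (2 * ?d * cnj (snd p))) (b * ?d\<^sup>2 / cnj (?d\<^sup>2)) (at z)"
    by (rule has_wirtinger_eqI) simp_all
  then show ?thesis
    by blast
qed

lemma vf_pullback_mobius: "p \<in> SU11 \<Longrightarrow> z \<in> disc \<Longrightarrow> vf_pullback (mobius p) X z = X (mob p z) * (mob_den p z)\<^sup>2"
  by (simp add: vf_pullback_def mobius_has_derivative(2) mobius_eq_mob)

lemma killing_fields_diff:
  assumes "X1 \<in> killing_fields" "X2 \<in> killing_fields"
  shows "(\<lambda>z. X1 z - X2 z) \<in> killing_fields"
proof -
  obtain a b where 1: "Re b = 0" "\<And>z. z \<in> disc \<Longrightarrow> X1 z = a + b * z - cnj a * z\<^sup>2"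
    using killing_fieldsD[OF assms(1)] by blast
  obtain a' b' where 2: "Re b' = 0" "\<And>z. z \<in> disc \<Longrightarrow> X2 z = a' + b' * z - cnj a' * z\<^sup>2"
    using killing_fieldsD[OF assms(2)] by blast
  show ?thesis
    by (rule killing_fieldsI[of _ "a - a'" "b - b'"]) (simp_all add: 1 2 algebra_simps)
qed

lemma killing_fields_cong:
  assumes "X \<in> killing_fields" "\<And>z. z \<in> disc \<Longrightarrow> X' z = X z"
  shows "X' \<in> killing_fields"
proof -
  obtain a b where "Re b = 0" "\<And>z. z \<in> disc \<Longrightarrow> X z = a + b * z - cnj a * z\<^sup>2"
    using killing_fieldsD[OF assms(1)] by blast
  then show ?thesis
    using assms(2) by (intro killing_fieldsI[of _ a b]) auto
qed

lemma killing_fields_zero: "(\<lambda>_. 0) \<in> killing_fields"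
  by (rule killing_fieldsI[of _ 0 0]) auto

text \<open>The adjoint action in coordinates. The new middle coefficient is purely imaginary
  because it equals minus its conjugate, given cnj b = - b.\<close>

lemma killing_fields_pullback:
  assumes X: "X \<in> killing_fields" and p: "p \<in> SU11"
  shows "vf_pullback (mobius p) X \<in> killing_fields"
proof -
  obtain a b where b: "Re b = 0" and X: "\<And>z. z \<in> disc \<Longrightarrow> X z = a + b * z - cnj a * z\<^sup>2"
    using killing_fieldsD[OF X] by blast
  obtain u v where p_eq: "p = (u, v)"
    by (cases p)
  have cb: "cnj b = - b"
    using b by (simp add: complex_eq_iff)
  show ?thesis
  proof (rule killing_fieldsI)
    fix z assume z: "z \<in> disc"
    define d where "d = cnj v * z + cnj u"
    have d: "d \<noteq> 0" "mob_den p z = d" "mob p z = (u * z + v) / d"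
      using mob_den_nonzero[OF p, of z] z by (simp_all add: mob_den_def mob_def p_eq d_def)
    have "vf_pullback (mobius p) X z = (a + b * ((u * z + v) / d) - cnj a * ((u * z + v) / d)\<^sup>2) * d\<^sup>2"
      using X[OF mob_disc[OF p z]] by (simp add: vf_pullback_mobius[OF p z] d)
    also have "\<dots> = a * d\<^sup>2 + b * (u * z + v) * d - cnj a * (u * z + v)\<^sup>2"
      using d(1) by (simp add: field_simps power2_eq_square)
    also have "\<dots> = (a * (cnj u)\<^sup>2 + b * v * cnj u - cnj a * v\<^sup>2)
        + (2 * a * cnj v * cnj u + b * (u * cnj u + v * cnj v) - 2 * cnj a * u * v) * z
        - cnj (a * (cnj u)\<^sup>2 + b * v * cnj u - cnj a * v\<^sup>2) * z\<^sup>2"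
      by (simp add: d_def cb algebra_simps power2_eq_square)
    finally show "vf_pullback (mobius p) X z = (a * (cnj u)\<^sup>2 + b * v * cnj u - cnj a * v\<^sup>2)
        + (2 * a * cnj v * cnj u + b * (u * cnj u + v * cnj v) - 2 * cnj a * u * v) * z
        - cnj (a * (cnj u)\<^sup>2 + b * v * cnj u - cnj a * v\<^sup>2) * z\<^sup>2" .
  next
    have "cnj (2 * a * cnj v * cnj u + b * (u * cnj u + v * cnj v) - 2 * cnj a * u * v) =
        - (2 * a * cnj v * cnj u + b * (u * cnj u + v * cnj v) - 2 * cnj a * u * v)"
      by (simp add: cb algebra_simps)
    moreover have "Re x = 0" if "cnj x = - x" for x
      using that by (simp add: complex_eq_iff)
    ultimately show "Re (2 * a * cnj v * cnj u + b * (u * cnj u + v * cnj v) - 2 * cnj a * u * v) = 0"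
      by blast
  qed
qed

section \<open>Coboundaries, cohomology and invariant fields\<close>

context PSU11_subgroup
begin

lemma coboundary_killing:
  assumes "X \<in> killing_fields" "\<gamma> \<in> \<Gamma>"
  shows "coboundary X \<gamma> \<in> killing_fields"
  using killing_fields_diff[OF killing_fields_pullback[OF assms(1)] assms(1)] lift[OF assms(2)]
  unfolding coboundary_def[abs_def] by auto

lemma coboundary_mult:
  assumes "\<gamma> \<in> \<Gamma>" "\<eta> \<in> \<Gamma>" and z: "z \<in> disc"
  shows "coboundary F (\<gamma> \<otimes>\<^bsub>PSU11\<^esub> \<eta>) z = vf_pullback \<eta> (coboundary F \<gamma>) z + coboundary F \<eta> z"
proof -
  obtain p q where p: "p \<in> SU11" "\<gamma> = mobius p" and q: "q \<in> SU11" "\<eta> = mobius q"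
    using lift assms(1,2) by metis
  have \<eta>z: "\<eta> z \<in> disc"
    by (rule maps_disc[OF assms(2) z])
  have d: "(\<gamma> has_field_derivative deriv \<gamma> (\<eta> z)) (at (\<eta> z))" "(\<eta> has_field_derivative deriv \<eta> z) (at z)"
    using mobius_has_derivative(1) p q z \<eta>z by (metis DERIV_imp_deriv)+
  have "((\<lambda>z. \<gamma> (\<eta> z)) has_field_derivative deriv \<gamma> (\<eta> z) * deriv \<eta> z) (at z)"
    by (rule DERIV_chain2[OF d])
  then have "((\<gamma> \<otimes>\<^bsub>PSU11\<^esub> \<eta>) has_field_derivative deriv \<gamma> (\<eta> z) * deriv \<eta> z) (at z)"
    by (rule has_field_derivative_transform_within_open[OF _ open_ball z]) (simp add: PSU11_mult_apply)
  then have "deriv (\<gamma> \<otimes>\<^bsub>PSU11\<^esub> \<eta>) z = deriv \<gamma> (\<eta> z) * deriv \<eta> z"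
    by (rule DERIV_imp_deriv)
  then show ?thesis
    by (simp add: coboundary_def vf_pullback_def PSU11_mult_apply[OF z] diff_divide_distrib)
qed

lemma coboundary_cocycle:
  assumes "\<And>\<gamma>. \<gamma> \<in> \<Gamma> \<Longrightarrow> coboundary F \<gamma> \<in> killing_fields"
  shows "coboundary F \<in> cocycles \<Gamma>"
  using assms coboundary_mult by (simp add: cocycles_def)

lemma coboundary_diff: "coboundary (\<lambda>z. F z - G z) \<gamma> z = coboundary F \<gamma> z - coboundary G \<gamma> z"
  by (simp add: coboundary_def vf_pullback_def diff_divide_distrib)

lemma equiv_cohomologous: "equiv (cocycles \<Gamma>) (cohomologous \<Gamma>)"
proof (rule equivI)
  show "cohomologous \<Gamma> \<subseteq> cocycles \<Gamma> \<times> cocycles \<Gamma>"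
    by (auto simp: cohomologous_def)
  have zero: "coboundary (\<lambda>_. 0) \<gamma> z = 0" for \<gamma> z
    by (simp add: coboundary_def vf_pullback_def)
  show "refl_on (cocycles \<Gamma>) (cohomologous \<Gamma>)"
    unfolding refl_on_def by (auto simp: cohomologous_def zero intro!: bexI[OF _ killing_fields_zero])
  have minus: "(\<lambda>z. 0 - X z) \<in> killing_fields" "coboundary (\<lambda>z. 0 - X z) \<gamma> z = - coboundary X \<gamma> z"
    if "X \<in> killing_fields" for X \<gamma> z
    using killing_fields_diff[OF killing_fields_zero that] coboundary_diff[of "\<lambda>_. 0" X] zero by simp_all
  show "sym (cohomologous \<Gamma>)"
  proof (rule symI)
    fix c c' assume cc': "(c, c') \<in> cohomologous \<Gamma>"
    then obtain X where X: "X \<in> killing_fields" "\<forall>\<gamma>\<in>\<Gamma>. \<forall>z\<in>disc. c' \<gamma> z - c \<gamma> z = coboundary X \<gamma> z"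
      by (auto simp: cohomologous_def)
    have "c \<gamma> z - c' \<gamma> z = coboundary (\<lambda>z. 0 - X z) \<gamma> z" if "\<gamma> \<in> \<Gamma>" "z \<in> disc" for \<gamma> z
      unfolding minus(2)[OF X(1)] using X(2) that by (metis minus_diff_eq)
    with minus(1)[OF X(1)] cc' show "(c', c) \<in> cohomologous \<Gamma>"
      unfolding cohomologous_def by blast
  qed
  show "trans (cohomologous \<Gamma>)"
  proof (rule transI)
    fix c1 c2 c3 assume c: "(c1, c2) \<in> cohomologous \<Gamma>" "(c2, c3) \<in> cohomologous \<Gamma>"
    obtain X where X: "X \<in> killing_fields" "\<forall>\<gamma>\<in>\<Gamma>. \<forall>z\<in>disc. c2 \<gamma> z - c1 \<gamma> z = coboundary X \<gamma> z"
      using c(1) by (auto simp: cohomologous_def)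
    obtain X' where X': "X' \<in> killing_fields" "\<forall>\<gamma>\<in>\<Gamma>. \<forall>z\<in>disc. c3 \<gamma> z - c2 \<gamma> z = coboundary X' \<gamma> z"
      using c(2) by (auto simp: cohomologous_def)
    have "c3 \<gamma> z - c1 \<gamma> z = coboundary (\<lambda>z. X z - (0 - X' z)) \<gamma> z" if "\<gamma> \<in> \<Gamma>" "z \<in> disc" for \<gamma> z
    proof -
      have "c3 \<gamma> z - c1 \<gamma> z = (c3 \<gamma> z - c2 \<gamma> z) + (c2 \<gamma> z - c1 \<gamma> z)"
        by simp
      also have "\<dots> = coboundary X' \<gamma> z + coboundary X \<gamma> z"
        using X(2) X'(2) that by simp
      finally show ?thesis
        unfolding coboundary_diff[of X] minus(2)[OF X'(1)] by simp
    qed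
    moreover have "(\<lambda>z. X z - (0 - X' z)) \<in> killing_fields"
      by (rule killing_fields_diff[OF X(1) minus(1)[OF X'(1)]])
    ultimately show "(c1, c3) \<in> cohomologous \<Gamma>"
      using c unfolding cohomologous_def by blast
  qed
qed

text \<open>By cocompactness an invariant continuous vector field is bounded in the hyperbolic metric, hence
  vanishes on the circle in Euclidean terms.\<close>

lemma invariant_zero_boundary:
  assumes cocompact: "cocompact_in_PSU11 \<Gamma>" and v: "continuous_on disc v"
    and inv: "\<And>\<gamma> z. \<gamma> \<in> \<Gamma> \<Longrightarrow> z \<in> disc \<Longrightarrow> coboundary v \<gamma> z = 0"
  shows "has_L2_boundary v (\<lambda>_. 0)"
proof -
  obtain k where k: "k > 0" "\<And>z. z \<in> disc \<Longrightarrow> \<exists>\<gamma>\<in>\<Gamma>. height (\<gamma> z) \<ge> k"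
    using cocompact_height[OF cocompact] by blast
  define S where "S = {z. k \<le> height z}"
  have S_disc: "S \<subseteq> disc"
    using k(1) height_pos_iff by (force simp: S_def)
  moreover have "closed S"
    unfolding S_def by (intro closed_Collect_le continuous_intros)
  ultimately have "compact S"
    using compact_eq_bounded_closed bounded_subset[OF bounded_ball] by blast
  then have "bounded (v ` S)"
    using continuous_on_subset[OF v S_disc] by (intro compact_imp_bounded compact_continuous_image)
  then obtain B where B: "B > 0" "\<forall>x\<in>v ` S. cmod x \<le> B"
    unfolding bounded_pos by blast
  have bound: "cmod (v z) \<le> B / k * height z" if z: "z \<in> disc" for z
  proof -
    obtain \<gamma> where \<gamma>: "\<gamma> \<in> \<Gamma>" "height (\<gamma> z) \<ge> k"
      using k(2)[OF z] by blast
    obtain p where p: "p \<in> SU11" "\<gamma> = mobius p"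
      using lift[OF \<gamma>(1)] by blast
    have d: "cmod (mob_den p z) > 0"
      using mob_den_nonzero[OF p(1), of z] z by simp
    have hk: "k \<le> height (mob p z)"
      using \<gamma>(2) by (simp only: p(2) mobius_eq_mob[OF z])
    have "v z = v (mob p z) * (mob_den p z)\<^sup>2"
      using inv[OF \<gamma>(1) z] by (simp add: coboundary_def p vf_pullback_mobius[OF p(1) z])
    then have "cmod (v z) = cmod (v (mob p z)) * (cmod (mob_den p z))\<^sup>2"
      by (simp add: norm_mult norm_power)
    also have "\<dots> \<le> B * (height z / k)"
    proof (intro mult_mono)
      show "cmod (v (mob p z)) \<le> B"
        using B(2) hk by (auto simp: S_def)
      have "k \<le> height z / (cmod (mob_den p z))\<^sup>2"
        using hk z by (simp only: height_mob[OF p(1) less_imp_le] mem_ball dist_0_norm)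
      then show "(cmod (mob_den p z))\<^sup>2 \<le> height z / k"
        using d k(1) by (simp add: field_simps)
    qed (use B in auto)
    finally show ?thesis
      by simp
  qed
  let ?U = "\<lambda>z. if z \<in> disc then v z else 0"
  have "continuous_on (cball 0 1) ?U"
    unfolding continuous_on_eq_continuous_within
  proof
    fix p :: complex assume p: "p \<in> cball 0 1"
    show "continuous (at p within cball 0 1) ?U"
    proof (cases "p \<in> disc")
      case True
      have "continuous_on disc ?U"
        using v by (rule continuous_on_eq) simp
      then show ?thesis
        using True by (simp add: continuous_on_eq_continuous_at continuous_at_imp_continuous_at_within)
    next
      case False
      then have p1: "cmod p = 1"
        using p by auto
      have "((\<lambda>z. B / k * height z) \<longlongrightarrow> B / k * height p) (at p within cball 0 1)"
        by (intro tendsto_intros)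
      then have lim: "((\<lambda>z. B / k * height z) \<longlongrightarrow> 0) (at p within cball 0 1)"
        by (simp add: p1)
      have "cmod (?U z) \<le> B / k * height z" if "z \<in> cball 0 1" for z
        using bound[of z] that B(1) k(1) by (simp add: power_le_one)
      then have "eventually (\<lambda>z. cmod (?U z) \<le> B / k * height z) (at p within cball 0 1)"
        unfolding eventually_at_filter by (intro always_eventually) blast
      then have "(?U \<longlongrightarrow> 0) (at p within cball 0 1)"
        by (rule Lim_null_comparison[OF _ lim])
      then show ?thesis
        using False by (simp add: continuous_within)
    qed
  qed
  then show ?thesis
    by (rule has_L2_boundaryI) auto
qed

end

context PSU11_cocycle
begin

text \<open>One vanishing argument gives both the primitive and the automorphy of its (2,0)-part.
  The defect \<open>D\<close> has zero boundary values and dbar-derivative s^2 cnj g, where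
  \<open>g\<close> is 3 times the defect of \<open>G\<close> as a quadratic differential; once
  \<open>D\<close> vanishes, so does \<open>g\<close>.\<close>

lemma harmonic_primitive:
  obtains Y where "continuous_on (sphere 0 1) Y" "tangential Y" "has_L2_boundary (F_op Y) Y"
    "\<And>\<gamma> z. \<gamma> \<in> \<Gamma> \<Longrightarrow> z \<in> disc \<Longrightarrow> coboundary (F_op Y) \<gamma> z = c \<gamma> z"
    "(\<lambda>z. if z \<in> disc then part_2_0 (F_op Y) z else 0) \<in> HQD \<Gamma>"
proof -
  obtain Y where Y: "continuous_on (sphere 0 1) Y" and tan: "\<And>w. cmod w = 1 \<Longrightarrow> Re (cnj w * Y w) = 0"
    and eq: "\<And>p w. p \<in> SU11 \<Longrightarrow> mobius p \<in> \<Gamma> \<Longrightarrow> cmod w = 1 \<Longrightarrow> Y (mob p w) * (mob_den p w)\<^sup>2 - Y w = C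
        (mobius p) w"
    using boundary_field by blast
  define G where "G = conj_Cauchy 4 Y"
  have G: "G holomorphic_on disc"
    unfolding G_def by (intro conj_Cauchy_holomorphic Y) simp
  define U where "U z = (if z \<in> disc then F_op Y z else Y z)" for z
  have U: "continuous_on (cball 0 1) U"
    unfolding U_def by (rule continuous_on_F_op_extension[OF Y])
  have "tangential Y"
    unfolding tangential_def
  proof (intro exI AE_I2)
    fix w assume "w \<in> space circle_measure"
    then have w: "cmod w = 1"
      by simp
    have "cnj w * Y w = of_real (Im (cnj w * Y w)) * \<i>"
      using tan[OF w] by (simp add: complex_eq_iff)
    then have "w * (cnj w * Y w) = w * (of_real (Im (cnj w * Y w)) * \<i>)"
      by (rule arg_cong)
    then show "Y w = of_real (Im (cnj w * Y w)) * (\<i> * w)"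
      by (simp add: mult.assoc[symmetric] circle_cnj[OF w]) (simp add: mult_ac)
  qed
  moreover have bd: "has_L2_boundary (F_op Y) Y"
    by (rule has_L2_boundaryI[OF U]) (auto simp: U_def)
  have main: "coboundary (F_op Y) (mobius p) z = C (mobius p) z \<and> G (mob p z) / (mob_den p z) ^ 4 = G z"
    if p: "p \<in> SU11" and \<gamma>: "mobius p \<in> \<Gamma>" and z: "z \<in> disc" for p z
  proof -
    define D where "D z = vf_pullback (mobius p) (F_op Y) z - F_op Y z - C (mobius p) z" for z
    define g where "g z = 3 * (G (mob p z) / (mob_den p z) ^ 4 - G z)" for z
    have "\<exists>f'. (mob p has_field_derivative f') (at x)" if "x \<in> disc" for x
      using mob_has_derivative[OF p, of x] that by auto
    then have "mob p holomorphic_on disc"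
      unfolding holomorphic_on_open[OF open_ball] by blast
    moreover have "mob_den p holomorphic_on disc"
      unfolding mob_den_def by (intro holomorphic_intros)
    moreover have "mob p ` disc \<subseteq> disc"
      using mob_disc[OF p] by blast
    ultimately have g: "g holomorphic_on disc"
      unfolding g_def using mob_den_nonzero[OF p]
      by (intro holomorphic_intros G holomorphic_on_compose_gen[OF _ G, unfolded o_def]) auto
    have dD: "\<exists>a. has_wirtinger D a ((1 - z * cnj z) ^ 2 * cnj (g z)) (at z)" if z: "z \<in> disc" for z
    proof -
      let ?d = "mob_den p z"
      have d: "?d \<noteq> 0"
        using mob_den_nonzero[OF p, of z] z by simp
      obtain a where "has_wirtinger (F_op Y) a (cnj (3 * (1 - mob p z * cnj (mob p z)) ^ 2 * G (mob p
          z))) (at (mob p z))"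
        using F_op_harmonic(2)[OF Y mob_disc[OF p z]] unfolding G_def by blast
      from has_wirtinger_pullback[OF p z this] obtain a where
        a: "has_wirtinger (vf_pullback (mobius p) (F_op Y)) a
          (cnj (3 * (1 - mob p z * cnj (mob p z)) ^ 2 * G (mob p z)) * ?d\<^sup>2 / cnj (?d\<^sup>2)) (at z)"
        by blast
      obtain a' where a': "has_wirtinger (F_op Y) a' (cnj (3 * (1 - z * cnj z) ^ 2 * G z)) (at z)"
        using F_op_harmonic(2)[OF Y z] unfolding G_def by blast
      obtain a'' where "(C (mobius p) has_field_derivative a'') (at z)"
        using C_holomorphic[of "mobius p" disc] z unfolding holomorphic_on_open[OF open_ball] by blast
      from has_wirtinger_diff[OF has_wirtinger_diff[OF a a'] has_wirtinger_field[OF this]]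
      have w: "has_wirtinger D (a - a' - a'')
          (cnj (3 * (1 - mob p z * cnj (mob p z)) ^ 2 * G (mob p z)) * ?d\<^sup>2 / cnj (?d\<^sup>2)
            - cnj (3 * (1 - z * cnj z) ^ 2 * G z) - 0) (at z)"
        unfolding D_def[abs_def] .
      \<comment> \<open>The height at the image contributes 1 / (d cnj d)^2 and the pullback d^2 /
        cnj d^2. Together they leave 1 / cnj d^4, the conjugate of the weight of a quadratic
        differential.\<close>
      have alg: "cnj (3 * (s / (d * cnj d)) ^ 2 * x) * d\<^sup>2 / cnj (d\<^sup>2) - cnj (3 * s ^ 2 * y) - 0 =
          s ^ 2 * cnj (3 * (x / d ^ 4 - y))" if "d \<noteq> 0" "cnj s = s" for s d x y :: complex
        using that by (simp add: field_simps power2_eq_square eval_nat_numeral)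
      have "cnj (1 - z * cnj z) = 1 - z * cnj z" "cmod z \<le> 1"
        using z by (simp_all add: mult.commute)
      from w[unfolded one_minus_mob[OF p this(2)] alg[OF d this(1)]] show ?thesis
        unfolding g_def by blast
    qed
    have bdD: "has_L2_boundary D (\<lambda>_. 0)"
    proof (rule has_L2_boundaryI)
      show "continuous_on (cball 0 1) (\<lambda>z. U (mob p z) * (mob_den p z)\<^sup>2 - U z - C (mobius p) z)"
        using mob_cball[OF p]
        by (intro continuous_intros U continuous_on_C continuous_on_mob_den
            continuous_on_compose2[OF U continuous_on_mob[OF p]]) auto
      show "D z = U (mob p z) * (mob_den p z)\<^sup>2 - U z - C (mobius p) z" if "z \<in> disc" for z
        using that mob_disc[OF p that] by (simp add: D_def U_def vf_pullback_mobius[OF p])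
      show "0 = U (mob p w) * (mob_den p w)\<^sup>2 - U w - C (mobius p) w" if "w \<in> sphere 0 1" for w
        using that eq[OF p \<gamma>, of w] mob_sphere[OF p, of w] by (simp add: U_def)
    qed
    have D0: "D z = 0" if "z \<in> disc" for z
      using zero_L2_boundary_imp_zero[OF g dD bdD that] .
    \<comment> \<open>Since \<open>D\<close> is identically zero on the disc, uniqueness of
      Wirtinger derivatives transfers the vanishing to \<open>g\<close>.\<close>
    have "has_wirtinger D 0 0 (at z)"
      using has_derivative_cong_open[OF open_ball z, of D "\<lambda>_. 0"] D0 by simp
    with dD[OF z] has_wirtinger_unique(2) have "(1 - z * cnj z) ^ 2 * cnj (g z) = 0"
      by blast
    then have "g z = 0"
      using one_minus_mult_cnj_nonzero[OF z] by simp
    then have "G (mob p z) / (mob_den p z) ^ 4 = G z"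
      unfolding g_def by (simp only: mult_eq_0_iff right_minus_eq) simp
    then show ?thesis
      using D0[OF z] by (simp add: D_def coboundary_def)
  qed
  have "coboundary (F_op Y) \<gamma> z = c \<gamma> z" if "\<gamma> \<in> \<Gamma>" "z \<in> disc" for \<gamma> z
    using lift[OF that(1)] main that kcoeff(2)[OF that] by metis
  moreover have "(\<lambda>z. if z \<in> disc then part_2_0 (F_op Y) z else 0) \<in> HQD \<Gamma>" (is "?q \<in> _")
    unfolding HQD_def mem_Collect_eq
  proof (intro conjI ballI allI impI)
    have "(\<lambda>z. 24 * G z) holomorphic_on disc"
      by (intro holomorphic_intros G)
    then show "?q holomorphic_on disc"
      by (rule holomorphic_transform) (simp add: part_2_0_F_op[OF Y] G_def)
    fix \<gamma> z assume \<gamma>: "\<gamma> \<in> \<Gamma>" and z: "z \<in> disc"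
    obtain p where p: "p \<in> SU11" "\<gamma> = mobius p"
      using lift[OF \<gamma>] by blast
    have "mob_den p z \<noteq> 0"
      using mob_den_nonzero[OF p(1), of z] z by simp
    moreover from this have "G (mob p z) = G z * (mob_den p z) ^ 4"
      using main[OF p(1) _ z] \<gamma> p(2) by (auto simp: divide_eq_eq)
    moreover have "(1 / (mob_den p z)\<^sup>2)\<^sup>2 = 1 / (mob_den p z) ^ 4"
      by (simp add: power_divide)
    ultimately show "?q (\<gamma> z) * (deriv \<gamma> z)\<^sup>2 = ?q z"
      using z mob_disc[OF p(1) z]
      by (simp add: p(2) mobius_eq_mob mobius_has_derivative(2)[OF p(1)] part_2_0_F_op[OF Y] G_def)
  qed simp
  ultimately show thesis
    using that Y bd by blast
qed

end

section \<open>Independence of the choices in both maps\<close>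

lemma part_2_0_add_killing:
  assumes "has_wirtinger \<xi> a b (at z)" "X \<in> killing_fields" and z: "z \<in> disc"
    and f: "\<And>z. z \<in> disc \<Longrightarrow> f z = \<xi> z + X z"
  shows "part_2_0 f z = part_2_0 \<xi> z"
proof -
  obtain x where "(X has_field_derivative x) (at z)"
    using killing_fields_holomorphic[OF assms(2) z] by blast
  from has_wirtinger_add[OF assms(1) has_wirtinger_field[OF this]]
  have "has_wirtinger f (a + x) b (at z)"
    using has_derivative_cong_open[where f = f and g = "\<lambda>z. \<xi> z + X z", OF open_ball z f] by simp
  then show ?thesis
    using part_2_0_eq[OF z] assms(1) by metis
qed

lemma equal_part_2_0_imp_killing:
  assumes "smooth_on disc \<xi>" "smooth_on disc \<xi>'" and eq: "\<And>z. z \<in> disc \<Longrightarrow> part_2_0 \<xi> z = part_2_0 \<xi>' z"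
    and "has_L2_boundary \<xi> Y" "has_L2_boundary \<xi>' Y'" and tan: "tangential Y" "tangential Y'"
  shows "(\<lambda>z. \<xi> z - \<xi>' z) \<in> killing_fields"
proof (rule tangential_holomorphic_killing)
  have "\<exists>a. ((\<lambda>z. \<xi> z - \<xi>' z) has_field_derivative a) (at z)" if z: "z \<in> disc" for z
  proof -
    obtain a b where ab: "has_wirtinger \<xi> a b (at z)"
      using differentiable_has_wirtinger[OF smooth_on_differentiable[OF open_ball assms(1) z]] by blast
    obtain a' b' where ab': "has_wirtinger \<xi>' a' b' (at z)"
      using differentiable_has_wirtinger[OF smooth_on_differentiable[OF open_ball assms(2) z]] by blast
    have "b = b'"
      using eq[OF z] conf_factor_pos[OF z] by (simp add: part_2_0_eq[OF z ab] part_2_0_eq[OF z ab'])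
    then show ?thesis
      using has_wirtinger_diff[OF ab ab'] by (auto simp: has_field_derivative_def)
  qed
  then show "(\<lambda>z. \<xi> z - \<xi>' z) holomorphic_on disc"
    unfolding holomorphic_on_open[OF open_ball] by blast
  show "has_L2_boundary (\<lambda>z. \<xi> z - \<xi>' z) (\<lambda>w. Y w - Y' w)"
    by (rule has_L2_boundary_diff[OF assms(4,5)])
  obtain f f' :: "complex \<Rightarrow> real" where
    "AE w in circle_measure. Y w = of_real (f w) * (\<i> * w)" "AE w in circle_measure. Y' w = of_real (f'
        w) * (\<i> * w)"
    using tan by (auto simp: tangential_def)
  then have "AE w in circle_measure. Y w - Y' w = of_real (f w - f' w) * (\<i> * w)"
    by eventually_elim (simp add: algebra_simps)
  then show "tangential (\<lambda>w. Y w - Y' w)"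
    unfolding tangential_def by (intro exI[of _ "\<lambda>w. f w - f' w"])
qed

context PSU11_cocycle
begin

text \<open>The field \<psi> - F_op Y - X is invariant and therefore has boundary value 0. Hence Y'
  = Y + P almost everywhere, where \<open>P\<close> is the polynomial that extends \<open>X\<close>
  to the circle, and \<open>F_op\<close> is additive and reproduces \<open>P\<close>.\<close>

lemma F_op_unique_up_to_killing:
  assumes Y: "continuous_on (sphere 0 1) Y" "has_L2_boundary (F_op Y) Y"
    "\<And>\<gamma> z. \<gamma> \<in> \<Gamma> \<Longrightarrow> z \<in> disc \<Longrightarrow> coboundary (F_op Y) \<gamma> z = c \<gamma> z"
    and c': "(c, c') \<in> cohomologous \<Gamma>"
    and \<psi>: "continuous_on disc \<psi>" "\<And>\<gamma> z. \<gamma> \<in> \<Gamma> \<Longrightarrow> z \<in> disc \<Longrightarrow> coboundary \<psi> \<gamma> z = c' \<gamma> z" "has_L2_boundary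
        \<psi> Y'"
  obtains X where "X \<in> killing_fields" "\<And>z. z \<in> disc \<Longrightarrow> F_op Y' z = F_op Y z + X z"
proof -
  obtain X where X: "X \<in> killing_fields" "\<And>\<gamma> z. \<gamma> \<in> \<Gamma> \<Longrightarrow> z \<in> disc \<Longrightarrow> c' \<gamma> z - c \<gamma> z = coboundary X \<gamma> z"
    using c' by (auto simp: cohomologous_def)
  obtain a b where ab: "\<And>z. z \<in> disc \<Longrightarrow> X z = a + b * z - cnj a * z\<^sup>2"
    using killing_fieldsD[OF X(1)] by blast
  define P where "P z = a + b * z - cnj a * z\<^sup>2" for z
  have P: "continuous_on S P" "P holomorphic_on S" for S
    unfolding P_def by (intro continuous_intros holomorphic_intros)+
  have XP: "has_L2_boundary X P"
    by (rule has_L2_boundaryI[OF P(1)]) (auto simp: P_def ab)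
  define v where "v z = \<psi> z - F_op Y z - X z" for z
  have "continuous_on disc (F_op Y)" "continuous_on disc X"
    using Y(2) XP by (auto simp: has_L2_boundary_def)
  then have "continuous_on disc v"
    unfolding v_def by (intro continuous_intros \<psi>(1))
  moreover have "coboundary v \<gamma> z = 0" if "\<gamma> \<in> \<Gamma>" "z \<in> disc" for \<gamma> z
    unfolding v_def using \<psi>(2)[OF that] Y(3)[OF that] X(2)[OF that] by (simp add: coboundary_diff)
  ultimately have "has_L2_boundary v (\<lambda>_. 0)"
    by (rule invariant_zero_boundary[OF cocompact])
  moreover have "has_L2_boundary v (\<lambda>w. Y' w - Y w - P w)"
    unfolding v_def[abs_def] by (intro has_L2_boundary_diff \<psi>(3) Y(2) XP)
  ultimately have "AE w in circle_measure. 0 = Y' w - Y w - P w"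
    by (rule has_L2_boundary_unique)
  then have AE: "AE w in circle_measure. Y' w = Y w + P w"
    by eventually_elim (simp add: algebra_simps)
  have "F_op Y' z = F_op Y z + X z" if z: "z \<in> disc" for z
  proof -
    have "F_op Y' z = F_op (\<lambda>w. Y w + P w) z"
      using \<psi>(3) by (intro F_op_cong_AE AE z continuous_intros Y(1) P) (auto simp: has_L2_boundary_def
          L2_circle_def)
    also have "\<dots> = F_op Y z + F_op P z"
      by (intro F_op_add Y(1) P z)
    also have "F_op P z = X z"
      by (simp add: F_op_holomorphic[OF P z] ab[OF z] P_def)
    finally show ?thesis .
  qed
  with X(1) that show thesis
    by blast
qed

lemma Phi_Psi_class: "Phi \<Gamma> (Psi \<Gamma> (cohomologous \<Gamma> `` {c})) = cohomologous \<Gamma> `` {c}"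
proof -
  let ?h = "cohomologous \<Gamma> `` {c}"
  have ch: "c \<in> ?h"
    using equiv_cohomologous cocycle by (rule equiv_class_self)
  have h: "?h \<in> H1 \<Gamma>"
    unfolding H1_def using cocycle by (rule quotientI)
  obtain Y where Y: "continuous_on (sphere 0 1) Y" "tangential Y" "has_L2_boundary (F_op Y) Y"
    "\<And>\<gamma> z. \<gamma> \<in> \<Gamma> \<Longrightarrow> z \<in> disc \<Longrightarrow> coboundary (F_op Y) \<gamma> z = c \<gamma> z"
    and q: "(\<lambda>z. if z \<in> disc then part_2_0 (F_op Y) z else 0) \<in> HQD \<Gamma>" (is "?q \<in> _")
    using harmonic_primitive by metis
  have harm: "harmonic_field_on disc (F_op Y)"
    by (rule F_op_harmonic(1)[OF Y(1)])
  then have smooth: "smooth_on disc (F_op Y)"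
    by (simp add: harmonic_field_on_def)
  have "Psi \<Gamma> ?h = (THE q. \<exists>c'\<in>?h. \<exists>\<psi> Y'. smooth_on disc \<psi> \<and>
      (\<forall>\<gamma>\<in>\<Gamma>. \<forall>z\<in>disc. coboundary \<psi> \<gamma> z = c' \<gamma> z) \<and> has_L2_boundary \<psi> Y' \<and> tangential Y' \<and>
      q = (\<lambda>z. if z \<in> disc then part_2_0 (F_op Y') z else 0))"
    using h by (simp add: Psi_def)
  also have "\<dots> = ?q"
  proof (rule the_equality)
    show "\<exists>c'\<in>?h. \<exists>\<psi> Y'. smooth_on disc \<psi> \<and>
        (\<forall>\<gamma>\<in>\<Gamma>. \<forall>z\<in>disc. coboundary \<psi> \<gamma> z = c' \<gamma> z) \<and> has_L2_boundary \<psi> Y' \<and> tangential Y' \<and>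
        ?q = (\<lambda>z. if z \<in> disc then part_2_0 (F_op Y') z else 0)"
      using smooth Y by (intro bexI[OF _ ch] exI[of _ "F_op Y"] exI[of _ Y]) auto
    \<comment> \<open>Uniqueness ranges over representatives \<open>c'\<close> of the class as well
      as over primitives and their boundary values. All of these change \<open>F_op Y\<close> by a
      Killing field only, which the (2,0)-part does not see.\<close>
    fix q' assume "\<exists>c'\<in>?h. \<exists>\<psi> Y'. smooth_on disc \<psi> \<and>
        (\<forall>\<gamma>\<in>\<Gamma>. \<forall>z\<in>disc. coboundary \<psi> \<gamma> z = c' \<gamma> z) \<and> has_L2_boundary \<psi> Y' \<and> tangential Y' \<and>
        q' = (\<lambda>z. if z \<in> disc then part_2_0 (F_op Y') z else 0)"
    then obtain c' \<psi> Y' where "c' \<in> ?h" and \<psi>: "smooth_on disc \<psi>"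
      "\<forall>\<gamma>\<in>\<Gamma>. \<forall>z\<in>disc. coboundary \<psi> \<gamma> z = c' \<gamma> z" "has_L2_boundary \<psi> Y'"
      and q': "q' = (\<lambda>z. if z \<in> disc then part_2_0 (F_op Y') z else 0)"
      by (elim bexE exE conjE) (rule that)
    then have c': "(c, c') \<in> cohomologous \<Gamma>"
      by simp
    obtain X where X: "X \<in> killing_fields" "\<And>z. z \<in> disc \<Longrightarrow> F_op Y' z = F_op Y z + X z"
      using F_op_unique_up_to_killing[OF Y(1,3,4) c' smooth_on_continuous_on[OF open_ball \<psi>(1)] _ \<psi>(3)] \<psi>(2)
      by blast
    have "part_2_0 (F_op Y') z = part_2_0 (F_op Y) z" if z: "z \<in> disc" for z
      using F_op_harmonic(2)[OF Y(1) z] part_2_0_add_killing[OF _ X(1) z X(2)] by blast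
    then show "q' = ?q"
      by (auto simp: q')
  qed
  finally have Psi: "Psi \<Gamma> ?h = ?q" .
  have killing: "coboundary (F_op Y) \<gamma> \<in> killing_fields" if "\<gamma> \<in> \<Gamma>" for \<gamma>
    using killing_fields_cong[of "c \<gamma>"] cocycle that Y(4)[OF that] by (auto simp: cocycles_def)
  \<comment> \<open>The two cocycles need only agree on the disc for elements of \<Gamma>; as
    functions they may differ elsewhere, so they are related through the zero Killing field.\<close>
  have class_eq: "cohomologous \<Gamma> `` {coboundary (F_op Y)} = ?h"
  proof -
    have "c' \<gamma> z - c \<gamma> z = coboundary (\<lambda>_. 0) \<gamma> z" if "c' = coboundary (F_op Y)" "\<gamma> \<in> \<Gamma>" "z \<in> disc" for
        c' \<gamma> z
      using Y(4) that by (simp add: coboundary_def[of "\<lambda>_. 0"] vf_pullback_def)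
    then have "(c, coboundary (F_op Y)) \<in> cohomologous \<Gamma>"
      unfolding cohomologous_def using cocycle coboundary_cocycle[OF killing] killing_fields_zero by blast
    then show ?thesis
      using equiv_class_eq[OF equiv_cohomologous] by metis
  qed
  have "Phi \<Gamma> ?q = (THE h. \<exists>\<xi> Y'. harmonic_field_on disc \<xi> \<and> (\<forall>z\<in>disc. part_2_0 \<xi> z = ?q z) \<and>
      has_L2_boundary \<xi> Y' \<and> tangential Y' \<and> h = cohomologous \<Gamma> `` {coboundary \<xi>})"
    using q by (simp only: Phi_def restrict_apply if_True)
  also have "\<dots> = ?h"
  proof (rule the_equality)
    show "\<exists>\<xi> Y'. harmonic_field_on disc \<xi> \<and> (\<forall>z\<in>disc. part_2_0 \<xi> z = ?q z) \<and>
        has_L2_boundary \<xi> Y' \<and> tangential Y' \<and> ?h = cohomologous \<Gamma> `` {coboundary \<xi>}"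
      using harm Y class_eq by (intro exI[of _ "F_op Y"] exI[of _ Y]) auto
    fix h' assume "\<exists>\<xi> Y'. harmonic_field_on disc \<xi> \<and> (\<forall>z\<in>disc. part_2_0 \<xi> z = ?q z) \<and>
        has_L2_boundary \<xi> Y' \<and> tangential Y' \<and> h' = cohomologous \<Gamma> `` {coboundary \<xi>}"
    then obtain \<xi> Y' where "harmonic_field_on disc \<xi>" "\<forall>z\<in>disc. part_2_0 \<xi> z = ?q z"
      and bd: "has_L2_boundary \<xi> Y'" "tangential Y'" and h': "h' = cohomologous \<Gamma> `` {coboundary \<xi>}"
      by (elim exE conjE) (rule that)
    then have \<xi>: "smooth_on disc \<xi>" "\<And>z. z \<in> disc \<Longrightarrow> part_2_0 \<xi> z = part_2_0 (F_op Y) z"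
      by (simp_all add: harmonic_field_on_def)
    have X: "(\<lambda>z. \<xi> z - F_op Y z) \<in> killing_fields" (is "?X \<in> _")
      by (rule equal_part_2_0_imp_killing[OF \<xi>(1) smooth \<xi>(2) bd(1) Y(3) bd(2) Y(2)])
    have "coboundary \<xi> \<gamma> \<in> killing_fields" if "\<gamma> \<in> \<Gamma>" for \<gamma>
    proof -
      have "(\<lambda>z. coboundary ?X \<gamma> z - (0 - coboundary (F_op Y) \<gamma> z)) \<in> killing_fields"
        using coboundary_killing[OF X that] killing[OF that]
        by (intro killing_fields_diff killing_fields_zero) auto
      then show ?thesis
        by (rule killing_fields_cong) (simp add: coboundary_diff)
    qed
    then have "(coboundary (F_op Y), coboundary \<xi>) \<in> cohomologous \<Gamma>"
      unfolding cohomologous_def using coboundary_cocycle killing X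
      by (auto intro!: bexI[OF _ X] simp: coboundary_diff)
    then show "h' = ?h"
      using equiv_class_eq[OF equiv_cohomologous] class_eq h' by metis
  qed
  finally show ?thesis
    by (simp only: Psi)
qed

end

theorem corollary5:
  fixes \<Gamma> :: "(complex \<Rightarrow> complex) set"
  assumes "subgroup \<Gamma> PSU11"
    and "discrete_in_PSU11 \<Gamma>"
    and "cocompact_in_PSU11 \<Gamma>"
  shows "compose (H1 \<Gamma>) (Phi \<Gamma>) (Psi \<Gamma>) = (\<lambda>h\<in>H1 \<Gamma>. h)"
proof
  fix h
  show "compose (H1 \<Gamma>) (Phi \<Gamma>) (Psi \<Gamma>) h = (\<lambda>h\<in>H1 \<Gamma>. h) h"
  proof (cases "h \<in> H1 \<Gamma>")
    case True
    then obtain c where c: "c \<in> cocycles \<Gamma>" "h = cohomologous \<Gamma> `` {c}"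
      by (auto simp: H1_def elim: quotientE)
    interpret PSU11_cocycle \<Gamma> c
      by (intro PSU11_cocycle.intro PSU11_subgroup.intro PSU11_cocycle_axioms.intro assms c(1))
    show ?thesis
      using True Phi_Psi_class by (simp add: compose_eq c(2))
  \<comment> \<open>Outside \<open>H1 \<Gamma>\<close> both sides are
    \<open>undefined\<close>.\<close>
  qed (simp add: compose_def)
qed

end
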